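(* Under the teacher-student framework, suppose we choose $L=L_0$, $s\ge s_0$ and $N\ge\max_{1\le i\le L_0}p_{0,i}/(12p)$ for the network family $\mathcal F(L,\boldsymbol p,s)$ with $\boldsymbol p=(12pN,\dots,12pN)$, that $B_0\ge\|\theta_0\|_\infty$ (under the uniform prior), and that $\max\{Ls\log(pN),\,s\log(nL/s)\}=o(n)$. Then the variational posterior $\widehat q$ satisfies $$\int d^2(P_\theta,P_0)\,\widehat q(\theta)\,d\theta\le C''\left(\frac{s\log(nL/s)+Ls\log(pN)}{n}\log^{2\delta}(n)\right)$$ with dominating probability, for some constant $C''>0$ and any $\delta>1$.
   Context: Model. The observations $D_i=(X_i,Y_i)$, $i=1,\dots,n$, are i.i.d. with $X_i\sim\mathcal U([-1,1]^p)$ and $Y_i=f_0(X_i)+\epsilon_i$, where $\epsilon_i\sim N(0,\sigma_\epsilon^2)$ are i.i.d., $\sigma_\epsilon>0$ is a known constant and $f_0:[-1,1]^p\to\mathbb R$ is the unknown true function. Write $\boldsymbol D^{(n)}=(D_1,\dots,D_n)$. $P_0$ is the true distribution, with density $p_0(D_i)=\phi([Y_i-f_0(X_i)]/\sigma_\epsilon)/\sigma_\epsilon$ ($\phi$ the standard normal pdf); $P_\theta,p_\theta$ are the same with $f_0$ replaced by $f_\theta$. Densities of $\boldsymbol D^{(n)}$ are products. Networks. An $(L-1)$-hidden-layer ReLU network with hidden widths $\boldsymbol p=(p_1,\dots,p_{L-1})$, input dimension $p$ and scalar output is $f_\theta(X)=W_L\sigma_{b_{L-1}}(W_{L-1}\cdots\sigma_{b_1}(W_1X))+b_L$,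 where $W_i$ are weight matrices, $b_i$ bias vectors, $\sigma(x)=\max(0,x)$ and $\sigma_b(y)_i=\sigma(y_i-b_i)$. The vector $\theta=(\theta_1,\dots,\theta_H)$ collects all entries of the $W_i$ and $b_i$. $\mathcal F(L,\boldsymbol p,s)=\{f_\theta:\|\theta\|_0\le s\}$. Teacher-student framework. The true $f_0$ is exactly an unknown fixed sparse ReLU network (the teacher): $f_0\in\mathcal F(L_0,\boldsymbol p_0,s_0)$ for some $L_0$, $s_0$ and layer widths $\boldsymbol p_0=(p_{0,1},\dots,p_{0,L_0})$ (the last entry being the output width $1$), with network parameter $\theta_0$, i.e. $f_0=f_{\theta_0}$. Prior. With $\gamma\in\{0,1\}^H$: $\pi(\gamma)\propto 1\{\sum_i\gamma_i=s\}$ and, given $\gamma$, independently $\theta_i\sim\gamma_i\mathcal M_0+(1-\gamma_i)\delta_0$, where the slab $\mathcal M_0$ is either $\mathcal U([-B_0,B_0])$ (uniform prior, fixed $B_0>1$) or $N(0,\sigma_0^2)$ (normal prior, fixed $\sigma_0^2>0$). The posterior is $\pi(\theta|\boldsymbol D^{(n)})\propto\pi(\theta)p_\theta(\boldsymbol D^{(n)})$. Variational posterior. $\mathcal Q$ is the family of distributions with independent coordinates, $\gamma_i\sim\mathrm{Bern}(\nu_i)$, $0\le\nu_i\le1$, and $\theta_i|\gamma_i\sim\gamma_i\mathcal M_i+(1-\gamma_i)\delta_0$, where $\mathcal M_i=\mathcal U(l_i,u_i)$ with $-B_0\le l_i\le u_i\le B_0$ (uniform prior) or $\mathcal M_i=N(\mu_i,\sigma_i^2)$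 (normal prior). $\widehat q=\arg\min_{q\in\mathcal Q}\mathrm{KL}(q(\theta)\|\pi(\theta|\boldsymbol D^{(n)}))$. Hellinger distance: $d^2(P_\theta,P_0)=\mathbb E_X\left(1-\exp\{-[f_\theta(X)-f_0(X)]^2/(8\sigma_\epsilon^2)\}\right)$. "With dominating probability" means with $P_0$-probability tending to one as $n\to\infty$. *)

theory Defs
  imports "HOL-Probability.Probability" "HOL-Library.Landau_Symbols"
begin

section \<open>Sparse ReLU networks\<close>

text \<open>
  A network with \<open>L - 1\<close> hidden layers is described by its input dimension \<open>p\<close>, by \<open>L\<close>, and by the
  hidden widths \<open>h 1, \<dots>, h (L - 1)\<close>; other values of \<open>h\<close> play no role.  The coordinates of the
  parameter vector are indexed by the positions in the weight matrices and bias vectors: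
  \<open>Weight l i j\<close> is entry \<open>(i, j)\<close> of \<open>W\<^sub>l\<close> and \<open>Bias l i\<close> is entry \<open>i\<close> of \<open>b\<^sub>l\<close>.  Layers are counted
  from 1, units within a layer from 0.
\<close>

datatype param = Weight nat nat nat | Bias nat nat

definition layer_width :: "nat \<Rightarrow> nat \<Rightarrow> (nat \<Rightarrow> nat) \<Rightarrow> nat \<Rightarrow> nat" where
  "layer_width p L h l = (if l = 0 then p else if l = L then 1 else h l)"

definition param_index :: "nat \<Rightarrow> nat \<Rightarrow> (nat \<Rightarrow> nat) \<Rightarrow> param set" where
  "param_index p L h =
     {Weight l i j | l i j. l \<in> {1..L} \<and> i < layer_width p L h l \<and> j < layer_width p L h (l - 1)} \<union>
     {Bias l i | l i. l \<in> {1..L} \<and> i < layer_width p L h l}"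

primrec hidden_layer ::
  "nat \<Rightarrow> nat \<Rightarrow> (nat \<Rightarrow> nat) \<Rightarrow> (param \<Rightarrow> real) \<Rightarrow> (nat \<Rightarrow> real) \<Rightarrow> nat \<Rightarrow> nat \<Rightarrow> real" where
  "hidden_layer p L h \<theta> x 0 = x"
| "hidden_layer p L h \<theta> x (Suc l) =
     (\<lambda>i. max 0 ((\<Sum>j<layer_width p L h l. \<theta> (Weight (Suc l) i j) * hidden_layer p L h \<theta> x l j)
                 - \<theta> (Bias (Suc l) i)))"

definition network ::
  "nat \<Rightarrow> nat \<Rightarrow> (nat \<Rightarrow> nat) \<Rightarrow> (param \<Rightarrow> real) \<Rightarrow> (nat \<Rightarrow> real) \<Rightarrow> real" where
  "network p L h \<theta> x =
     (\<Sum>j<layer_width p L h (L - 1). \<theta> (Weight L 0 j) * hidden_layer p L h \<theta> x (L - 1) j)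
     + \<theta> (Bias L 0)"

definition l0_norm :: "nat \<Rightarrow> nat \<Rightarrow> (nat \<Rightarrow> nat) \<Rightarrow> (param \<Rightarrow> real) \<Rightarrow> nat" where
  "l0_norm p L h \<theta> = card {k \<in> param_index p L h. \<theta> k \<noteq> 0}"

section \<open>The regression model\<close>

definition normal_dist :: "real \<Rightarrow> real \<Rightarrow> real measure" where
  "normal_dist \<mu> \<sigma> = density lborel (\<lambda>x. ennreal (normal_density \<mu> \<sigma> x))"

definition cube_dist :: "nat \<Rightarrow> (nat \<Rightarrow> real) measure" where
  "cube_dist p = (\<Pi>\<^sub>M j\<in>{..<p}. uniform_measure lborel {-1..1})"

text \<open>The law of a single observation \<open>(X, f X + \<epsilon>)\<close>, and of \<open>n\<close> i.i.d. observations.\<close>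

definition obs_dist :: "nat \<Rightarrow> real \<Rightarrow> ((nat \<Rightarrow> real) \<Rightarrow> real) \<Rightarrow> ((nat \<Rightarrow> real) \<times> real) measure" where
  "obs_dist p \<sigma> f =
     distr (cube_dist p \<Otimes>\<^sub>M normal_dist 0 \<sigma>) (cube_dist p \<Otimes>\<^sub>M borel) (\<lambda>(x, e). (x, f x + e))"

definition data_dist ::
  "nat \<Rightarrow> real \<Rightarrow> ((nat \<Rightarrow> real) \<Rightarrow> real) \<Rightarrow> nat \<Rightarrow> (nat \<Rightarrow> (nat \<Rightarrow> real) \<times> real) measure" where
  "data_dist p \<sigma> f n = (\<Pi>\<^sub>M i\<in>{..<n}. obs_dist p \<sigma> f)"

definition likelihood ::
  "real \<Rightarrow> ((nat \<Rightarrow> real) \<Rightarrow> real) \<Rightarrow> nat \<Rightarrow> (nat \<Rightarrow> (nat \<Rightarrow> real) \<times> real) \<Rightarrow> real" where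
  "likelihood \<sigma> f n D = (\<Prod>i<n. normal_density (f (fst (D i))) \<sigma> (snd (D i)))"

definition hellinger_sq ::
  "nat \<Rightarrow> real \<Rightarrow> ((nat \<Rightarrow> real) \<Rightarrow> real) \<Rightarrow> ((nat \<Rightarrow> real) \<Rightarrow> real) \<Rightarrow> real" where
  "hellinger_sq p \<sigma> f g = (\<integral>x. 1 - exp (- ((f x - g x)\<^sup>2 / (8 * \<sigma>\<^sup>2))) \<partial>cube_dist p)"

section \<open>Spike-and-slab prior and posterior\<close>

text \<open>\<open>Uniform B\<close> stands for the slab \<open>U([-B, B])\<close>, \<open>Normal \<sigma>\<close> for the slab \<open>N(0, \<sigma>\<^sup>2)\<close>.\<close>

datatype slab = Uniform real | Normal real

text \<open>The degenerate case \<open>l = u\<close>, which the variational family allows, is a point mass.\<close>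

definition uniform_dist :: "real \<Rightarrow> real \<Rightarrow> real measure" where
  "uniform_dist l u = (if l = u then return borel l else uniform_measure lborel {l..u})"

fun valid_slab :: "slab \<Rightarrow> bool" where
  "valid_slab (Uniform B) \<longleftrightarrow> B > 1"
| "valid_slab (Normal \<sigma>) \<longleftrightarrow> \<sigma> > 0"

fun slab_dist :: "slab \<Rightarrow> real measure" where
  "slab_dist (Uniform B) = uniform_dist (- B) B"
| "slab_dist (Normal \<sigma>) = normal_dist 0 \<sigma>"

fun variational_slabs :: "slab \<Rightarrow> real measure set" where
  "variational_slabs (Uniform B) = {uniform_dist l u | l u. - B \<le> l \<and> l \<le> u \<and> u \<le> B}"
| "variational_slabs (Normal \<sigma>) = {normal_dist \<mu> \<tau> | \<mu> \<tau>. \<tau> > 0}"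

definition inclusion_prior :: "param set \<Rightarrow> nat \<Rightarrow> (param \<Rightarrow> nat) pmf" where
  "inclusion_prior I s = pmf_of_set {\<gamma> \<in> I \<rightarrow>\<^sub>E {0, 1}. (\<Sum>i\<in>I. \<gamma> i) = s}"

definition prior :: "slab \<Rightarrow> param set \<Rightarrow> nat \<Rightarrow> (param \<Rightarrow> real) measure" where
  "prior M I s = measure_pmf (inclusion_prior I s) \<bind>
     (\<lambda>\<gamma>. \<Pi>\<^sub>M i\<in>I. if \<gamma> i = 1 then slab_dist M else return borel 0)"

definition posterior ::
  "(param \<Rightarrow> real) measure \<Rightarrow> ((param \<Rightarrow> real) \<Rightarrow> real) \<Rightarrow> (param \<Rightarrow> real) measure" where
  "posterior \<pi> lik = density \<pi> (\<lambda>\<theta>. ennreal (lik \<theta> / (\<integral>\<eta>. lik \<eta> \<partial>\<pi>)))"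

section \<open>Variational family\<close>

text \<open>The members are the laws of \<open>\<theta>\<close>, with the inclusion indicators integrated out.\<close>

definition variational_family :: "slab \<Rightarrow> param set \<Rightarrow> (param \<Rightarrow> real) measure set" where
  "variational_family M I =
     {(\<Pi>\<^sub>M i\<in>I. measure_pmf (bernoulli_pmf (\<nu> i)) \<bind> (\<lambda>b. if b then S i else return borel 0)) | \<nu> S.
        (\<forall>i\<in>I. 0 \<le> \<nu> i \<and> \<nu> i \<le> 1 \<and> S i \<in> variational_slabs M)}"

text \<open>
  \<open>KL_divergence b \<pi> q\<close> is the divergence of \<open>q\<close> from \<open>\<pi>\<close> (reference measure first), and is a junk
  value unless \<open>q\<close> is absolutely continuous with respect to \<open>\<pi>\<close> and the log-density is
  \<open>q\<close>-integrable.  For probability measures the divergence is infinite in the remaining cases.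
\<close>

definition KL :: "'a measure \<Rightarrow> 'a measure \<Rightarrow> ereal" where
  "KL q \<pi> = (if absolutely_continuous \<pi> q \<and> integrable q (entropy_density (exp 1) \<pi> q)
             then ereal (KL_divergence (exp 1) \<pi> q) else \<infinity>)"

section \<open>Events of probability tending to one\<close>

text \<open>
  Minimisers of the variational problem need not depend measurably on the data, so the event in
  question may fail to be measurable; it is required to contain measurable events of probability
  tending to one.  For measurable events this is the same as their probability tending to one.
\<close>

definition with_dominating_probability ::
  "(nat \<Rightarrow> 'a measure) \<Rightarrow> (nat \<Rightarrow> 'a \<Rightarrow> bool) \<Rightarrow> bool" where
  "with_dominating_probability P E \<longleftrightarrow>
     (\<exists>A. (\<forall>n. A n \<in> sets (P n) \<and> (\<forall>D\<in>A n. E n D)) \<and> (\<lambda>n. measure (P n) (A n)) \<longlonglongrightarrow> 1)"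

end

theory Submission
  imports Defs
begin

text \<open>
  Write \<open>\<Lambda>(\<theta>)\<close> for the log-likelihood ratio of the student network with parameters \<open>\<theta>\<close> against
  the teacher, and \<open>d\<^sup>2(\<theta>)\<close> for the squared Hellinger distance between the two.  The minimiser
  \<open>q\<close> does at least as well as any competitor \<open>q'\<close> from the variational family.  Combined with
  the Donsker--Varadhan bound for the function \<open>2 * n * d\<^sup>2\<close> under the posterior this
  becomes (\<open>variational_oracle_inequality\<close>)

    \<open>2 * n * \<integral>d\<^sup>2 dq \<le> ln (sup dq'/d\<pi>) - \<integral>\<Lambda> dq' + ln (\<integral>exp (2 * n * d\<^sup>2 + \<Lambda>) d\<pi>)\<close>,

  where \<open>\<pi>\<close> is the prior; the normalising constant of the posterior cancels.  Each of the three
  terms has to be of the order of the number \<open>s\<close> of active parameters times a logarithm.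

  The last term carries the statistical content (\<open>good_event\<close>).  For a single \<open>\<theta>\<close> the
  expectation of \<open>exp (\<Lambda> / 2)\<close> is the \<open>n\<close>-th power of the affinity \<open>1 - d\<^sup>2\<close>, hence at most
  \<open>exp (- n * d\<^sup>2)\<close>; so \<open>\<Lambda> + 2 * n * d\<^sup>2\<close> exceeds \<open>2 * t\<close> with probability at most
  \<open>exp (- t)\<close>.  A union bound over a finite net of \<open>s\<close>-sparse vectors (\<open>sparse_net\<close>), whose
  cardinality is at most the \<open>s\<close>-th power of a polynomial in \<open>n\<close> and in the width, extends this to all sparse
  parameters in a large box, because on the box the network is Lipschitz with polynomial constants.
  Outside the box the prior mass is exponentially small.  It absorbs the factor \<open>exp (2 * n)\<close>,
  since \<open>d\<^sup>2 \<le> 1\<close> and the likelihood ratio has expectation one.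

  For the other two terms the competitor is supported on one inclusion pattern that contains the
  support of the teacher, padded with zeros to the architecture of the student, and it is
  concentrated around the teacher at a scale that is polynomially small in \<open>n\<close> and in the width.  Its
  density with respect to the prior is then at most the \<open>s\<close>-th power of a polynomial
  (\<open>sparse_competitor\<close>), and \<open>- \<integral>\<Lambda> dq'\<close> stays bounded on the same event.

  Altogether \<open>\<integral>d\<^sup>2 dq\<close> is of order \<open>s * (1 + ln (n * W)) / n\<close> with \<open>W = 12 * p * N\<close>
  (\<open>student_bound_explicit\<close>).  The growth condition makes \<open>ln (n * L / s)\<close> at least one from some
  point on, and then a single factor \<open>ln n\<close> turns \<open>s * ln (n * L / s) + L * s * ln (p * N)\<close> into
  an upper bound for \<open>s * (1 + ln (n * W))\<close> (\<open>log_rate_le\<close>).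
\<close>

abbreviation input_space :: "nat \<Rightarrow> (nat \<Rightarrow> real) measure" where
  "input_space p \<equiv> \<Pi>\<^sub>M j\<in>{..<p}. borel"

abbreviation param_space :: "param set \<Rightarrow> (param \<Rightarrow> real) measure" where
  "param_space I \<equiv> \<Pi>\<^sub>M i\<in>I. borel"

section \<open>The variational inequality\<close>

lemma neg_part_mult_ln_le_one:
  fixes r :: real
  assumes "0 \<le> r"
  shows "r * max 0 (- ln r) \<le> 1"
proof (cases "0 < r \<and> r < 1")
  case True
  then have "- ln r = ln (1 / r)" by (simp add: ln_div)
  also have "\<dots> \<le> 1 / r - 1" using True by (intro ln_le_minus_one) simp
  finally have "r * (- ln r) \<le> r * (1 / r - 1)" using True by (intro mult_left_mono) auto
  also have "\<dots> \<le> 1" using True by (simp add: field_simps)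
  finally show ?thesis using True by (auto simp: max_def)
next
  case False
  then show ?thesis using assms by (cases "r = 0") (auto simp: max_def)
qed

text \<open>
  A one-sided bound on the log-density already controls the divergence: the negative part of
  \<open>ln r\<close> is automatically integrable under \<open>Q\<close>, because \<open>r * max 0 (- ln r)\<close> is bounded.
\<close>

lemma KL_le_of_log_density_le:
  fixes r g :: "'a \<Rightarrow> real"
  assumes P: "prob_space P" and Q: "prob_space Q"
    and [measurable]: "r \<in> borel_measurable P" and r: "\<And>x. 0 \<le> r x"
    and Q_eq: "Q = density P (\<lambda>x. ennreal (r x))"
    and le: "AE x in Q. ln (r x) \<le> g x"
    and g: "integrable Q g"
  shows "KL Q P \<le> ereal (\<integral>x. g x \<partial>Q)"
proof -
  interpret P: prob_space P by (rule P)
  interpret Q: prob_space Q by (rule Q)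
  have sets_Q [measurable_cong]: "sets Q = sets P" by (simp add: Q_eq)
  have ac: "absolutely_continuous P Q"
    unfolding Q_eq by (rule absolutely_continuousI_density) simp
  have "AE x in P. ennreal (r x) = RN_deriv P Q x"
    by (rule P.RN_deriv_unique) (auto simp: Q_eq)
  then have "AE x in Q. ennreal (r x) = RN_deriv P Q x"
    by (rule absolutely_continuous_AE[OF sets_Q ac])
  then have ed: "AE x in Q. entropy_density (exp 1) P Q x = ln (r x)"
    by eventually_elim (metis comp_apply entropy_density_def enn2real_ennreal log_ln r)
  have meas [measurable]: "entropy_density (exp 1) P Q \<in> borel_measurable Q"
    using measurable_entropy_density by measurable
  have "(\<integral>\<^sup>+x. ennreal (max 0 (- ln (r x))) \<partial>Q) = (\<integral>\<^sup>+x. ennreal (r x) * ennreal (max 0 (- ln (r x))) \<partial>P)"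
    unfolding Q_eq by (intro nn_integral_density) auto
  also have "\<dots> \<le> (\<integral>\<^sup>+x. 1 \<partial>P)"
    by (intro nn_integral_mono)
      (simp only: ennreal_mult'[symmetric] r ennreal_le_1 neg_part_mult_ln_le_one)
  also have "\<dots> < \<infinity>" by (simp add: P.emeasure_space_1)
  finally have neg: "integrable Q (\<lambda>x. max 0 (- ln (r x)))"
    by (intro integrableI_nonneg) auto
  have int: "integrable Q (\<lambda>x. ln (r x))"
  proof (rule Bochner_Integration.integrable_bound)
    show "integrable Q (\<lambda>x. \<bar>g x\<bar> + max 0 (- ln (r x)))" using g neg by auto
    show "AE x in Q. norm (ln (r x)) \<le> norm (\<bar>g x\<bar> + max 0 (- ln (r x)))"
      using le by eventually_elim auto
  qed simp
  then have int': "integrable Q (entropy_density (exp 1) P Q)"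
    using ed by (subst integrable_cong_AE[OF _ _ ed]) auto
  have "KL_divergence (exp 1) P Q = (\<integral>x. ln (r x) \<partial>Q)"
    unfolding KL_divergence_def using ed by (intro integral_cong_AE) auto
  also have "\<dots> \<le> (\<integral>x. g x \<partial>Q)"
    by (rule integral_mono_AE[OF int g le])
  finally show ?thesis using ac int' by (simp add: KL_def)
qed

text \<open>
  The Donsker--Varadhan bound: by \<open>ln x \<le> x - 1\<close>, replacing the density \<open>D\<close> of \<open>Q\<close> by
  the exponentially tilted one can only increase \<open>\<integral>h dQ - KL\<close>.
\<close>

lemma Donsker_Varadhan:
  fixes h :: "'a \<Rightarrow> real"
  assumes P: "prob_space P" and Q: "prob_space Q" and sets_Q: "sets Q = sets P"
    and KL: "KL Q P \<le> ereal c"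
    and [measurable]: "h \<in> borel_measurable P" and h: "\<And>x. \<bar>h x\<bar> \<le> H"
  shows "absolutely_continuous P Q" and "(\<integral>x. h x \<partial>Q) \<le> c + ln (\<integral>x. exp (h x) \<partial>P)"
proof -
  interpret P: prob_space P by (rule P)
  interpret Q: prob_space Q by (rule Q)
  have [measurable_cong]: "sets Q = sets P" by (rule sets_Q)
  have fin: "absolutely_continuous P Q \<and> integrable Q (entropy_density (exp 1) P Q)"
    and KL_c: "KL_divergence (exp 1) P Q \<le> c"
    using KL by (auto simp: KL_def split: if_splits)
  then show ac: "absolutely_continuous P Q" by blast
  have "finite_measure Q" by unfold_locales
  from P.real_RN_deriv[OF this ac sets_Q] obtain D
    where D[measurable]: "D \<in> borel_measurable P"
      and D_eq: "AE x in P. RN_deriv P Q x = ennreal (D x)"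
      and D_pos: "AE x in Q. 0 < D x" and D_nn: "\<And>x. 0 \<le> D x"
    by this auto
  have "Q = density P (RN_deriv P Q)"
    using ac sets_Q by (rule P.density_RN_deriv[symmetric])
  also have "\<dots> = density P D"
    using D_eq by (auto intro!: density_cong)
  finally have Q_eq: "Q = density P D" .
  have ed: "AE x in Q. entropy_density (exp 1) P Q x = ln (D x)"
    using absolutely_continuous_AE[OF sets_Q ac D_eq]
    by eventually_elim (simp add: entropy_density_def D_nn log_def)
  have meas [measurable]: "entropy_density (exp 1) P Q \<in> borel_measurable Q"
    using measurable_entropy_density by measurable
  have int_ln: "integrable Q (\<lambda>x. ln (D x))"
    using fin ed by (subst integrable_cong_AE[of _ _ "entropy_density (exp 1) P Q"]) auto
  have KL_eq: "KL_divergence (exp 1) P Q = (\<integral>x. ln (D x) \<partial>Q)"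
    unfolding KL_divergence_def using ed by (intro integral_cong_AE) auto
  define Z where "Z = (\<integral>x. exp (h x) \<partial>P)"
  have int_h: "integrable Q h"
    by (rule Q.integrable_const_bound[where B = H]) (use h in auto)
  have int_exp: "integrable P (\<lambda>x. exp (h x))"
    by (rule P.integrable_const_bound[where B = "exp H"]) (use h in \<open>auto simp: abs_le_iff\<close>)
  have "exp (- H) = (\<integral>x. exp (- H) \<partial>P)" by (simp add: P.prob_space)
  also have "\<dots> \<le> Z" unfolding Z_def using int_exp h
    by (intro integral_mono) (auto simp: abs_le_iff minus_le_iff)
  finally have Z: "0 < Z" by (rule less_le_trans[rotated]) simp
  have nn: "(\<integral>\<^sup>+x. ennreal (exp (h x) / D x) \<partial>Q) \<le> ennreal Z"
  proof -
    have "(\<integral>\<^sup>+x. ennreal (exp (h x) / D x) \<partial>Q) = (\<integral>\<^sup>+x. ennreal (D x) * ennreal (exp (h x) / D x) \<partial>P)"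
      unfolding Q_eq by (intro nn_integral_density) auto
    also have "\<dots> \<le> (\<integral>\<^sup>+x. ennreal (exp (h x)) \<partial>P)"
      using D_nn by (intro nn_integral_mono) (auto simp flip: ennreal_mult')
    also have "\<dots> = ennreal Z" unfolding Z_def
      using int_exp by (intro nn_integral_eq_integral) auto
    finally show ?thesis .
  qed
  then have int_tilt: "integrable Q (\<lambda>x. exp (h x) / D x)"
    using D_nn by (intro integrableI_nonneg) (auto intro: le_less_trans)
  have "(\<integral>x. exp (h x) / D x \<partial>Q) \<le> Z"
    using nn D_nn Z by (subst integral_eq_nn_integral) (auto intro: enn2real_leI)
  have "(\<integral>x. h x - ln (D x) - ln Z \<partial>Q) \<le> (\<integral>x. (exp (h x) / D x) / Z - 1 \<partial>Q)"
  proof (rule integral_mono_AE)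
    show "AE x in Q. h x - ln (D x) - ln Z \<le> exp (h x) / D x / Z - 1"
      using D_pos
    proof eventually_elim
      fix x assume "0 < D x"
      then have "h x - ln (D x) - ln Z = ln (exp (h x) / D x / Z)" using Z by (simp add: ln_div ln_mult)
      also have "\<dots> \<le> exp (h x) / D x / Z - 1" using Z \<open>0 < D x\<close> by (intro ln_le_minus_one) simp
      finally show "h x - ln (D x) - ln Z \<le> exp (h x) / D x / Z - 1" .
    qed
  next
    show "integrable Q (\<lambda>x. exp (h x) / D x / Z - 1)"
      by (intro Bochner_Integration.integrable_diff integrable_divide int_tilt) simp
  qed (use int_h int_ln in auto)
  also have "\<dots> = (\<integral>x. exp (h x) / D x \<partial>Q) / Z - 1"
    using int_tilt by (simp del: divide_divide_eq_left add: Q.prob_space)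
  also have "\<dots> \<le> 0" using \<open>(\<integral>x. exp (h x) / D x \<partial>Q) \<le> Z\<close> Z by (simp add: divide_le_eq)
  finally have "(\<integral>x. h x \<partial>Q) - (\<integral>x. ln (D x) \<partial>Q) - ln Z \<le> 0"
    using int_h int_ln by (simp add: Q.prob_space)
  then show "(\<integral>x. h x \<partial>Q) \<le> c + ln (\<integral>x. exp (h x) \<partial>P)"
    using KL_c KL_eq by (simp add: Z_def)
qed

text \<open>
  The normalising constant of the posterior enters the divergence of the competitor \<open>q'\<close> and the
  Donsker--Varadhan bound for \<open>q\<close> with opposite signs and cancels.
\<close>

lemma variational_oracle_inequality:
  fixes \<pi> q q' :: "(param \<Rightarrow> real) measure" and lik \<rho> h :: "(param \<Rightarrow> real) \<Rightarrow> real"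
  assumes "prob_space \<pi>" "prob_space q" "prob_space q'" and sets_q: "sets q = sets \<pi>"
    and [measurable]: "lik \<in> borel_measurable \<pi>" "\<rho> \<in> borel_measurable \<pi>" "h \<in> borel_measurable \<pi>"
    and lik: "\<And>x. 0 < lik x" "\<And>x. lik x \<le> c"
    and q': "q' = density \<pi> (\<lambda>x. ennreal (\<rho> x))" and \<rho>: "\<And>x. 0 \<le> \<rho> x" "\<And>x. \<rho> x \<le> exp \<kappa>"
    and int_ln: "integrable q' (\<lambda>x. ln (lik x))"
    and KL: "KL q (posterior \<pi> lik) \<le> KL q' (posterior \<pi> lik)"
    and h: "\<And>x. \<bar>h x\<bar> \<le> H"
  shows "absolutely_continuous \<pi> q"
    and "(\<integral>x. h x \<partial>q) \<le> \<kappa> - (\<integral>x. ln (lik x) \<partial>q') + ln (\<integral>x. exp (h x) * lik x \<partial>\<pi>)"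
proof -
  interpret \<pi>: prob_space \<pi> by fact
  interpret q': prob_space q' by fact
  define Z where "Z = (\<integral>x. lik x \<partial>\<pi>)"
  have lik_nn: "\<And>x. 0 \<le> lik x" using lik less_imp_le by blast
  have int_lik: "integrable \<pi> lik"
    by (rule \<pi>.integrable_const_bound[where B = c]) (use lik lik_nn in auto)
  have Z: "0 < Z"
  proof -
    have "Z \<noteq> 0"
    proof
      assume "Z = 0"
      then have "AE x in \<pi>. lik x = 0"
        unfolding Z_def using integral_nonneg_eq_0_iff_AE[OF int_lik] lik_nn by simp
      then have "AE x in \<pi>. False" by eventually_elim (metis lik(1) less_irrefl)
      then show False by simp
    qed
    moreover have "0 \<le> Z" unfolding Z_def using lik_nn by simp
    ultimately show ?thesis by simp
  qed
  let ?P = "posterior \<pi> lik"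
  have P_eq: "?P = density \<pi> (\<lambda>x. ennreal (lik x / Z))" by (simp add: posterior_def Z_def)
  have sets_P [measurable_cong]: "sets ?P = sets \<pi>" by (simp add: P_eq)
  have P: "prob_space ?P"
  proof
    have "emeasure ?P (space ?P) = (\<integral>\<^sup>+x. ennreal (lik x / Z) \<partial>\<pi>)"
      by (simp add: P_eq emeasure_density cong: nn_integral_cong)
    also have "\<dots> = ennreal (\<integral>x. lik x / Z \<partial>\<pi>)"
      using int_lik lik_nn Z by (intro nn_integral_eq_integral) auto
    also have "\<dots> = 1" using Z int_lik by (simp add: Z_def)
    finally show "emeasure ?P (space ?P) = 1" .
  qed
  have q'_P: "q' = density ?P (\<lambda>x. ennreal (\<rho> x * Z / lik x))"
  proof -
    have "density ?P (\<lambda>x. ennreal (\<rho> x * Z / lik x))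
        = density \<pi> (\<lambda>x. ennreal (lik x / Z) * ennreal (\<rho> x * Z / lik x))"
      unfolding P_eq by (rule density_density_eq) auto
    also have "\<dots> = density \<pi> (\<lambda>x. ennreal (\<rho> x))"
      using lik(1) lik_nn Z by (intro arg_cong2[where f = density] ext refl)
        (simp flip: ennreal_mult' add: less_imp_neq[THEN not_sym])
    finally show ?thesis using q' by simp
  qed
  have \<rho>_pos: "AE x in q'. 0 < \<rho> x"
    unfolding q' by (subst AE_density) auto
  have "KL q' ?P \<le> ereal (\<integral>x. \<kappa> + ln Z - ln (lik x) \<partial>q')"
  proof (rule KL_le_of_log_density_le[OF P _ _ _ q'_P])
    show "AE x in q'. ln (\<rho> x * Z / lik x) \<le> \<kappa> + ln Z - ln (lik x)"
      using \<rho>_pos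
    proof eventually_elim
      fix x assume "0 < \<rho> x"
      moreover from this have "ln (\<rho> x) \<le> \<kappa>" using \<rho>(2)[of x] by (metis exp_gt_zero ln_exp ln_le_cancel_iff)
      ultimately show "ln (\<rho> x * Z / lik x) \<le> \<kappa> + ln Z - ln (lik x)"
        using lik(1)[of x] Z by (simp add: ln_div ln_mult)
    qed
  qed (use \<rho> lik_nn Z int_ln in \<open>auto intro: q'.prob_space_axioms\<close>)
  also have "(\<integral>x. \<kappa> + ln Z - ln (lik x) \<partial>q') = \<kappa> + ln Z - (\<integral>x. ln (lik x) \<partial>q')"
    using int_ln by (simp add: q'.prob_space)
  finally have "KL q ?P \<le> ereal (\<kappa> + ln Z - (\<integral>x. ln (lik x) \<partial>q'))" using KL by (rule order_trans[rotated])
  note DV = Donsker_Varadhan[where h = h, OF P \<open>prob_space q\<close> sets_q[folded sets_P] this _ h]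
  have "absolutely_continuous ?P q" by (rule DV(1)) simp
  then show "absolutely_continuous \<pi> q"
    using absolutely_continuousI_density[of "\<lambda>x. ennreal (lik x / Z)" \<pi>]
    by (auto simp: P_eq absolutely_continuous_def)
  have "(\<integral>x. h x \<partial>q) \<le> \<kappa> + ln Z - (\<integral>x. ln (lik x) \<partial>q') + ln (\<integral>x. exp (h x) \<partial>?P)"
    by (rule DV(2)) simp
  also have "(\<integral>x. exp (h x) \<partial>?P) = (\<integral>x. exp (h x) * lik x \<partial>\<pi>) / Z"
    unfolding P_eq using lik_nn Z by (subst integral_density) (auto simp: mult_ac)
  also have "ln \<dots> = ln (\<integral>x. exp (h x) * lik x \<partial>\<pi>) - ln Z"
  proof -
    have int: "integrable \<pi> (\<lambda>x. exp (h x) * lik x)"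
      using h lik by (intro \<pi>.integrable_const_bound[where B = "exp H * c"])
        (auto simp: abs_mult abs_le_iff lik_nn intro!: mult_mono)
    have "exp (- H) * Z = (\<integral>x. exp (- H) * lik x \<partial>\<pi>)" by (simp add: Z_def)
    also have "\<dots> \<le> (\<integral>x. exp (h x) * lik x \<partial>\<pi>)"
      using int int_lik h lik_nn by (intro integral_mono mult_right_mono) (auto simp: abs_le_iff minus_le_iff)
    finally have "0 < (\<integral>x. exp (h x) * lik x \<partial>\<pi>)"
      by (rule less_le_trans[rotated]) (use Z in simp)
    then show ?thesis using Z by (simp add: ln_div)
  qed
  finally show "(\<integral>x. h x \<partial>q) \<le> \<kappa> - (\<integral>x. ln (lik x) \<partial>q') + ln (\<integral>x. exp (h x) * lik x \<partial>\<pi>)"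
    by simp
qed

section \<open>ReLU networks as functions of their parameters\<close>

lemma Weight_in_param_index:
  "l < L \<Longrightarrow> i < layer_width p L h (Suc l) \<Longrightarrow> j < layer_width p L h l \<Longrightarrow>
    Weight (Suc l) i j \<in> param_index p L h"
  by (auto simp: param_index_def)

lemma Bias_in_param_index:
  "l < L \<Longrightarrow> i < layer_width p L h (Suc l) \<Longrightarrow> Bias (Suc l) i \<in> param_index p L h"
  by (auto simp: param_index_def)

lemma output_params_in_param_index:
  assumes "1 \<le> L"
  shows "j < layer_width p L h (L - 1) \<Longrightarrow> Weight L 0 j \<in> param_index p L h"
    and "Bias L 0 \<in> param_index p L h"
  using assms by (auto simp: param_index_def layer_width_def)

lemma
  assumes "\<And>l. l \<le> L \<Longrightarrow> layer_width p L h l \<le> W"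
  shows finite_param_index: "finite (param_index p L h)"
    and card_param_index_le: "card (param_index p L h) \<le> 2 * L * W\<^sup>2"
proof -
  let ?A = "(\<lambda>(l, i, j). Weight l i j) ` ({1..L} \<times> {..<W} \<times> {..<W})"
  let ?B = "(\<lambda>(l, i). Bias l i) ` ({1..L} \<times> {..<W})"
  have "param_index p L h \<subseteq> ?A \<union> ?B"
  proof
    fix k assume "k \<in> param_index p L h"
    then consider l i j where "k = Weight l i j" "l \<in> {1..L}" "i < layer_width p L h l"
        "j < layer_width p L h (l - 1)"
      | l i where "k = Bias l i" "l \<in> {1..L}" "i < layer_width p L h l"
      by (auto simp: param_index_def)
    then show "k \<in> ?A \<union> ?B"
    proof cases
      case (1 l i j)
      then have "l \<le> L" "l - 1 \<le> L" by auto
      then have "i < W" "j < W" using 1 assms[of l] assms[of "l - 1"] by (meson less_le_trans)+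
      then show ?thesis using 1 by (auto simp: image_iff)
    next
      case (2 l i)
      then have "l \<le> L" by auto
      then have "i < W" using 2 assms[of l] by (meson less_le_trans)
      then show ?thesis using 2 by (auto simp: image_iff)
    qed
  qed
  moreover have fin: "finite (?A \<union> ?B)" by simp
  ultimately show "finite (param_index p L h)" by (rule finite_subset)
  have "card (param_index p L h) \<le> card (?A \<union> ?B)"
    by (rule card_mono) fact+
  also have "\<dots> \<le> card ?A + card ?B" by (rule card_Un_le)
  also have "\<dots> \<le> card ({1..L} \<times> {..<W} \<times> {..<W}) + card ({1..L} \<times> {..<W})"
    by (intro add_mono card_image_le) auto
  also have "\<dots> = L * (W * W) + L * W" by (simp add: card_cartesian_product)
  also have "\<dots> \<le> 2 * L * W\<^sup>2"
    by (cases W) (auto simp: power2_eq_square)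
  finally show "card (param_index p L h) \<le> 2 * L * W\<^sup>2" .
qed

lemma borel_measurable_hidden_layer:
  assumes \<Theta>: "\<And>k. k \<in> param_index p L h \<Longrightarrow> (\<lambda>\<omega>. \<Theta> \<omega> k) \<in> borel_measurable M"
    and X: "\<And>j. j < p \<Longrightarrow> (\<lambda>\<omega>. X \<omega> j) \<in> borel_measurable M"
  shows "l < L \<Longrightarrow> i < layer_width p L h l \<Longrightarrow>
    (\<lambda>\<omega>. hidden_layer p L h (\<Theta> \<omega>) (X \<omega>) l i) \<in> borel_measurable M"
proof (induction l arbitrary: i)
  case 0
  then show ?case using X by (simp add: layer_width_def)
next
  case (Suc l)
  have "(\<lambda>\<omega>. \<Theta> \<omega> (Weight (Suc l) i j) * hidden_layer p L h (\<Theta> \<omega>) (X \<omega>) l j) \<in> borel_measurable M"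
    if "j < layer_width p L h l" for j
    using Suc that by (intro borel_measurable_times \<Theta> Suc.IH Weight_in_param_index) auto
  moreover have "(\<lambda>\<omega>. \<Theta> \<omega> (Bias (Suc l) i)) \<in> borel_measurable M"
    using Suc by (intro \<Theta> Bias_in_param_index) auto
  ultimately show ?case
    by (auto intro!: borel_measurable_max borel_measurable_diff borel_measurable_sum)
qed

lemma borel_measurable_network:
  assumes "1 \<le> L"
    and \<Theta>: "\<And>k. k \<in> param_index p L h \<Longrightarrow> (\<lambda>\<omega>. \<Theta> \<omega> k) \<in> borel_measurable M"
    and X: "\<And>j. j < p \<Longrightarrow> (\<lambda>\<omega>. X \<omega> j) \<in> borel_measurable M"
  shows "(\<lambda>\<omega>. network p L h (\<Theta> \<omega>) (X \<omega>)) \<in> borel_measurable M"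
  unfolding network_def
  using assms borel_measurable_hidden_layer[OF \<Theta> X]
  by (intro borel_measurable_add borel_measurable_sum borel_measurable_times \<Theta> output_params_in_param_index)
     auto

lemma abs_affine_le:
  fixes a v :: "nat \<Rightarrow> real"
  assumes G: "G = 2 * real W * b"
    and W: "m \<le> W" "1 \<le> W" and b: "1 \<le> b" and V: "1 \<le> V"
    and a: "\<And>j. j < m \<Longrightarrow> \<bar>a j\<bar> \<le> b" and v: "\<And>j. j < m \<Longrightarrow> \<bar>v j\<bar> \<le> V" and c: "\<bar>c\<bar> \<le> b"
  shows "\<bar>(\<Sum>j<m. a j * v j) + c\<bar> \<le> G * V"
proof -
  have "\<bar>(\<Sum>j<m. a j * v j) + c\<bar> \<le> (\<Sum>j<m. \<bar>a j * v j\<bar>) + \<bar>c\<bar>"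
    using sum_abs[of "\<lambda>j. a j * v j" "{..<m}"] by linarith
  also have "\<dots> \<le> (\<Sum>j<m. b * V) + b"
    using a v c b V by (intro add_mono sum_mono) (auto simp: abs_mult intro!: mult_mono)
  also have "\<dots> = real m * (b * V) + b * 1" by simp
  also have "\<dots> \<le> real W * (b * V) + real W * (b * V)"
  proof (intro add_mono mult_right_mono)
    have "1 * (b * 1) \<le> real W * (b * V)" using W b V by (intro mult_mono) auto
    then show "b * 1 \<le> real W * (b * V)" by simp
  qed (use W b V in auto)
  finally show ?thesis by (simp add: G mult_ac)
qed

lemma abs_affine_diff_le:
  fixes a a' v v' :: "nat \<Rightarrow> real" and r :: real
  assumes G: "G = 2 * real W * b"
    and W: "m \<le> W" "1 \<le> W" and b: "1 \<le> b" and V: "1 \<le> V" and r: "0 \<le> r" and d: "0 \<le> d"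
    and a': "\<And>j. j < m \<Longrightarrow> \<bar>a' j\<bar> \<le> b" and v: "\<And>j. j < m \<Longrightarrow> \<bar>v j\<bar> \<le> V"
    and da: "\<And>j. j < m \<Longrightarrow> \<bar>a j - a' j\<bar> \<le> d"
    and dv: "\<And>j. j < m \<Longrightarrow> \<bar>v j - v' j\<bar> \<le> d * r * V" and dc: "\<bar>c - c'\<bar> \<le> d"
  shows "\<bar>((\<Sum>j<m. a j * v j) + c) - ((\<Sum>j<m. a' j * v' j) + c')\<bar> \<le> d * (r + 1) * (G * V)"
proof -
  have eq: "((\<Sum>j<m. a j * v j) + c) - ((\<Sum>j<m. a' j * v' j) + c')
     = (\<Sum>j<m. (a j - a' j) * v j + a' j * (v j - v' j)) + (c - c')"
    by (simp add: algebra_simps sum.distrib sum_subtractf)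
  have "\<bar>\<dots>\<bar> \<le> (\<Sum>j<m. \<bar>(a j - a' j) * v j + a' j * (v j - v' j)\<bar>) + \<bar>c - c'\<bar>"
    using sum_abs[of "\<lambda>j. (a j - a' j) * v j + a' j * (v j - v' j)" "{..<m}"] by linarith
  also have "\<dots> \<le> (\<Sum>j<m. d * V + b * (d * r * V)) + d"
  proof (intro add_mono sum_mono dc)
    fix j assume "j \<in> {..<m}"
    then have j: "j < m" by simp
    have "\<bar>(a j - a' j) * v j + a' j * (v j - v' j)\<bar> \<le> \<bar>a j - a' j\<bar> * \<bar>v j\<bar> + \<bar>a' j\<bar> * \<bar>v j - v' j\<bar>"
      by (simp flip: abs_mult)
    also have "\<dots> \<le> d * V + b * (d * r * V)"
      using da[OF j] v[OF j] a'[OF j] dv[OF j] d b by (intro add_mono mult_mono) auto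
    finally show "\<bar>(a j - a' j) * v j + a' j * (v j - v' j)\<bar> \<le> d * V + b * (d * r * V)" .
  qed
  also have "\<dots> = real m * (d * V) + real m * (b * (d * r * V)) + d"
    by (simp add: algebra_simps)
  also have "\<dots> \<le> real W * b * V * d + real W * b * V * (2 * (d * r)) + real W * b * V * d"
  proof (intro add_mono)
    have "real m * (1 * (V * d)) \<le> real W * (b * (V * d))"
      using W b V d by (intro mult_mono) auto
    then show "real m * (d * V) \<le> real W * b * V * d" by (simp add: mult_ac)
    have "real m * (b * (V * e)) \<le> real W * (b * (V * (2 * e)))" if "0 \<le> e" for e
      using W b V that by (intro mult_mono[of "real m"] mult_left_mono) auto
    from this[of "d * r"] have "real m * (b * (V * (d * r))) \<le> real W * (b * (V * (2 * (d * r))))"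
      using d r by simp
    then show "real m * (b * (d * r * V)) \<le> real W * b * V * (2 * (d * r))" by (simp add: mult_ac)
    have "1 * (1 * (1 * d)) \<le> real W * (b * (V * d))"
      using W b V d by (intro mult_mono) auto
    then show "d \<le> real W * b * V * d" by (simp add: mult_ac)
  qed
  also have "\<dots> = d * (r + 1) * (G * V)" by (simp add: G algebra_simps)
  finally show ?thesis unfolding eq .
qed

context
  fixes p L W :: nat and h :: "nat \<Rightarrow> nat" and b G :: real and x :: "nat \<Rightarrow> real"
  assumes G: "G = 2 * real W * b"
    and width: "\<And>l. l < L \<Longrightarrow> layer_width p L h l \<le> W" and W: "1 \<le> W" and b: "1 \<le> b"
    and x: "\<And>j. j < p \<Longrightarrow> \<bar>x j\<bar> \<le> 1"
begin

lemma growth_ge_one: "1 \<le> G"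
  unfolding G using mult_mono[of 1 "2 * real W" 1 b] W b by simp

lemma abs_hidden_layer_le:
  assumes \<theta>: "\<And>k. k \<in> param_index p L h \<Longrightarrow> \<bar>\<theta> k\<bar> \<le> b"
  shows "l < L \<Longrightarrow> i < layer_width p L h l \<Longrightarrow> \<bar>hidden_layer p L h \<theta> x l i\<bar> \<le> G ^ l"
proof (induction l arbitrary: i)
  case 0
  then show ?case using x by (simp add: layer_width_def)
next
  case (Suc l)
  have "\<bar>(\<Sum>j<layer_width p L h l. \<theta> (Weight (Suc l) i j) * hidden_layer p L h \<theta> x l j) + - \<theta> (Bias (Suc l) i)\<bar>
     \<le> G * G ^ l"
    by (rule abs_affine_le[OF G])
      (use Suc W b width in \<open>auto intro!: \<theta> Weight_in_param_index Bias_in_param_index one_le_power growth_ge_one\<close>)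
  then show ?case by auto
qed

lemma abs_network_le:
  assumes \<theta>: "\<And>k. k \<in> param_index p L h \<Longrightarrow> \<bar>\<theta> k\<bar> \<le> b" and L: "1 \<le> L"
  shows "\<bar>network p L h \<theta> x\<bar> \<le> G ^ L"
proof -
  have "\<bar>network p L h \<theta> x\<bar> \<le> G * G ^ (L - 1)"
    unfolding network_def
    by (rule abs_affine_le[OF G])
      (use L W b width in \<open>auto intro!: \<theta> output_params_in_param_index one_le_power growth_ge_one abs_hidden_layer_le\<close>)
  also have "\<dots> = G ^ L" using L by (cases L) auto
  finally show ?thesis .
qed

text \<open>
  Each layer multiplies the size of its input by at most \<open>G\<close>, and the error made in one
  layer is amplified by the same factor in each later one.
\<close>

lemma abs_hidden_layer_diff_le:
  assumes \<theta>: "\<And>k. k \<in> param_index p L h \<Longrightarrow> \<bar>\<theta> k\<bar> \<le> b"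
    and \<theta>': "\<And>k. k \<in> param_index p L h \<Longrightarrow> \<bar>\<theta>' k\<bar> \<le> b"
    and d: "\<And>k. k \<in> param_index p L h \<Longrightarrow> \<bar>\<theta> k - \<theta>' k\<bar> \<le> d" "0 \<le> d"
  shows "l < L \<Longrightarrow> i < layer_width p L h l \<Longrightarrow>
    \<bar>hidden_layer p L h \<theta> x l i - hidden_layer p L h \<theta>' x l i\<bar> \<le> d * real l * G ^ l"
proof (induction l arbitrary: i)
  case 0
  then show ?case by simp
next
  case (Suc l)
  have "\<bar>((\<Sum>j<layer_width p L h l. \<theta> (Weight (Suc l) i j) * hidden_layer p L h \<theta> x l j) + - \<theta> (Bias (Suc l) i))
     - ((\<Sum>j<layer_width p L h l. \<theta>' (Weight (Suc l) i j) * hidden_layer p L h \<theta>' x l j) + - \<theta>' (Bias (Suc l) i))\<bar>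
     \<le> d * (real l + 1) * (G * G ^ l)"
  proof (rule abs_affine_diff_le[OF G])
    have "\<bar>\<theta> (Bias (Suc l) i) - \<theta>' (Bias (Suc l) i)\<bar> \<le> d"
      using Suc by (intro d Bias_in_param_index) auto
    then show "\<bar>- \<theta> (Bias (Suc l) i) - - \<theta>' (Bias (Suc l) i)\<bar> \<le> d" by linarith
  qed (use Suc W b width d in \<open>auto intro!: \<theta>' d Weight_in_param_index one_le_power growth_ge_one abs_hidden_layer_le[OF \<theta>]\<close>)
  then show ?case by (auto simp: algebra_simps)
qed

lemma abs_network_diff_le:
  assumes \<theta>: "\<And>k. k \<in> param_index p L h \<Longrightarrow> \<bar>\<theta> k\<bar> \<le> b"
    and \<theta>': "\<And>k. k \<in> param_index p L h \<Longrightarrow> \<bar>\<theta>' k\<bar> \<le> b"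
    and d: "\<And>k. k \<in> param_index p L h \<Longrightarrow> \<bar>\<theta> k - \<theta>' k\<bar> \<le> d" "0 \<le> d" and L: "1 \<le> L"
  shows "\<bar>network p L h \<theta> x - network p L h \<theta>' x\<bar> \<le> d * real L * G ^ L"
proof -
  have dv: "\<bar>hidden_layer p L h \<theta> x (L - 1) j - hidden_layer p L h \<theta>' x (L - 1) j\<bar>
      \<le> d * real (L - 1) * G ^ (L - 1)" if "j < layer_width p L h (L - 1)" for j
    by (rule abs_hidden_layer_diff_le[OF \<theta> \<theta>' d]) (use L that in auto)
  have "\<bar>network p L h \<theta> x - network p L h \<theta>' x\<bar>
      \<le> d * (real (L - 1) + 1) * (G * G ^ (L - 1))"
    unfolding network_def
  proof (rule abs_affine_diff_le[OF G _ _ _ _ _ _ _ _ _ dv])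
    show "layer_width p L h (L - 1) \<le> W" using L width by simp
    show "\<bar>hidden_layer p L h \<theta> x (L - 1) j\<bar> \<le> G ^ (L - 1)" if "j < layer_width p L h (L - 1)" for j
      by (rule abs_hidden_layer_le[OF \<theta>]) (use L that in auto)
  qed (use L W b d in \<open>auto intro!: \<theta>' d output_params_in_param_index one_le_power growth_ge_one\<close>)
  also have "\<dots> = d * real L * G ^ L" using L by (cases L) (auto simp: algebra_simps)
  finally show ?thesis .
qed

end

text \<open>Padding the parameters of a network with zeros embeds it into a wider one of the same depth.\<close>

definition pad_params :: "param set \<Rightarrow> (param \<Rightarrow> real) \<Rightarrow> param \<Rightarrow> real" where
  "pad_params J \<theta> k = (if k \<in> J then \<theta> k else 0)"

lemma hidden_layer_pad_params:
  assumes wider: "\<And>l. l < L \<Longrightarrow> layer_width p L h\<^sub>0 l \<le> layer_width p L h l"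
  shows "l < L \<Longrightarrow> i < layer_width p L h\<^sub>0 l \<Longrightarrow>
    hidden_layer p L h (pad_params (param_index p L h\<^sub>0) \<theta>) x l i = hidden_layer p L h\<^sub>0 \<theta> x l i"
proof (induction l arbitrary: i)
  case (Suc l)
  let ?\<theta> = "pad_params (param_index p L h\<^sub>0) \<theta>"
  have "(\<Sum>j<layer_width p L h l. ?\<theta> (Weight (Suc l) i j) * hidden_layer p L h ?\<theta> x l j)
      = (\<Sum>j<layer_width p L h\<^sub>0 l. \<theta> (Weight (Suc l) i j) * hidden_layer p L h\<^sub>0 \<theta> x l j)"
  proof (rule sum.mono_neutral_cong_right)
    show "{..<layer_width p L h\<^sub>0 l} \<subseteq> {..<layer_width p L h l}" using wider Suc by auto
    show "\<forall>j\<in>{..<layer_width p L h l} - {..<layer_width p L h\<^sub>0 l}.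
        ?\<theta> (Weight (Suc l) i j) * hidden_layer p L h ?\<theta> x l j = 0"
      by (auto simp: pad_params_def param_index_def)
  next
    fix j assume "j \<in> {..<layer_width p L h\<^sub>0 l}"
    then show "?\<theta> (Weight (Suc l) i j) * hidden_layer p L h ?\<theta> x l j
        = \<theta> (Weight (Suc l) i j) * hidden_layer p L h\<^sub>0 \<theta> x l j"
      using Suc by (simp add: Suc.IH pad_params_def Weight_in_param_index)
  qed simp
  moreover have "?\<theta> (Bias (Suc l) i) = \<theta> (Bias (Suc l) i)"
    using Suc by (simp add: pad_params_def Bias_in_param_index)
  ultimately show ?case by simp
qed simp

lemma network_pad_params:
  assumes wider: "\<And>l. l < L \<Longrightarrow> layer_width p L h\<^sub>0 l \<le> layer_width p L h l" and L: "1 \<le> L"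
  shows "network p L h (pad_params (param_index p L h\<^sub>0) \<theta>) x = network p L h\<^sub>0 \<theta> x"
proof -
  let ?\<theta> = "pad_params (param_index p L h\<^sub>0) \<theta>"
  have "(\<Sum>j<layer_width p L h (L - 1). ?\<theta> (Weight L 0 j) * hidden_layer p L h ?\<theta> x (L - 1) j)
      = (\<Sum>j<layer_width p L h\<^sub>0 (L - 1). \<theta> (Weight L 0 j) * hidden_layer p L h\<^sub>0 \<theta> x (L - 1) j)"
  proof (rule sum.mono_neutral_cong_right)
    show "{..<layer_width p L h\<^sub>0 (L - 1)} \<subseteq> {..<layer_width p L h (L - 1)}" using wider L by auto
    show "\<forall>j\<in>{..<layer_width p L h (L - 1)} - {..<layer_width p L h\<^sub>0 (L - 1)}.
        ?\<theta> (Weight L 0 j) * hidden_layer p L h ?\<theta> x (L - 1) j = 0"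
      by (auto simp: pad_params_def param_index_def)
  next
    fix j assume "j \<in> {..<layer_width p L h\<^sub>0 (L - 1)}"
    then show "?\<theta> (Weight L 0 j) * hidden_layer p L h ?\<theta> x (L - 1) j
        = \<theta> (Weight L 0 j) * hidden_layer p L h\<^sub>0 \<theta> x (L - 1) j"
      using L by (simp add: hidden_layer_pad_params wider pad_params_def output_params_in_param_index)
  qed simp
  then show ?thesis
    using L by (simp add: network_def pad_params_def output_params_in_param_index)
qed

lemma param_index_mono:
  assumes "\<And>l. l \<le> L \<Longrightarrow> layer_width p L h\<^sub>0 l \<le> layer_width p L h l"
  shows "param_index p L h\<^sub>0 \<subseteq> param_index p L h"
proof
  fix k assume "k \<in> param_index p L h\<^sub>0"
  then consider l i j where "k = Weight l i j" "l \<in> {1..L}" "i < layer_width p L h\<^sub>0 l"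
      "j < layer_width p L h\<^sub>0 (l - 1)"
    | l i where "k = Bias l i" "l \<in> {1..L}" "i < layer_width p L h\<^sub>0 l"
    by (auto simp: param_index_def)
  then show "k \<in> param_index p L h"
  proof cases
    case (1 l i j)
    then have "l \<le> L" "l - 1 \<le> L" by auto
    then have "i < layer_width p L h l" "j < layer_width p L h (l - 1)"
      using 1 assms[of l] assms[of "l - 1"] by (meson less_le_trans)+
    with 1 show ?thesis by (auto simp: param_index_def)
  next
    case (2 l i)
    then have "l \<le> L" by auto
    then have "i < layer_width p L h l" using 2 assms[of l] by (meson less_le_trans)
    with 2 show ?thesis by (auto simp: param_index_def)
  qed
qed

section \<open>Likelihood ratios in the Gaussian regression model\<close>

lemma sets_normal_dist [simp, measurable_cong]: "sets (normal_dist \<mu> \<sigma>) = sets borel"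
  by (simp add: normal_dist_def)

lemma prob_space_normal_dist: "0 < \<sigma> \<Longrightarrow> prob_space (normal_dist \<mu> \<sigma>)"
  unfolding normal_dist_def by (rule prob_space_normal_density)

text \<open>
  Tilting \<open>N(0, \<sigma>\<^sup>2)\<close> by \<open>exp (c * e)\<close> moves its mean to \<open>c * \<sigma>\<^sup>2\<close>.
\<close>

lemma nn_integral_exp_normal_dist:
  assumes "0 < \<sigma>"
  shows "(\<integral>\<^sup>+e. ennreal (exp (c * e)) \<partial>normal_dist 0 \<sigma>) = ennreal (exp (c\<^sup>2 * \<sigma>\<^sup>2 / 2))"
proof -
  have tilt: "normal_density 0 \<sigma> e * exp (c * e) = exp (c\<^sup>2 * \<sigma>\<^sup>2 / 2) * normal_density (c * \<sigma>\<^sup>2) \<sigma> e" for e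
  proof -
    have "- (e\<^sup>2 / (2 * \<sigma>\<^sup>2)) + c * e = c\<^sup>2 * \<sigma>\<^sup>2 / 2 + - ((e - c * \<sigma>\<^sup>2)\<^sup>2 / (2 * \<sigma>\<^sup>2))"
      using assms by (simp add: field_simps power2_eq_square)
    then show ?thesis by (simp add: normal_density_def mult_ac flip: exp_add)
  qed
  have "(\<integral>\<^sup>+e. ennreal (exp (c * e)) \<partial>normal_dist 0 \<sigma>)
      = (\<integral>\<^sup>+e. ennreal (normal_density 0 \<sigma> e) * ennreal (exp (c * e)) \<partial>lborel)"
    unfolding normal_dist_def by (rule nn_integral_density) auto
  also have "\<dots> = (\<integral>\<^sup>+e. ennreal (exp (c\<^sup>2 * \<sigma>\<^sup>2 / 2)) * ennreal (normal_density (c * \<sigma>\<^sup>2) \<sigma> e) \<partial>lborel)"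
    by (simp add: tilt flip: ennreal_mult')
  also have "\<dots> = ennreal (exp (c\<^sup>2 * \<sigma>\<^sup>2 / 2)) * (\<integral>\<^sup>+e. ennreal (normal_density (c * \<sigma>\<^sup>2) \<sigma> e) \<partial>lborel)"
    by (rule nn_integral_cmult) auto
  also have "(\<integral>\<^sup>+e. ennreal (normal_density (c * \<sigma>\<^sup>2) \<sigma> e) \<partial>lborel) = 1"
    using assms by (subst nn_integral_eq_integral) auto
  finally show ?thesis by simp
qed

lemma nn_integral_exp_abs_normal_dist_le:
  assumes "0 < \<sigma>"
  shows "(\<integral>\<^sup>+e. ennreal (exp \<bar>e\<bar>) \<partial>normal_dist 0 \<sigma>) \<le> ennreal (2 * exp (\<sigma>\<^sup>2 / 2))"
proof -
  have "(\<integral>\<^sup>+e. ennreal (exp \<bar>e\<bar>) \<partial>normal_dist 0 \<sigma>)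
      \<le> (\<integral>\<^sup>+e. ennreal (exp (1 * e)) + ennreal (exp (- 1 * e)) \<partial>normal_dist 0 \<sigma>)"
    by (intro nn_integral_mono) (auto simp: abs_if simp flip: ennreal_plus)
  also have "\<dots> = ennreal (exp (\<sigma>\<^sup>2 / 2)) + ennreal (exp (\<sigma>\<^sup>2 / 2))"
    by (subst nn_integral_add) (simp_all only: nn_integral_exp_normal_dist[OF assms], simp_all)
  finally show ?thesis by (simp flip: ennreal_plus)
qed

lemma sets_cube_dist [simp, measurable_cong]: "sets (cube_dist p) = sets (input_space p)"
  unfolding cube_dist_def by (intro sets_PiM_cong) auto

lemma prob_space_uniform_interval: "l < u \<Longrightarrow> prob_space (uniform_measure lborel {l..u::real})"
  by (intro prob_space_uniform_measure) auto

lemma prob_space_cube_dist: "prob_space (cube_dist p)"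
  unfolding cube_dist_def by (intro prob_space_PiM prob_space_uniform_interval) simp

lemma AE_cube_dist: "AE x in cube_dist p. \<forall>j\<in>{..<p}. \<bar>x j\<bar> \<le> 1"
proof -
  have "AE x in cube_dist p. \<bar>x j\<bar> \<le> 1" if "j < p" for j
    unfolding cube_dist_def
  proof (rule AE_PiM_component)
    show "AE y in uniform_measure lborel {- 1..1}. \<bar>y\<bar> \<le> (1::real)"
      by (rule AE_uniform_measureI) (auto simp: abs_le_iff)
  qed (use that in \<open>auto intro: prob_space_uniform_interval\<close>)
  then show ?thesis by (intro AE_finite_allI) (simp_all only: lessThan_iff finite_lessThan)
qed

definition sq_loss :: "real \<Rightarrow> ((nat \<Rightarrow> real) \<Rightarrow> real) \<Rightarrow> nat \<Rightarrow> (nat \<Rightarrow> (nat \<Rightarrow> real) \<times> real) \<Rightarrow> real" where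
  "sq_loss \<sigma> f n D = (\<Sum>i<n. (snd (D i) - f (fst (D i)))\<^sup>2) / (2 * \<sigma>\<^sup>2)"

definition log_lik_ratio ::
  "real \<Rightarrow> ((nat \<Rightarrow> real) \<Rightarrow> real) \<Rightarrow> ((nat \<Rightarrow> real) \<Rightarrow> real) \<Rightarrow> nat \<Rightarrow> (nat \<Rightarrow> (nat \<Rightarrow> real) \<times> real) \<Rightarrow> real" where
  "log_lik_ratio \<sigma> f g n D = sq_loss \<sigma> g n D - sq_loss \<sigma> f n D"

lemma likelihood_eq:
  "likelihood \<sigma> f n D = (1 / sqrt (2 * pi * \<sigma>\<^sup>2)) ^ n * exp (- sq_loss \<sigma> f n D)"
proof -
  have "exp (- sq_loss \<sigma> f n D) = (\<Prod>i<n. exp (- (snd (D i) - f (fst (D i)))\<^sup>2 / (2 * \<sigma>\<^sup>2)))"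
    unfolding sq_loss_def sum_divide_distrib sum_negf[symmetric] minus_divide_left[symmetric]
    by (rule exp_sum) simp
  then show ?thesis
    unfolding likelihood_def normal_density_def prod.distrib by simp
qed

lemma likelihood_pos: "0 < \<sigma> \<Longrightarrow> 0 < likelihood \<sigma> f n D"
  by (simp add: likelihood_eq)

lemma sq_loss_nonneg: "0 \<le> sq_loss \<sigma> f n D"
  by (simp add: sq_loss_def sum_nonneg)

lemma likelihood_le: "0 < \<sigma> \<Longrightarrow> likelihood \<sigma> f n D \<le> (1 / sqrt (2 * pi * \<sigma>\<^sup>2)) ^ n"
  unfolding likelihood_eq by (intro mult_left_le) (auto simp: sq_loss_nonneg)

lemma likelihood_eq_log_lik_ratio:
  "likelihood \<sigma> f n D = likelihood \<sigma> g n D * exp (log_lik_ratio \<sigma> f g n D)"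
  by (simp add: likelihood_eq log_lik_ratio_def exp_diff exp_minus field_simps)

locale regression =
  fixes p :: nat and \<sigma> :: real and f\<^sub>0 :: "(nat \<Rightarrow> real) \<Rightarrow> real"
  assumes \<sigma>: "0 < \<sigma>" and f\<^sub>0 [measurable]: "f\<^sub>0 \<in> borel_measurable (input_space p)"
begin

lemma sets_obs_dist [simp, measurable_cong]:
  "sets (obs_dist p \<sigma> f\<^sub>0) = sets ((input_space p) \<Otimes>\<^sub>M borel)"
  unfolding obs_dist_def by (simp cong: sets_pair_measure_cong)

lemma measurable_obs [measurable]:
  "(\<lambda>(x, e). (x, f\<^sub>0 x + e)) \<in> cube_dist p \<Otimes>\<^sub>M normal_dist 0 \<sigma> \<rightarrow>\<^sub>M cube_dist p \<Otimes>\<^sub>M borel"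
  by measurable

lemma prob_space_obs_dist: "prob_space (obs_dist p \<sigma> f\<^sub>0)"
proof -
  interpret cube: prob_space "cube_dist p" by (rule prob_space_cube_dist)
  interpret noise: prob_space "normal_dist 0 \<sigma>" by (rule prob_space_normal_dist[OF \<sigma>])
  interpret pair_prob_space "cube_dist p" "normal_dist 0 \<sigma>" ..
  show ?thesis unfolding obs_dist_def by (rule prob_space_distr) (rule measurable_obs)
qed

lemma nn_integral_obs_dist:
  assumes [measurable]: "F \<in> borel_measurable ((input_space p) \<Otimes>\<^sub>M borel)"
  shows "(\<integral>\<^sup>+z. F z \<partial>obs_dist p \<sigma> f\<^sub>0) = (\<integral>\<^sup>+x. \<integral>\<^sup>+e. F (x, f\<^sub>0 x + e) \<partial>normal_dist 0 \<sigma> \<partial>cube_dist p)"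
proof -
  interpret noise: prob_space "normal_dist 0 \<sigma>" by (rule prob_space_normal_dist[OF \<sigma>])
  have "(\<integral>\<^sup>+z. F z \<partial>obs_dist p \<sigma> f\<^sub>0)
      = (\<integral>\<^sup>+(x, e). F (x, f\<^sub>0 x + e) \<partial>(cube_dist p \<Otimes>\<^sub>M normal_dist 0 \<sigma>))"
    unfolding obs_dist_def by (subst nn_integral_distr) (auto simp: case_prod_unfold)
  also have "\<dots> = (\<integral>\<^sup>+x. \<integral>\<^sup>+e. F (x, f\<^sub>0 x + e) \<partial>normal_dist 0 \<sigma> \<partial>cube_dist p)"
    by (subst noise.nn_integral_fst[symmetric]) auto
  finally show ?thesis .
qed

lemma AE_obs_dist: "AE z in obs_dist p \<sigma> f\<^sub>0. \<forall>j\<in>{..<p}. \<bar>fst z j\<bar> \<le> 1"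
proof -
  interpret cube: prob_space "cube_dist p" by (rule prob_space_cube_dist)
  interpret noise: prob_space "normal_dist 0 \<sigma>" by (rule prob_space_normal_dist[OF \<sigma>])
  interpret pair_prob_space "cube_dist p" "normal_dist 0 \<sigma>" ..
  have "AE z in cube_dist p \<Otimes>\<^sub>M normal_dist 0 \<sigma>. \<forall>j\<in>{..<p}. \<bar>fst z j\<bar> \<le> 1"
  proof (rule AE_pair_measure)
    show "AE x in cube_dist p. AE y in normal_dist 0 \<sigma>. \<forall>j\<in>{..<p}. \<bar>fst (x, y) j\<bar> \<le> 1"
      using AE_cube_dist by eventually_elim simp
  qed measurable
  then show ?thesis
    unfolding obs_dist_def by (subst AE_distr_iff) (measurable, simp add: case_prod_unfold)
qed

lemma sets_data_dist [simp, measurable_cong]: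
  "sets (data_dist p \<sigma> f\<^sub>0 n) = sets (\<Pi>\<^sub>M i\<in>{..<n}. (input_space p) \<Otimes>\<^sub>M borel)"
  unfolding data_dist_def by (intro sets_PiM_cong) auto

lemma prob_space_data_dist: "prob_space (data_dist p \<sigma> f\<^sub>0 n)"
  unfolding data_dist_def by (intro prob_space_PiM prob_space_obs_dist)

lemma nn_integral_data_dist_component:
  assumes "i < n" and "F \<in> borel_measurable ((input_space p) \<Otimes>\<^sub>M borel)"
  shows "(\<integral>\<^sup>+D. F (D i) \<partial>data_dist p \<sigma> f\<^sub>0 n) = (\<integral>\<^sup>+z. F z \<partial>obs_dist p \<sigma> f\<^sub>0)"
proof -
  have "(\<integral>\<^sup>+z. F z \<partial>obs_dist p \<sigma> f\<^sub>0)
      = (\<integral>\<^sup>+z. F z \<partial>distr (\<Pi>\<^sub>M i\<in>{..<n}. obs_dist p \<sigma> f\<^sub>0) (obs_dist p \<sigma> f\<^sub>0) (\<lambda>D. D i))"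
    using assms(1) by (subst distr_PiM_component) (auto intro: prob_space_obs_dist)
  also have "\<dots> = (\<integral>\<^sup>+D. F (D i) \<partial>data_dist p \<sigma> f\<^sub>0 n)"
    unfolding data_dist_def using assms by (intro nn_integral_distr) auto
  finally show ?thesis by simp
qed

lemma AE_data_dist: "AE D in data_dist p \<sigma> f\<^sub>0 n. \<forall>i\<in>{..<n}. \<forall>j\<in>{..<p}. \<bar>fst (D i) j\<bar> \<le> 1"
proof -
  have "AE D in data_dist p \<sigma> f\<^sub>0 n. \<forall>j\<in>{..<p}. \<bar>fst (D i) j\<bar> \<le> 1" if "i < n" for i
    unfolding data_dist_def
    by (rule AE_PiM_component[where P = "\<lambda>z. \<forall>j\<in>{..<p}. \<bar>fst z j\<bar> \<le> 1"])
      (use that AE_obs_dist in \<open>auto intro: prob_space_obs_dist\<close>)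
  then show ?thesis by (rule AE_finite_allI[OF finite_lessThan]) (simp only: lessThan_iff)
qed

lemma nn_integral_noise_le:
  "(\<integral>\<^sup>+D. ennreal (\<Sum>i<n. \<bar>snd (D i) - f\<^sub>0 (fst (D i))\<bar>) \<partial>data_dist p \<sigma> f\<^sub>0 n) \<le> ennreal (n * (2 * exp (\<sigma>\<^sup>2 / 2)))"
proof -
  have one: "(\<integral>\<^sup>+D. ennreal \<bar>snd (D i) - f\<^sub>0 (fst (D i))\<bar> \<partial>data_dist p \<sigma> f\<^sub>0 n) \<le> ennreal (2 * exp (\<sigma>\<^sup>2 / 2))"
    if "i < n" for i
  proof -
    interpret cube: prob_space "cube_dist p" by (rule prob_space_cube_dist)
    have "(\<integral>\<^sup>+D. ennreal \<bar>snd (D i) - f\<^sub>0 (fst (D i))\<bar> \<partial>data_dist p \<sigma> f\<^sub>0 n)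
        = (\<integral>\<^sup>+z. ennreal \<bar>snd z - f\<^sub>0 (fst z)\<bar> \<partial>obs_dist p \<sigma> f\<^sub>0)"
      using that by (rule nn_integral_data_dist_component) measurable
    also have "\<dots> = (\<integral>\<^sup>+x. \<integral>\<^sup>+e. ennreal \<bar>e\<bar> \<partial>normal_dist 0 \<sigma> \<partial>cube_dist p)"
      by (subst nn_integral_obs_dist) auto
    also have "\<dots> \<le> (\<integral>\<^sup>+x. ennreal (2 * exp (\<sigma>\<^sup>2 / 2)) \<partial>cube_dist p)"
    proof (intro nn_integral_mono)
      have "(\<integral>\<^sup>+e. ennreal \<bar>e\<bar> \<partial>normal_dist 0 \<sigma>) \<le> (\<integral>\<^sup>+e. ennreal (exp \<bar>e\<bar>) \<partial>normal_dist 0 \<sigma>)"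
      proof (intro nn_integral_mono ennreal_leI)
        show "\<bar>e\<bar> \<le> exp \<bar>e\<bar>" for e :: real using exp_ge_add_one_self[of "\<bar>e\<bar>"] by linarith
      qed
      also note nn_integral_exp_abs_normal_dist_le[OF \<sigma>]
      finally show "(\<integral>\<^sup>+e. ennreal \<bar>e\<bar> \<partial>normal_dist 0 \<sigma>) \<le> ennreal (2 * exp (\<sigma>\<^sup>2 / 2))" .
    qed
    also have "\<dots> = ennreal (2 * exp (\<sigma>\<^sup>2 / 2))" by (simp add: cube.emeasure_space_1)
    finally show ?thesis .
  qed
  have "(\<integral>\<^sup>+D. ennreal (\<Sum>i<n. \<bar>snd (D i) - f\<^sub>0 (fst (D i))\<bar>) \<partial>data_dist p \<sigma> f\<^sub>0 n)
      = (\<Sum>i<n. \<integral>\<^sup>+D. ennreal \<bar>snd (D i) - f\<^sub>0 (fst (D i))\<bar> \<partial>data_dist p \<sigma> f\<^sub>0 n)"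
    by (subst sum_ennreal[symmetric], simp, rule nn_integral_sum) measurable
  also have "\<dots> \<le> (\<Sum>i<n. ennreal (2 * exp (\<sigma>\<^sup>2 / 2)))" by (intro sum_mono one) simp
  also have "\<dots> = ennreal (n * (2 * exp (\<sigma>\<^sup>2 / 2)))" by (simp add: ennreal_mult' ennreal_of_nat_eq_real_of_nat)
  finally show ?thesis .
qed

text \<open>
  Conditionally on \<open>X\<close> the log-likelihood ratio is Gaussian, so that the powers of the likelihood
  ratio have explicit moments.
\<close>

lemma nn_integral_lik_ratio_power_obs:
  fixes t :: real
  assumes [measurable]: "f \<in> borel_measurable (input_space p)"
  shows "(\<integral>\<^sup>+z. ennreal (exp (t * (((snd z - f\<^sub>0 (fst z))\<^sup>2 - (snd z - f (fst z))\<^sup>2) / (2 * \<sigma>\<^sup>2)))) \<partial>obs_dist p \<sigma> f\<^sub>0)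
    = (\<integral>\<^sup>+x. ennreal (exp (- (t * (1 - t) * (f x - f\<^sub>0 x)\<^sup>2 / (2 * \<sigma>\<^sup>2)))) \<partial>cube_dist p)"
proof -
  have inner: "(\<integral>\<^sup>+e. ennreal (exp (t * ((e\<^sup>2 - (f\<^sub>0 x + e - f x)\<^sup>2) / (2 * \<sigma>\<^sup>2)))) \<partial>normal_dist 0 \<sigma>)
      = ennreal (exp (- (t * (1 - t) * (f x - f\<^sub>0 x)\<^sup>2 / (2 * \<sigma>\<^sup>2))))" for x
  proof -
    define g where "g = f x - f\<^sub>0 x"
    have "t * ((e\<^sup>2 - (f\<^sub>0 x + e - f x)\<^sup>2) / (2 * \<sigma>\<^sup>2)) = - (t * g\<^sup>2 / (2 * \<sigma>\<^sup>2)) + (t * g / \<sigma>\<^sup>2) * e" for e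
      using \<sigma> by (simp add: g_def field_simps power2_eq_square)
    then have "(\<integral>\<^sup>+e. ennreal (exp (t * ((e\<^sup>2 - (f\<^sub>0 x + e - f x)\<^sup>2) / (2 * \<sigma>\<^sup>2)))) \<partial>normal_dist 0 \<sigma>)
        = (\<integral>\<^sup>+e. ennreal (exp (- (t * g\<^sup>2 / (2 * \<sigma>\<^sup>2)))) * ennreal (exp ((t * g / \<sigma>\<^sup>2) * e)) \<partial>normal_dist 0 \<sigma>)"
      by (simp only: exp_add ennreal_mult' exp_ge_zero)
    also have "\<dots> = ennreal (exp (- (t * g\<^sup>2 / (2 * \<sigma>\<^sup>2)))) * ennreal (exp ((t * g / \<sigma>\<^sup>2)\<^sup>2 * \<sigma>\<^sup>2 / 2))"
      by (subst nn_integral_cmult) (auto simp only: nn_integral_exp_normal_dist[OF \<sigma>], measurable)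
    also have "\<dots> = ennreal (exp (- (t * g\<^sup>2 / (2 * \<sigma>\<^sup>2)) + (t * g / \<sigma>\<^sup>2)\<^sup>2 * \<sigma>\<^sup>2 / 2))"
      by (simp only: exp_add ennreal_mult' exp_ge_zero)
    also have "- (t * g\<^sup>2 / (2 * \<sigma>\<^sup>2)) + (t * g / \<sigma>\<^sup>2)\<^sup>2 * \<sigma>\<^sup>2 / 2 = - (t * (1 - t) * g\<^sup>2 / (2 * \<sigma>\<^sup>2))"
      using \<sigma> by (simp add: field_simps power2_eq_square)
    finally show ?thesis by (simp add: g_def)
  qed
  have "(\<integral>\<^sup>+z. ennreal (exp (t * (((snd z - f\<^sub>0 (fst z))\<^sup>2 - (snd z - f (fst z))\<^sup>2) / (2 * \<sigma>\<^sup>2)))) \<partial>obs_dist p \<sigma> f\<^sub>0)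
      = (\<integral>\<^sup>+x. \<integral>\<^sup>+e. ennreal (exp (t * ((e\<^sup>2 - (f\<^sub>0 x + e - f x)\<^sup>2) / (2 * \<sigma>\<^sup>2)))) \<partial>normal_dist 0 \<sigma> \<partial>cube_dist p)"
    using nn_integral_obs_dist[of "\<lambda>z. ennreal (exp (t * (((snd z - f\<^sub>0 (fst z))\<^sup>2 - (snd z - f (fst z))\<^sup>2) / (2 * \<sigma>\<^sup>2))))"]
    by (simp only: fst_conv snd_conv add_diff_cancel_left') measurable
  then show ?thesis by (simp only: inner)
qed

lemma nn_integral_lik_ratio_power:
  fixes t :: real
  assumes [measurable]: "f \<in> borel_measurable (input_space p)"
  shows "(\<integral>\<^sup>+D. ennreal (exp (t * log_lik_ratio \<sigma> f f\<^sub>0 n D)) \<partial>data_dist p \<sigma> f\<^sub>0 n)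
    = (\<integral>\<^sup>+x. ennreal (exp (- (t * (1 - t) * (f x - f\<^sub>0 x)\<^sup>2 / (2 * \<sigma>\<^sup>2)))) \<partial>cube_dist p) ^ n"
proof -
  interpret product_sigma_finite "\<lambda>i::nat. obs_dist p \<sigma> f\<^sub>0"
    by (intro product_sigma_finite.intro prob_space_imp_sigma_finite prob_space_obs_dist)
  let ?F = "\<lambda>z. ennreal (exp (t * (((snd z - f\<^sub>0 (fst z))\<^sup>2 - (snd z - f (fst z))\<^sup>2) / (2 * \<sigma>\<^sup>2))))"
  have "ennreal (exp (t * log_lik_ratio \<sigma> f f\<^sub>0 n D)) = (\<Prod>i<n. ?F (D i))" for D
  proof -
    have "t * log_lik_ratio \<sigma> f f\<^sub>0 n D
        = (\<Sum>i<n. t * (((snd (D i) - f\<^sub>0 (fst (D i)))\<^sup>2 - (snd (D i) - f (fst (D i)))\<^sup>2) / (2 * \<sigma>\<^sup>2)))"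
      unfolding log_lik_ratio_def sq_loss_def
      by (simp only: sum_distrib_left[symmetric] sum_divide_distrib[symmetric] sum_subtractf diff_divide_distrib)
    then show ?thesis by (simp only: exp_sum finite_lessThan prod_ennreal exp_ge_zero)
  qed
  then have "(\<integral>\<^sup>+D. ennreal (exp (t * log_lik_ratio \<sigma> f f\<^sub>0 n D)) \<partial>data_dist p \<sigma> f\<^sub>0 n)
     = (\<integral>\<^sup>+D. (\<Prod>i<n. ?F (D i)) \<partial>(\<Pi>\<^sub>M i\<in>{..<n}. obs_dist p \<sigma> f\<^sub>0))"
    unfolding data_dist_def by simp
  also have "\<dots> = (\<Prod>i<n. \<integral>\<^sup>+z. ?F z \<partial>obs_dist p \<sigma> f\<^sub>0)"
    by (rule product_nn_integral_prod) (simp, measurable)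
  finally show ?thesis by (simp only: nn_integral_lik_ratio_power_obs[OF assms] prod_constant card_lessThan)
qed

lemma nn_integral_lik_ratio:
  assumes "f \<in> borel_measurable (input_space p)"
  shows "(\<integral>\<^sup>+D. ennreal (exp (log_lik_ratio \<sigma> f f\<^sub>0 n D)) \<partial>data_dist p \<sigma> f\<^sub>0 n) = 1"
proof -
  interpret cube: prob_space "cube_dist p" by (rule prob_space_cube_dist)
  show ?thesis
    using nn_integral_lik_ratio_power[OF assms, where t = 1 and n = n] by (simp add: cube.emeasure_space_1)
qed

lemma integrable_hellinger:
  assumes [measurable]: "f \<in> borel_measurable (input_space p)"
  shows "integrable (cube_dist p) (\<lambda>x. 1 - exp (- ((f x - f\<^sub>0 x)\<^sup>2 / (8 * \<sigma>\<^sup>2))))"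
proof -
  interpret cube: prob_space "cube_dist p" by (rule prob_space_cube_dist)
  show ?thesis by (rule cube.integrable_const_bound[where B = 1]) auto
qed

lemma hellinger_sq_bounds:
  shows "0 \<le> hellinger_sq p \<sigma> f f\<^sub>0" and "hellinger_sq p \<sigma> f f\<^sub>0 \<le> 1"
proof -
  interpret cube: prob_space "cube_dist p" by (rule prob_space_cube_dist)
  show "0 \<le> hellinger_sq p \<sigma> f f\<^sub>0"
    unfolding hellinger_sq_def by (intro integral_nonneg_AE) auto
  show "hellinger_sq p \<sigma> f f\<^sub>0 \<le> 1"
  proof (cases "integrable (cube_dist p) (\<lambda>x. 1 - exp (- ((f x - f\<^sub>0 x)\<^sup>2 / (8 * \<sigma>\<^sup>2))))")
    case True
    then have "hellinger_sq p \<sigma> f f\<^sub>0 \<le> (\<integral>x. 1 \<partial>cube_dist p)"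
      unfolding hellinger_sq_def by (intro integral_mono) auto
    then show ?thesis by (simp add: cube.prob_space)
    \<comment> \<open>The integral of a function that is not integrable is zero.\<close>
  qed (simp add: hellinger_sq_def not_integrable_integral_eq)
qed

text \<open>
  The affinity \<open>1 - d\<^sup>2\<close> is the expected square root of the likelihood ratio of one
  observation; by independence its \<open>n\<close>-th power is that of the whole sample.
\<close>

lemma nn_integral_sqrt_lik_ratio_le:
  assumes f [measurable]: "f \<in> borel_measurable (input_space p)"
  shows "(\<integral>\<^sup>+D. ennreal (exp (log_lik_ratio \<sigma> f f\<^sub>0 n D / 2)) \<partial>data_dist p \<sigma> f\<^sub>0 n)
    \<le> ennreal (exp (- (real n * hellinger_sq p \<sigma> f f\<^sub>0)))"
proof -
  interpret cube: prob_space "cube_dist p" by (rule prob_space_cube_dist)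
  let ?d = "hellinger_sq p \<sigma> f f\<^sub>0"
  have int: "integrable (cube_dist p) (\<lambda>x. exp (- ((f x - f\<^sub>0 x)\<^sup>2 / (8 * \<sigma>\<^sup>2))))"
    by (rule cube.integrable_const_bound[where B = 1]) auto
  then have d: "?d = 1 - (\<integral>x. exp (- ((f x - f\<^sub>0 x)\<^sup>2 / (8 * \<sigma>\<^sup>2))) \<partial>cube_dist p)"
    unfolding hellinger_sq_def by (simp add: cube.prob_space)
  have "(\<integral>\<^sup>+D. ennreal (exp (log_lik_ratio \<sigma> f f\<^sub>0 n D / 2)) \<partial>data_dist p \<sigma> f\<^sub>0 n)
     = (\<integral>\<^sup>+x. ennreal (exp (- ((f x - f\<^sub>0 x)\<^sup>2 / (8 * \<sigma>\<^sup>2)))) \<partial>cube_dist p) ^ n"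
    using nn_integral_lik_ratio_power[OF f, where t = "1 / 2" and n = n] by simp
  also have "(\<integral>\<^sup>+x. ennreal (exp (- ((f x - f\<^sub>0 x)\<^sup>2 / (8 * \<sigma>\<^sup>2)))) \<partial>cube_dist p) = ennreal (1 - ?d)"
    using int d by (subst nn_integral_eq_integral) auto
  also have "ennreal (1 - ?d) ^ n \<le> ennreal (exp (- ?d)) ^ n"
    using exp_ge_add_one_self[of "- ?d"] by (intro power_mono ennreal_leI) auto
  also have "\<dots> = ennreal (exp (- (real n * ?d)))"
    by (simp add: ennreal_power flip: exp_of_nat_mult)
  finally show ?thesis .
qed

end

section \<open>Slabs\<close>

lemma uniform_dist_of_less: "l < u \<Longrightarrow> uniform_dist l u = uniform_measure lborel {l..u}"
  by (simp add: uniform_dist_def)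

lemma prob_space_uniform_dist: "l \<le> u \<Longrightarrow> prob_space (uniform_dist l u)"
  by (cases "l = u") (auto simp: uniform_dist_def prob_space_return intro: prob_space_uniform_interval)

lemma sets_uniform_dist [simp, measurable_cong]: "sets (uniform_dist l u) = sets borel"
  by (simp add: uniform_dist_def)

lemma sets_slab_dist [simp, measurable_cong]: "sets (slab_dist M) = sets borel"
  by (cases M) auto

lemma space_slab_dist [simp]: "space (slab_dist M) = UNIV"
  using sets_eq_imp_space_eq[OF sets_slab_dist] by simp

lemma prob_space_slab_dist: "valid_slab M \<Longrightarrow> prob_space (slab_dist M)"
  by (cases M) (auto intro: prob_space_uniform_dist prob_space_normal_dist)

lemma
  assumes "S \<in> variational_slabs M"
  shows prob_space_variational_slab: "prob_space S" and sets_variational_slab: "sets S = sets borel"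
  using assms by (cases M; auto intro: prob_space_uniform_dist prob_space_normal_dist)+

lemma AE_slab_dist_nonzero:
  assumes "valid_slab M"
  shows "AE x in slab_dist M. x \<noteq> 0"
proof -
  have lb: "AE x in lborel. x \<noteq> (0::real)" by (rule AE_lborel_singleton)
  show ?thesis
  proof (cases M)
    case (Uniform B)
    then have "slab_dist M = uniform_measure lborel {- B..B}"
      using assms by (simp add: uniform_dist_of_less)
    moreover have "AE x in uniform_measure lborel {- B..B}. x \<noteq> 0"
      using lb by (intro AE_uniform_measureI) (auto elim: eventually_mono)
    ultimately show ?thesis by (simp only:)
  next
    case (Normal s)
    moreover have "AE x in normal_dist 0 s. x \<noteq> 0"
      unfolding normal_dist_def by (subst AE_density) (use lb in \<open>auto elim: eventually_mono\<close>)
    ultimately show ?thesis by (simp only: slab_dist.simps)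
  qed
qed

text \<open>
  Both slabs have a finite moment of \<open>exp \<bar>x\<bar>\<close>, so Markov's inequality gives one form of tail
  bound for both.
\<close>

lemma slab_dist_tail:
  assumes "valid_slab M"
  obtains C where "0 \<le> C"
    and "\<And>b. 0 \<le> b \<Longrightarrow> emeasure (slab_dist M) {x. b < \<bar>x\<bar>} \<le> ennreal (C * exp (- b))"
proof -
  have markov: "emeasure (slab_dist M) {x. b < \<bar>x\<bar>} \<le> ennreal (C * exp (- b))"
    if C: "(\<integral>\<^sup>+x. ennreal (exp \<bar>x\<bar>) \<partial>slab_dist M) \<le> ennreal C" "0 \<le> C" for b C
  proof -
    have "emeasure (slab_dist M) {x. b < \<bar>x\<bar>} = (\<integral>\<^sup>+x. indicator {x. b < \<bar>x\<bar>} x \<partial>slab_dist M)"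
      by (rule nn_integral_indicator[symmetric]) simp
    also have "\<dots> \<le> (\<integral>\<^sup>+x. ennreal (exp (- b)) * ennreal (exp \<bar>x\<bar>) \<partial>slab_dist M)"
      by (intro nn_integral_mono) (auto simp: indicator_def simp flip: ennreal_mult' exp_add)
    also have "\<dots> = ennreal (exp (- b)) * (\<integral>\<^sup>+x. ennreal (exp \<bar>x\<bar>) \<partial>slab_dist M)"
      by (rule nn_integral_cmult) simp
    also have "\<dots> \<le> ennreal (exp (- b)) * ennreal C"
      by (intro mult_left_mono C) simp
    finally show ?thesis using C(2) by (simp add: mult.commute flip: ennreal_mult')
  qed
  have "\<exists>C\<ge>0. (\<integral>\<^sup>+x. ennreal (exp \<bar>x\<bar>) \<partial>slab_dist M) \<le> ennreal C"
  proof (cases M)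
    case (Normal s)
    then show ?thesis using assms nn_integral_exp_abs_normal_dist_le[of s]
      by (intro exI[of _ "2 * exp (s\<^sup>2 / 2)"]) simp
  next
    case (Uniform B)
    then have B: "1 < B" using assms by simp
    interpret prob_space "slab_dist M" by (rule prob_space_slab_dist[OF assms])
    have "AE x in slab_dist M. \<bar>x\<bar> \<le> B"
    proof -
      have "slab_dist M = uniform_measure lborel {- B..B}"
        using B Uniform by (simp add: uniform_dist_of_less)
      moreover have "AE x in uniform_measure lborel {- B..B}. \<bar>x\<bar> \<le> B"
        by (intro AE_uniform_measureI) (auto simp: abs_le_iff)
      ultimately show ?thesis by (simp only:)
    qed
    then have "(\<integral>\<^sup>+x. ennreal (exp \<bar>x\<bar>) \<partial>slab_dist M) \<le> (\<integral>\<^sup>+x. ennreal (exp B) \<partial>slab_dist M)"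
      by (intro nn_integral_mono_AE) (auto elim!: eventually_mono)
    also have "\<dots> = ennreal (exp B)" using emeasure_space_1 by simp
    finally show ?thesis by (intro exI[of _ "exp B"]) simp
  qed
  then show thesis using that markov by blast
qed

text \<open>
  For either slab the variational family has a member concentrated at scale \<open>\<tau>\<close> around \<open>t\<close>
  whose density with respect to the slab is at most a multiple of \<open>1 / \<tau>\<close>.  The even moments
  record the concentration, since they are explicit for normal distributions.
\<close>

lemma uniform_slab_competitor:
  assumes "1 < B" "\<bar>t\<bar> \<le> B" "0 < \<tau>" "\<tau> \<le> 1"
  obtains S \<rho> where "S \<in> variational_slabs (Uniform B)" "\<rho> \<in> borel_measurable borel"
    "\<And>x. 0 \<le> \<rho> x" "\<And>x. \<rho> x \<le> 2 * B / \<tau>" "S = density (slab_dist (Uniform B)) (\<lambda>x. ennreal (\<rho> x))"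
    "\<And>j. (\<integral>\<^sup>+x. ennreal ((x - t) ^ (2 * j)) \<partial>S) \<le> ennreal (\<tau> ^ (2 * j))"
proof -
  \<comment> \<open>The interval has \<open>t\<close> as an endpoint and extends toward the origin, so that it stays inside
    \<open>[- B, B]\<close>.\<close>
  define l where "l = (if t \<le> 0 then t else t - \<tau>)"
  let ?S = "uniform_measure lborel {l..l + \<tau>}"
  let ?\<rho> = "\<lambda>x. 2 * B / \<tau> * indicator {l..l + \<tau>} x"
  have l: "- B \<le> l" "l + \<tau> \<le> B" using assms by (auto simp: l_def)
  interpret prob_space ?S using assms by (intro prob_space_uniform_interval) simp
  have "density (slab_dist (Uniform B)) (\<lambda>x. ennreal (?\<rho> x))
      = density lborel (\<lambda>x. (indicator {- B..B} x / emeasure lborel {- B..B}) * ennreal (?\<rho> x))"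
    using assms unfolding slab_dist.simps uniform_measure_def
    by (subst uniform_dist_of_less) (simp, simp add: uniform_measure_def, subst density_density_eq, auto)
  also have "\<dots> = ?S"
    unfolding uniform_measure_def
  proof (intro arg_cong2[where f = density] ext refl)
    fix x
    have "ennreal 1 / ennreal (2 * B) * ennreal (2 * B / \<tau>) = ennreal 1 / ennreal \<tau>"
      using assms by (simp only: divide_ennreal ennreal_mult'[symmetric] zero_le_divide_iff) (simp flip: ennreal_mult')
    then show "indicator {- B..B} x / emeasure lborel {- B..B} * ennreal (?\<rho> x)
        = indicator {l..l + \<tau>} x / emeasure lborel {l..l + \<tau>}"
      using l assms by (auto simp: indicator_def)
  qed
  finally have dens: "?S = density (slab_dist (Uniform B)) (\<lambda>x. ennreal (?\<rho> x))" by simp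
  have mom: "(\<integral>\<^sup>+x. ennreal ((x - t) ^ (2 * j)) \<partial>?S) \<le> ennreal (\<tau> ^ (2 * j))" for j
  proof -
    have "(\<integral>\<^sup>+x. ennreal ((x - t) ^ (2 * j)) \<partial>?S) \<le> (\<integral>\<^sup>+x. ennreal (\<tau> ^ (2 * j)) \<partial>?S)"
    proof (intro nn_integral_mono_AE AE_uniform_measureI AE_I2 impI ennreal_leI)
      fix x assume "x \<in> {l..l + \<tau>}"
      then have "\<bar>x - t\<bar> \<le> \<tau>" using assms by (auto simp: l_def split: if_splits)
      then have "\<bar>x - t\<bar> ^ (2 * j) \<le> \<tau> ^ (2 * j)" by (intro power_mono) auto
      then show "(x - t) ^ (2 * j) \<le> \<tau> ^ (2 * j)" by (simp add: power_even_abs)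
    qed simp
    also have "\<dots> = ennreal (\<tau> ^ (2 * j))" using emeasure_space_1 by simp
    finally show ?thesis .
  qed
  show thesis
  proof (rule that[of ?S ?\<rho>, OF _ _ _ _ dens mom])
    show "?S \<in> variational_slabs (Uniform B)"
    proof -
      have "?S = uniform_dist l (l + \<tau>)" using assms by (simp add: uniform_dist_of_less)
      then show ?thesis using l assms unfolding variational_slabs.simps by fastforce
    qed
  qed (use assms in \<open>auto simp: indicator_def\<close>)
qed

lemma normal_slab_competitor:
  fixes s :: real
  defines "c \<equiv> min 1 (s / 2)"
  assumes s: "0 < s" and t: "\<bar>t\<bar> \<le> T" and \<tau>: "0 < \<tau>" "\<tau> \<le> 1"
  obtains S \<rho> where "S \<in> variational_slabs (Normal s)" "\<rho> \<in> borel_measurable borel"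
    "\<And>x. 0 \<le> \<rho> x" "\<And>x. \<rho> x \<le> (s / c * exp (T\<^sup>2 / s\<^sup>2)) / \<tau>"
    "S = density (slab_dist (Normal s)) (\<lambda>x. ennreal (\<rho> x))"
    "\<And>j. (\<integral>\<^sup>+x. ennreal ((x - t) ^ (2 * j)) \<partial>S) \<le> ennreal (fact (2 * j) / fact j * (c\<^sup>2 / 2) ^ j * \<tau> ^ (2 * j))"
proof -
  have c: "0 < c" "c \<le> 1" "c \<le> s / 2" using s by (auto simp: c_def)
  \<comment> \<open>With a standard deviation of at most \<open>s / 2\<close> the difference of the two exponents is bounded
    above.\<close>
  define u where "u = \<tau> * c"
  have "u \<le> c" using \<tau> c mult_right_mono[of \<tau> 1 c] by (simp add: u_def)
  then have u: "0 < u" "u \<le> s / 2"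
    using c \<tau> by (simp add: u_def, linarith)
  have u2: "2 * u\<^sup>2 \<le> s\<^sup>2"
  proof -
    have "4 * u\<^sup>2 \<le> s\<^sup>2" using u power_mono[of u "s / 2" 2] by (simp add: power_divide)
    then show ?thesis using zero_le_power2[of u] by linarith
  qed
  let ?\<rho> = "\<lambda>x. normal_density t u x / normal_density 0 s x"
  have bound: "?\<rho> x \<le> (s / c * exp (T\<^sup>2 / s\<^sup>2)) / \<tau>" for x
  proof -
    have "x\<^sup>2 \<le> 2 * (x - t)\<^sup>2 + 2 * t\<^sup>2"
      using zero_le_power2[of "x - 2 * t"] by (simp add: power2_eq_square algebra_simps)
    then have "x\<^sup>2 / (2 * s\<^sup>2) \<le> (2 * (x - t)\<^sup>2 + 2 * t\<^sup>2) / (2 * s\<^sup>2)"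
      using s by (intro divide_right_mono) auto
    also have "\<dots> = (x - t)\<^sup>2 / s\<^sup>2 + t\<^sup>2 / s\<^sup>2" by (simp add: add_divide_distrib)
    also have "\<dots> \<le> (x - t)\<^sup>2 / (2 * u\<^sup>2) + T\<^sup>2 / s\<^sup>2"
      using u2 u s t abs_le_square_iff[of t T] by (intro add_mono divide_left_mono divide_right_mono) auto
    finally have "- (x - t)\<^sup>2 / (2 * u\<^sup>2) - - (x - 0)\<^sup>2 / (2 * s\<^sup>2) \<le> T\<^sup>2 / s\<^sup>2" by simp
    then have "exp (- (x - t)\<^sup>2 / (2 * u\<^sup>2)) / exp (- (x - 0)\<^sup>2 / (2 * s\<^sup>2)) \<le> exp (T\<^sup>2 / s\<^sup>2)"
      by (simp flip: exp_diff)
    then have "s / u * (exp (- (x - t)\<^sup>2 / (2 * u\<^sup>2)) / exp (- (x - 0)\<^sup>2 / (2 * s\<^sup>2))) \<le> s / u * exp (T\<^sup>2 / s\<^sup>2)"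
      using u s by (intro mult_left_mono) auto
    moreover have "?\<rho> x = s / u * (exp (- (x - t)\<^sup>2 / (2 * u\<^sup>2)) / exp (- (x - 0)\<^sup>2 / (2 * s\<^sup>2)))"
      using u s unfolding normal_density_def by (simp add: real_sqrt_mult field_simps)
    ultimately show ?thesis by (simp add: u_def field_simps)
  qed
  have dens: "normal_dist t u = density (slab_dist (Normal s)) (\<lambda>x. ennreal (?\<rho> x))"
  proof -
    have "density (slab_dist (Normal s)) (\<lambda>x. ennreal (?\<rho> x))
        = density lborel (\<lambda>x. ennreal (normal_density 0 s x) * ennreal (?\<rho> x))"
      unfolding slab_dist.simps normal_dist_def by (rule density_density_eq) auto
    also have "\<dots> = normal_dist t u"
      unfolding normal_dist_def using normal_density_pos[OF s, of 0]
      by (intro arg_cong2[where f = density] ext refl) (simp flip: ennreal_mult' add: less_imp_neq[THEN not_sym])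
    finally show ?thesis by simp
  qed
  have mom: "(\<integral>\<^sup>+x. ennreal ((x - t) ^ (2 * j)) \<partial>normal_dist t u)
      \<le> ennreal (fact (2 * j) / fact j * (c\<^sup>2 / 2) ^ j * \<tau> ^ (2 * j))" for j
  proof -
    have "(\<integral>\<^sup>+x. ennreal ((x - t) ^ (2 * j)) \<partial>normal_dist t u)
        = (\<integral>\<^sup>+x. ennreal (normal_density t u x) * ennreal ((x - t) ^ (2 * j)) \<partial>lborel)"
      unfolding normal_dist_def by (rule nn_integral_density) auto
    also have "\<dots> = (\<integral>\<^sup>+x. ennreal (normal_density t u x * (x - t) ^ (2 * j)) \<partial>lborel)"
      by (simp add: ennreal_mult')
    also have "\<dots> = ennreal (\<integral>x. normal_density t u x * (x - t) ^ (2 * j) \<partial>lborel)"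
      using integrable_normal_moment[OF u(1)] by (intro nn_integral_eq_integral) auto
    also have "\<dots> = ennreal (fact (2 * j) / ((2 / u\<^sup>2) ^ j * fact j))"
      by (simp only: integral_normal_moment_even[OF u(1)])
    also have "fact (2 * j) / ((2 / u\<^sup>2) ^ j * fact j) = fact (2 * j) / fact j * (u\<^sup>2 / 2) ^ j"
      using u by (simp add: power_divide)
    also have "(u\<^sup>2 / 2) ^ j = (c\<^sup>2 / 2) ^ j * \<tau> ^ (2 * j)"
      by (simp add: u_def power_mult power_divide power_mult_distrib)
    finally show ?thesis by (simp add: mult.assoc)
  qed
  show thesis
    by (rule that[of "normal_dist t u" ?\<rho>, OF _ _ _ bound dens mom]) (use u in auto)
qed

definition is_slab_competitor ::
  "slab \<Rightarrow> real \<Rightarrow> (nat \<Rightarrow> real) \<Rightarrow> real \<Rightarrow> real \<Rightarrow> real measure \<Rightarrow> (real \<Rightarrow> real) \<Rightarrow> bool" where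
  "is_slab_competitor M K C t \<tau> S \<rho> \<longleftrightarrow> S \<in> variational_slabs M \<and> \<rho> \<in> borel_measurable borel \<and>
     (\<forall>x. 0 \<le> \<rho> x \<and> \<rho> x \<le> K / \<tau>) \<and> S = density (slab_dist M) (\<lambda>x. ennreal (\<rho> x)) \<and>
     (\<forall>j. (\<integral>\<^sup>+x. ennreal ((x - t) ^ (2 * j)) \<partial>S) \<le> ennreal (C j * \<tau> ^ (2 * j)))"

lemma slab_competitor:
  assumes M: "valid_slab M"
  obtains K :: real and C :: "nat \<Rightarrow> real" where "0 < K" "\<And>j. 0 \<le> C j"
    and "\<And>t \<tau>. \<bar>t\<bar> \<le> T \<Longrightarrow> (\<And>B. M = Uniform B \<Longrightarrow> \<bar>t\<bar> \<le> B) \<Longrightarrow> 0 < \<tau> \<Longrightarrow> \<tau> \<le> 1 \<Longrightarrow>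
      \<exists>S \<rho>. is_slab_competitor M K C t \<tau> S \<rho>"
proof (cases M)
  case (Uniform B)
  then have B: "1 < B" using M by simp
  show thesis
  proof (rule that[of "2 * B" "\<lambda>_. 1"])
    fix t \<tau> :: real assume "\<And>B. M = Uniform B \<Longrightarrow> \<bar>t\<bar> \<le> B" "0 < \<tau>" "\<tau> \<le> 1"
    with B Uniform uniform_slab_competitor[of B t \<tau>]
    show "\<exists>S \<rho>. is_slab_competitor M (2 * B) (\<lambda>_. 1) t \<tau> S \<rho>"
      unfolding is_slab_competitor_def mult_1 by metis
  qed (use B in auto)
next
  case (Normal s)
  then have s: "0 < s" using M by simp
  define c where "c = min 1 (s / 2)"
  have c: "0 < c" using s by (simp add: c_def)
  show thesis
  proof (rule that[of "s / c * exp (T\<^sup>2 / s\<^sup>2)" "\<lambda>j. fact (2 * j) / fact j * (c\<^sup>2 / 2) ^ j"])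
    fix t \<tau> :: real assume "\<bar>t\<bar> \<le> T" "0 < \<tau>" "\<tau> \<le> 1"
    with s Normal normal_slab_competitor[of s t T \<tau>, folded c_def]
    show "\<exists>S \<rho>. is_slab_competitor M (s / c * exp (T\<^sup>2 / s\<^sup>2)) (\<lambda>j. fact (2 * j) / fact j * (c\<^sup>2 / 2) ^ j) t \<tau> S \<rho>"
      unfolding is_slab_competitor_def by metis
  qed (use s c in auto)
qed

section \<open>The spike-and-slab prior and the variational family\<close>

lemma density_PiM:
  fixes M :: "'i \<Rightarrow> 'a measure" and f :: "'i \<Rightarrow> 'a \<Rightarrow> ennreal"
  assumes I: "finite I" and M: "\<And>i. prob_space (M i)"
    and f [measurable]: "\<And>i. f i \<in> borel_measurable (M i)"
    and D: "\<And>i. prob_space (density (M i) (f i))"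
  shows "(\<Pi>\<^sub>M i\<in>I. density (M i) (f i)) = density (Pi\<^sub>M I M) (\<lambda>x. \<Prod>i\<in>I. f i (x i))"
proof -
  interpret D: product_sigma_finite "\<lambda>i. density (M i) (f i)"
    by (intro product_sigma_finite.intro prob_space_imp_sigma_finite D)
  interpret M: product_sigma_finite M
    by (intro product_sigma_finite.intro prob_space_imp_sigma_finite M)
  show ?thesis
  proof (rule D.PiM_eqI[OF I, symmetric])
    show "sets (density (Pi\<^sub>M I M) (\<lambda>x. \<Prod>i\<in>I. f i (x i))) = sets (\<Pi>\<^sub>M i\<in>I. density (M i) (f i))"
      by (simp cong: sets_PiM_cong)
    fix A assume A: "\<And>i. i \<in> I \<Longrightarrow> A i \<in> sets (density (M i) (f i))"
    then have [measurable]: "Pi\<^sub>E I A \<in> sets (Pi\<^sub>M I M)"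
      by (intro sets_PiM_I_finite I) auto
    have "emeasure (density (Pi\<^sub>M I M) (\<lambda>x. \<Prod>i\<in>I. f i (x i))) (Pi\<^sub>E I A)
        = (\<integral>\<^sup>+x. (\<Prod>i\<in>I. f i (x i)) * indicator (Pi\<^sub>E I A) x \<partial>Pi\<^sub>M I M)"
      by (rule emeasure_density) auto
    also have "\<dots> = (\<integral>\<^sup>+x. (\<Prod>i\<in>I. f i (x i) * indicator (A i) (x i)) \<partial>Pi\<^sub>M I M)"
    proof (rule nn_integral_cong)
      fix x assume "x \<in> space (Pi\<^sub>M I M)"
      then have "indicator (Pi\<^sub>E I A) x = (\<Prod>i\<in>I. indicator (A i) (x i) :: ennreal)"
        using I by (auto simp: indicator_def space_PiM PiE_def Pi_def prod_zero_iff
            simp flip: prod_zero_iff intro!: prod.neutral[symmetric])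
      then show "(\<Prod>i\<in>I. f i (x i)) * indicator (Pi\<^sub>E I A) x = (\<Prod>i\<in>I. f i (x i) * indicator (A i) (x i))"
        by (simp add: prod.distrib)
    qed
    also have "\<dots> = (\<Prod>i\<in>I. \<integral>\<^sup>+y. f i y * indicator (A i) y \<partial>M i)"
      using A by (intro M.product_nn_integral_prod I) auto
    also have "\<dots> = (\<Prod>i\<in>I. emeasure (density (M i) (f i)) (A i))"
      using A by (intro prod.cong refl emeasure_density[symmetric]) auto
    finally show "emeasure (density (Pi\<^sub>M I M) (\<lambda>x. \<Prod>i\<in>I. f i (x i))) (Pi\<^sub>E I A)
        = (\<Prod>i\<in>I. emeasure (density (M i) (f i)) (A i))" .
  qed
qed

lemma nn_integral_PiM_component:
  assumes "\<And>i. i \<in> I \<Longrightarrow> prob_space (M i)" "k \<in> I" and "f \<in> borel_measurable (M k)"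
  shows "(\<integral>\<^sup>+x. f (x k) \<partial>Pi\<^sub>M I M) = (\<integral>\<^sup>+y. f y \<partial>M k)"
proof -
  have "(\<integral>\<^sup>+y. f y \<partial>M k) = (\<integral>\<^sup>+y. f y \<partial>distr (Pi\<^sub>M I M) (M k) (\<lambda>x. x k))"
    using assms by (subst distr_PiM_component) auto
  also have "\<dots> = (\<integral>\<^sup>+x. f (x k) \<partial>Pi\<^sub>M I M)"
    using assms by (intro nn_integral_distr) auto
  finally show ?thesis by simp
qed

definition inclusion_patterns :: "param set \<Rightarrow> nat \<Rightarrow> (param \<Rightarrow> nat) set" where
  "inclusion_patterns I s = {\<gamma> \<in> I \<rightarrow>\<^sub>E {0, 1}. (\<Sum>i\<in>I. \<gamma> i) = s}"

definition pattern_dist :: "slab \<Rightarrow> param set \<Rightarrow> (param \<Rightarrow> nat) \<Rightarrow> (param \<Rightarrow> real) measure" where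
  "pattern_dist M I \<gamma> = (\<Pi>\<^sub>M i\<in>I. if \<gamma> i = 1 then slab_dist M else return borel 0)"

definition pattern_of :: "param set \<Rightarrow> param set \<Rightarrow> param \<Rightarrow> nat" where
  "pattern_of I A = (\<lambda>i\<in>I. if i \<in> A then 1 else 0)"

lemma sum_pattern:
  fixes \<gamma> :: "param \<Rightarrow> nat"
  assumes "finite I" "\<gamma> \<in> I \<rightarrow>\<^sub>E {0, 1}"
  shows "(\<Sum>i\<in>I. \<gamma> i) = card {i \<in> I. \<gamma> i = 1}"
proof -
  have "(\<Sum>i\<in>I. \<gamma> i) = (\<Sum>i\<in>I. if \<gamma> i = 1 then 1 else 0)"
    using assms by (intro sum.cong) (auto simp: PiE_iff)
  also have "\<dots> = card {i \<in> I. \<gamma> i = 1}"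
    using assms by (simp add: sum.If_cases Int_def)
  finally show ?thesis .
qed

lemma pattern_of_in_inclusion_patterns:
  assumes "finite I" "A \<subseteq> I" "card A = s"
  shows "pattern_of I A \<in> inclusion_patterns I s"
proof -
  have P: "pattern_of I A \<in> I \<rightarrow>\<^sub>E {0, 1}" by (auto simp: pattern_of_def)
  moreover have "{i \<in> I. pattern_of I A i = 1} = A" using assms by (auto simp: pattern_of_def)
  ultimately show ?thesis
    using sum_pattern[OF assms(1) P] assms(3) by (simp add: inclusion_patterns_def)
qed

lemma
  assumes I: "finite I" and s: "s \<le> card I"
  shows finite_inclusion_patterns: "finite (inclusion_patterns I s)"
    and inclusion_patterns_nonempty: "inclusion_patterns I s \<noteq> {}"
    and card_inclusion_patterns_le: "card (inclusion_patterns I s) \<le> card I ^ s"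
proof -
  show "finite (inclusion_patterns I s)"
    unfolding inclusion_patterns_def using I by (intro finite_subset[OF _ finite_PiE[of I "\<lambda>_. {0, 1}"]]) auto
  obtain A where "A \<subseteq> I" "card A = s" using s by (meson obtain_subset_with_card_n)
  then show "inclusion_patterns I s \<noteq> {}" using pattern_of_in_inclusion_patterns[OF I] by blast
  have "card (inclusion_patterns I s) \<le> card {A. A \<subseteq> I \<and> card A = s}"
  proof (rule card_inj_on_le)
    show "inj_on (\<lambda>\<gamma>. {i \<in> I. \<gamma> i = 1}) (inclusion_patterns I s)"
    proof (rule inj_onI)
      fix \<gamma> \<gamma>' assume *: "\<gamma> \<in> inclusion_patterns I s" "\<gamma>' \<in> inclusion_patterns I s"
        and eq: "{i \<in> I. \<gamma> i = 1} = {i \<in> I. \<gamma>' i = 1}"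
      have P: "\<gamma> \<in> I \<rightarrow>\<^sub>E {0, 1}" "\<gamma>' \<in> I \<rightarrow>\<^sub>E {0, 1}"
        using * by (auto simp: inclusion_patterns_def)
      show "\<gamma> = \<gamma>'"
      proof (rule PiE_ext[OF P])
        fix i assume "i \<in> I"
        with P have "\<gamma> i \<in> {0, 1}" "\<gamma>' i \<in> {0, 1}" by auto
        moreover have "\<gamma> i = 1 \<longleftrightarrow> \<gamma>' i = 1" using eq \<open>i \<in> I\<close> by blast
        ultimately show "\<gamma> i = \<gamma>' i" by auto
      qed
    qed
    show "(\<lambda>\<gamma>. {i \<in> I. \<gamma> i = 1}) ` inclusion_patterns I s \<subseteq> {A. A \<subseteq> I \<and> card A = s}"
      using sum_pattern[OF I] by (auto simp: inclusion_patterns_def)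
    show "finite {A. A \<subseteq> I \<and> card A = s}" using I by simp
  qed
  also have "\<dots> = card I choose s" by (rule n_subsets[OF I])
  also have "\<dots> \<le> card I ^ s" by (rule binomial_le_pow[OF s])
  finally show "card (inclusion_patterns I s) \<le> card I ^ s" .
qed

locale spike_slab =
  fixes M :: slab and I :: "param set" and s :: nat
  assumes M: "valid_slab M" and I: "finite I" and s: "s \<le> card I"
begin

lemma prob_space_pattern_factor: "prob_space (if b then slab_dist M else return borel 0)"
  using M by (auto intro: prob_space_slab_dist prob_space_return)

lemma sets_pattern_dist [simp, measurable_cong]: "sets (pattern_dist M I \<gamma>) = sets (param_space I)"
  unfolding pattern_dist_def by (intro sets_PiM_cong) auto

lemma prob_space_pattern_dist: "prob_space (pattern_dist M I \<gamma>)"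
  unfolding pattern_dist_def by (intro prob_space_PiM prob_space_pattern_factor)

lemma pattern_dist_kernel:
  "pattern_dist M I \<in> measure_pmf (inclusion_prior I s) \<rightarrow>\<^sub>M subprob_algebra (param_space I)"
proof -
  have "pattern_dist M I \<gamma> \<in> space (subprob_algebra (param_space I))" for \<gamma>
    using prob_space_pattern_dist by (simp add: space_subprob_algebra prob_space_imp_subprob_space)
  then show ?thesis by simp
qed

lemma prior_eq: "prior M I s = measure_pmf (inclusion_prior I s) \<bind> pattern_dist M I"
  by (simp add: prior_def pattern_dist_def[abs_def])

lemma sets_prior [simp, measurable_cong]: "sets (prior M I s) = sets (param_space I)"
  unfolding prior_eq by (rule sets_bind) auto

lemma emeasure_prior:
  assumes "A \<in> sets (param_space I)"
  shows "emeasure (prior M I s) A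
    = (\<Sum>\<gamma>\<in>inclusion_patterns I s. emeasure (pattern_dist M I \<gamma>) A) / of_nat (card (inclusion_patterns I s))"
proof -
  have "emeasure (prior M I s) A = (\<integral>\<^sup>+\<gamma>. emeasure (pattern_dist M I \<gamma>) A \<partial>measure_pmf (inclusion_prior I s))"
    unfolding prior_eq by (rule emeasure_bind[OF _ pattern_dist_kernel assms]) simp
  also have "\<dots> = (\<Sum>\<gamma>\<in>inclusion_patterns I s. emeasure (pattern_dist M I \<gamma>) A) / of_nat (card (inclusion_patterns I s))"
    unfolding inclusion_prior_def inclusion_patterns_def[symmetric]
    using finite_inclusion_patterns[OF I s] inclusion_patterns_nonempty[OF I s]
    by (simp add: nn_integral_pmf_of_set)
  finally show ?thesis .
qed

text \<open>
  The prior is a mixture over the inclusion patterns.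
\<close>

lemma emeasure_prior_le:
  assumes "A \<in> sets (param_space I)"
    and "\<And>\<gamma>. \<gamma> \<in> inclusion_patterns I s \<Longrightarrow> emeasure (pattern_dist M I \<gamma>) A \<le> c"
  shows "emeasure (prior M I s) A \<le> c"
proof -
  let ?G = "inclusion_patterns I s"
  have "emeasure (prior M I s) A \<le> (\<Sum>\<gamma>\<in>?G. c) / of_nat (card ?G)"
    unfolding emeasure_prior[OF assms(1)] by (intro divide_right_mono_ennreal sum_mono assms(2))
  also have "\<dots> = c"
    using finite_inclusion_patterns[OF I s] inclusion_patterns_nonempty[OF I s]
    by (simp add: ennreal_mult_divide_eq mult.commute card_eq_0_iff)
  finally show ?thesis .
qed

lemma prob_space_prior: "prob_space (prior M I s)"
  unfolding prior_eq
proof (rule prob_space.prob_space_bind[OF _ _ pattern_dist_kernel])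
  show "AE \<gamma> in measure_pmf (inclusion_prior I s). prob_space (pattern_dist M I \<gamma>)"
    by (simp add: prob_space_pattern_dist)
qed (rule measure_pmf.prob_space_axioms)

lemma AE_pattern_dist:
  "AE \<theta> in pattern_dist M I \<gamma>. \<forall>i\<in>I. \<theta> i \<noteq> 0 \<longleftrightarrow> \<gamma> i = 1"
proof (rule AE_finite_allI[OF I])
  fix i assume "i \<in> I"
  then show "AE \<theta> in pattern_dist M I \<gamma>. \<theta> i \<noteq> 0 \<longleftrightarrow> \<gamma> i = 1"
    unfolding pattern_dist_def
    by (intro AE_PiM_component[where P = "\<lambda>x. x \<noteq> 0 \<longleftrightarrow> \<gamma> i = 1"] prob_space_pattern_factor)
      (use AE_slab_dist_nonzero[OF M] in \<open>auto simp: AE_return\<close>)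
qed

lemma AE_prior_sparse: "AE \<theta> in prior M I s. card {k \<in> I. \<theta> k \<noteq> 0} \<le> s"
proof -
  let ?A = "{\<theta> \<in> space (param_space I). \<not> card {k \<in> I. \<theta> k \<noteq> 0} \<le> s}"
  have count: "card {k \<in> I. \<theta> k \<noteq> 0} \<le> s \<longleftrightarrow> (\<Sum>k\<in>I. if \<theta> k \<noteq> 0 then 1 else (0::real)) \<le> real s"
    for \<theta> :: "param \<Rightarrow> real"
    using I by (simp add: sum.If_cases Int_def)
  have "?A = {\<theta> \<in> space (param_space I). \<not> (\<Sum>k\<in>I. if \<theta> k \<noteq> 0 then 1 else (0::real)) \<le> real s}"
    by (simp only: count)
  also have "\<dots> \<in> sets (param_space I)"
    by measurable
  finally have A: "?A \<in> sets (param_space I)" .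
  have "emeasure (prior M I s) ?A \<le> 0"
  proof (rule emeasure_prior_le[OF A])
    fix \<gamma> assume \<gamma>: "\<gamma> \<in> inclusion_patterns I s"
    then have card: "card {i \<in> I. \<gamma> i = 1} = s"
      using sum_pattern[OF I] by (auto simp: inclusion_patterns_def)
    have "AE \<theta> in pattern_dist M I \<gamma>. \<not> \<not> card {k \<in> I. \<theta> k \<noteq> 0} \<le> s"
      using AE_pattern_dist[of \<gamma>]
    proof eventually_elim
      fix \<theta> :: "param \<Rightarrow> real" assume "\<forall>i\<in>I. \<theta> i \<noteq> 0 \<longleftrightarrow> \<gamma> i = 1"
      then have "{k \<in> I. \<theta> k \<noteq> 0} = {i \<in> I. \<gamma> i = 1}" by blast
      then show "\<not> \<not> card {k \<in> I. \<theta> k \<noteq> 0} \<le> s" using card by simp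
    qed
    then show "emeasure (pattern_dist M I \<gamma>) ?A \<le> 0"
      using A by (subst (asm) AE_iff_measurable[OF _ refl]) (auto simp: sets_eq_imp_space_eq[OF sets_pattern_dist])
  qed
  then show ?thesis
    using A by (subst AE_iff_measurable[OF _ refl]) (auto simp: sets_eq_imp_space_eq[OF sets_prior])
qed

lemma prior_tail_le:
  fixes b c :: real
  assumes tail: "emeasure (slab_dist M) {x. b < \<bar>x\<bar>} \<le> ennreal c" and b: "0 \<le> b" and c: "0 \<le> c"
  shows "emeasure (prior M I s) {\<theta> \<in> space (param_space I). \<exists>k\<in>I. b < \<bar>\<theta> k\<bar>} \<le> ennreal (real (card I) * c)"
proof (rule emeasure_prior_le)
  show "{\<theta> \<in> space (param_space I). \<exists>k\<in>I. b < \<bar>\<theta> k\<bar>} \<in> sets (param_space I)"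
    using I by measurable
  fix \<gamma>
  have "emeasure (pattern_dist M I \<gamma>) {\<theta> \<in> space (param_space I). \<exists>k\<in>I. b < \<bar>\<theta> k\<bar>}
      = emeasure (pattern_dist M I \<gamma>) (\<Union>k\<in>I. {\<theta> \<in> space (param_space I). b < \<bar>\<theta> k\<bar>})"
    by (rule arg_cong[where f = "emeasure _"]) auto
  also have "\<dots> \<le> (\<Sum>k\<in>I. emeasure (pattern_dist M I \<gamma>) {\<theta> \<in> space (param_space I). b < \<bar>\<theta> k\<bar>})"
    using I by (intro emeasure_subadditive_finite) auto
  also have "\<dots> \<le> (\<Sum>k\<in>I. ennreal c)"
  proof (rule sum_mono)
    fix k assume k: "k \<in> I"
    let ?F = "\<lambda>i. if \<gamma> i = 1 then slab_dist M else return borel (0::real)"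
    have "emeasure (pattern_dist M I \<gamma>) {\<theta> \<in> space (param_space I). b < \<bar>\<theta> k\<bar>}
        = (\<integral>\<^sup>+\<theta>. indicator {\<theta> \<in> space (param_space I). b < \<bar>\<theta> k\<bar>} \<theta> \<partial>pattern_dist M I \<gamma>)"
      using k by (intro nn_integral_indicator[symmetric]) simp
    also have "\<dots> = (\<integral>\<^sup>+\<theta>. indicator {x. b < \<bar>x\<bar>} (\<theta> k) \<partial>pattern_dist M I \<gamma>)"
      by (intro nn_integral_cong) (simp add: indicator_def sets_eq_imp_space_eq[OF sets_pattern_dist])
    also have "\<dots> = (\<integral>\<^sup>+y. indicator {x. b < \<bar>x\<bar>} y \<partial>?F k)"
      unfolding pattern_dist_def by (rule nn_integral_PiM_component[OF prob_space_pattern_factor k]) auto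
    also have "\<dots> \<le> ennreal c"
      using tail b by (auto simp: nn_integral_return)
    finally show "emeasure (pattern_dist M I \<gamma>) {\<theta> \<in> space (param_space I). b < \<bar>\<theta> k\<bar>} \<le> ennreal c" .
  qed
  also have "\<dots> = ennreal (real (card I) * c)" using c by (simp add: ennreal_mult' ennreal_of_nat_eq_real_of_nat)
  finally show "emeasure (pattern_dist M I \<gamma>) {\<theta> \<in> space (param_space I). \<exists>k\<in>I. b < \<bar>\<theta> k\<bar>} \<le> ennreal (real (card I) * c)" .
qed

text \<open>
  The slab has no atom at the origin, so the support of \<open>\<theta>\<close> reveals the inclusion
  pattern.  Each component of the prior mixture is therefore the prior conditioned on an event.
\<close>

lemma pattern_dist_eq_density_prior:
  assumes \<gamma>: "\<gamma> \<in> inclusion_patterns I s"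
  shows "pattern_dist M I \<gamma> = density (prior M I s)
    (\<lambda>\<theta>. of_nat (card (inclusion_patterns I s)) * indicator {\<theta>. \<forall>i\<in>I. \<theta> i \<noteq> 0 \<longleftrightarrow> \<gamma> i = 1} \<theta>)"
    (is "_ = density _ (\<lambda>\<theta>. of_nat ?c * indicator ?E \<theta>)")
proof (rule measure_eqI)
  fix A assume "A \<in> sets (pattern_dist M I \<gamma>)"
  then have A [measurable]: "A \<in> sets (param_space I)" by simp
  have c: "of_nat ?c \<noteq> (0::ennreal)" "of_nat ?c \<noteq> (top::ennreal)"
    using finite_inclusion_patterns[OF I s] inclusion_patterns_nonempty[OF I s] by (auto simp: card_eq_0_iff)
  have E [measurable]: "{\<theta> \<in> space (param_space I). \<theta> \<in> ?E} \<in> sets (param_space I)"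
    using I by simp
  have AE: "A \<inter> ?E = A \<inter> {\<theta> \<in> space (param_space I). \<theta> \<in> ?E}"
    using sets.sets_into_space[OF A] by auto
  have meas [measurable]: "A \<inter> ?E \<in> sets (param_space I)" unfolding AE by measurable
  have "emeasure (density (prior M I s) (\<lambda>\<theta>. of_nat ?c * indicator ?E \<theta>)) A
      = (\<integral>\<^sup>+\<theta>. of_nat ?c * indicator ?E \<theta> * indicator A \<theta> \<partial>prior M I s)"
  proof (rule emeasure_density)
    have "(indicator ?E :: _ \<Rightarrow> ennreal) \<in> borel_measurable (param_space I)"
      using E by (subst measurable_cong[where g = "indicator {\<theta> \<in> space (param_space I). \<theta> \<in> ?E}"])
        (auto simp: indicator_def)
    then have "(indicator ?E :: _ \<Rightarrow> ennreal) \<in> borel_measurable (prior M I s)"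
      by (simp only: measurable_cong_sets[OF sets_prior refl])
    then show "(\<lambda>\<theta>. of_nat ?c * indicator ?E \<theta> :: ennreal) \<in> borel_measurable (prior M I s)"
      by (intro borel_measurable_times_ennreal borel_measurable_const)
  qed simp
  also have "\<dots> = (\<integral>\<^sup>+\<theta>. of_nat ?c * indicator (A \<inter> ?E) \<theta> \<partial>prior M I s)"
    by (intro nn_integral_cong) (auto simp: indicator_def)
  also have "\<dots> = of_nat ?c * emeasure (prior M I s) (A \<inter> ?E)"
    by (rule nn_integral_cmult_indicator) (simp only: sets_prior meas)
  also have "\<dots> = (\<Sum>\<gamma>'\<in>inclusion_patterns I s. emeasure (pattern_dist M I \<gamma>') (A \<inter> ?E))"
    unfolding emeasure_prior[OF meas] ennreal_times_divide mult.commute[of "of_nat ?c"]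
    by (rule ennreal_mult_divide_eq[OF c])
  also have "\<dots> = (\<Sum>\<gamma>'\<in>inclusion_patterns I s. if \<gamma>' = \<gamma> then emeasure (pattern_dist M I \<gamma>) A else 0)"
  proof (intro sum.cong refl)
    fix \<gamma>' assume \<gamma>': "\<gamma>' \<in> inclusion_patterns I s"
    show "emeasure (pattern_dist M I \<gamma>') (A \<inter> ?E) = (if \<gamma>' = \<gamma> then emeasure (pattern_dist M I \<gamma>) A else 0)"
    proof (cases "\<gamma>' = \<gamma>")
      case True
      have "AE \<theta> in pattern_dist M I \<gamma>. \<theta> \<in> A \<inter> ?E \<longleftrightarrow> \<theta> \<in> A"
        using AE_pattern_dist[of \<gamma>] by eventually_elim simp
      then have "emeasure (pattern_dist M I \<gamma>) (A \<inter> ?E) = emeasure (pattern_dist M I \<gamma>) A"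
        by (rule emeasure_eq_AE) (simp_all only: sets_pattern_dist A meas)
      with True show ?thesis by simp
    next
      case False
      have P: "\<gamma> \<in> I \<rightarrow>\<^sub>E {0, 1}" "\<gamma>' \<in> I \<rightarrow>\<^sub>E {0, 1}"
        using \<gamma> \<gamma>' by (auto simp: inclusion_patterns_def)
      obtain i where i: "i \<in> I" "\<gamma> i \<noteq> \<gamma>' i" using False PiE_ext[OF P] by metis
      then have "\<gamma> i \<in> {0, 1}" "\<gamma>' i \<in> {0, 1}" using P by auto
      with i have ne: "\<gamma> i = 1 \<longleftrightarrow> \<gamma>' i \<noteq> 1" by auto
      have "AE \<theta> in pattern_dist M I \<gamma>'. \<theta> \<in> A \<inter> ?E \<longleftrightarrow> \<theta> \<in> {}"
        using AE_pattern_dist[of \<gamma>'] by eventually_elim (use i(1) ne in auto)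
      then have "emeasure (pattern_dist M I \<gamma>') (A \<inter> ?E) = emeasure (pattern_dist M I \<gamma>') {}"
        by (rule emeasure_eq_AE) (simp_all only: sets_pattern_dist meas sets.empty_sets)
      with False show ?thesis by simp
    qed
  qed
  also have "\<dots> = emeasure (pattern_dist M I \<gamma>) A"
    using \<gamma> finite_inclusion_patterns[OF I s] by simp
  finally show "emeasure (pattern_dist M I \<gamma>) A
      = emeasure (density (prior M I s) (\<lambda>\<theta>. of_nat ?c * indicator ?E \<theta>)) A" by simp
qed simp

end

lemma
  fixes T :: "real measure"
  assumes T: "prob_space T" "sets T = sets borel"
  shows prob_space_spike_slab_mixture:
      "prob_space (measure_pmf p \<bind> (\<lambda>b. if b then T else return borel 0))"
    and sets_spike_slab_mixture:
      "sets (measure_pmf p \<bind> (\<lambda>b. if b then T else return borel 0)) = sets borel"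
proof -
  let ?K = "\<lambda>b. if b then T else return borel (0::real)"
  have K: "prob_space (?K b)" "sets (?K b) = sets borel" for b
    using T by (auto intro: prob_space_return)
  then have meas: "?K \<in> measure_pmf p \<rightarrow>\<^sub>M subprob_algebra borel"
    by (simp add: space_subprob_algebra prob_space_imp_subprob_space)
  show "prob_space (measure_pmf p \<bind> ?K)"
    by (rule prob_space.prob_space_bind[OF measure_pmf.prob_space_axioms _ meas]) (simp add: K(1))
  show "sets (measure_pmf p \<bind> ?K) = sets borel"
    by (rule sets_bind) (use K in auto)
qed

lemma
  assumes "q \<in> variational_family M I"
  shows prob_space_variational_family: "prob_space q"
    and sets_variational_family: "sets q = sets (param_space I)"
proof -
  obtain \<nu> S where q: "q = (\<Pi>\<^sub>M i\<in>I. measure_pmf (bernoulli_pmf (\<nu> i)) \<bind> (\<lambda>b. if b then S i else return borel 0))"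
    and S: "\<And>i. i \<in> I \<Longrightarrow> S i \<in> variational_slabs M"
    using assms by (auto simp: variational_family_def)
  show "prob_space q" unfolding q
    using S by (intro prob_space_PiM prob_space_spike_slab_mixture prob_space_variational_slab sets_variational_slab)
  show "sets q = sets (param_space I)" unfolding q
    using S by (intro sets_PiM_cong refl sets_spike_slab_mixture prob_space_variational_slab sets_variational_slab)
qed

lemma bind_bernoulli_pmf_0_1:
  fixes T :: "real measure"
  assumes T: "prob_space T" "sets T = sets borel"
  shows "measure_pmf (bernoulli_pmf (if A then 1 else 0)) \<bind> (\<lambda>b. if b then T else return borel 0)
    = (if A then T else return borel 0)"
proof -
  let ?K = "\<lambda>b. if b then T else return borel (0::real)"
  have meas: "?K \<in> count_space UNIV \<rightarrow>\<^sub>M subprob_algebra borel"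
    using T by (simp add: space_subprob_algebra prob_space_imp_subprob_space prob_space_return)
  have "bernoulli_pmf (if A then 1 else 0) = return_pmf A"
    by (intro pmf_eqI) (auto simp: indicator_def split: bool.splits)
  then show ?thesis
    by (simp only: return_pmf.rep_eq) (rule bind_return[OF meas], simp)
qed

definition has_sparse_competitor ::
  "slab \<Rightarrow> param set \<Rightarrow> nat \<Rightarrow> (param \<Rightarrow> real) \<Rightarrow> real \<Rightarrow> (nat \<Rightarrow> real) \<Rightarrow> real \<Rightarrow> bool" where
  "has_sparse_competitor M I s \<theta> K C \<tau> \<longleftrightarrow>
     (\<exists>q \<rho>. q \<in> variational_family M I \<and> \<rho> \<in> borel_measurable (param_space I) \<and>
        (\<forall>x. 0 \<le> \<rho> x \<and> \<rho> x \<le> (card I * (K / \<tau>)) ^ s) \<and>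
        q = density (prior M I s) (\<lambda>x. ennreal (\<rho> x)) \<and>
        (\<forall>k\<in>I. \<forall>j\<ge>1. (\<integral>\<^sup>+\<eta>. ennreal ((\<eta> k - \<theta> k) ^ (2 * j)) \<partial>q) \<le> ennreal (C j * \<tau> ^ (2 * j))))"

text \<open>
  The competitor puts all its mass on one inclusion pattern that contains the support of
  \<open>\<theta>\<close>.  The bound on its density with respect to the prior consists of \<open>card I ^ s\<close> for the
  prior probability of the pattern and of \<open>K / \<tau>\<close> for each of the \<open>s\<close> included coordinates.  The
  constants \<open>K\<close> and \<open>C\<close> have to serve all sample sizes, so they are chosen before the index set
  and the sparsity.
\<close>

lemma sparse_competitor:
  assumes M: "valid_slab M"
  obtains K :: real and C :: "nat \<Rightarrow> real" where "0 < K" "\<And>j. 0 \<le> C j"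
    and "\<And>I s \<theta> \<tau>. finite I \<Longrightarrow> s \<le> card I \<Longrightarrow> card {k \<in> I. \<theta> k \<noteq> 0} \<le> s \<Longrightarrow>
      (\<And>k. k \<in> I \<Longrightarrow> \<bar>\<theta> k\<bar> \<le> T) \<Longrightarrow> (\<And>B k. M = Uniform B \<Longrightarrow> k \<in> I \<Longrightarrow> \<bar>\<theta> k\<bar> \<le> B) \<Longrightarrow>
      0 < \<tau> \<Longrightarrow> \<tau> \<le> 1 \<Longrightarrow> has_sparse_competitor M I s \<theta> K C \<tau>"
proof (rule slab_competitor[OF M, of T])
  fix K :: real and C :: "nat \<Rightarrow> real"
  assume K: "0 < K" and C: "\<And>j. 0 \<le> C j"
    and comp: "\<And>t \<tau>. \<bar>t\<bar> \<le> T \<Longrightarrow> (\<And>B. M = Uniform B \<Longrightarrow> \<bar>t\<bar> \<le> B) \<Longrightarrow> 0 < \<tau> \<Longrightarrow> \<tau> \<le> 1 \<Longrightarrow>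
      \<exists>S \<rho>. is_slab_competitor M K C t \<tau> S \<rho>"
  show thesis
  proof (rule that[OF K C])
    fix I :: "param set" and s :: nat and \<theta> :: "param \<Rightarrow> real" and \<tau> :: real
    assume I: "finite I" and s: "s \<le> card I" and supp: "card {k \<in> I. \<theta> k \<noteq> 0} \<le> s"
      and \<theta>: "\<And>k. k \<in> I \<Longrightarrow> \<bar>\<theta> k\<bar> \<le> T" "\<And>B k. M = Uniform B \<Longrightarrow> k \<in> I \<Longrightarrow> \<bar>\<theta> k\<bar> \<le> B"
      and \<tau>: "0 < \<tau>" "\<tau> \<le> 1"
    interpret spike_slab M I s by unfold_locales fact+
    obtain A where A: "{k \<in> I. \<theta> k \<noteq> 0} \<subseteq> A" "A \<subseteq> I" "card A = s"
      using exists_subset_between[OF supp s _ I] by auto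
    have "\<exists>S \<rho>. is_slab_competitor M K C (\<theta> k) \<tau> S \<rho>" if "k \<in> I" for k
      by (rule comp[OF \<theta>(1)[OF that] \<theta>(2)[OF _ that] \<tau>])
    then obtain S r where Sr: "\<And>k. k \<in> I \<Longrightarrow> is_slab_competitor M K C (\<theta> k) \<tau> (S k) (r k)" by metis
    then have S: "\<And>k. k \<in> I \<Longrightarrow> S k \<in> variational_slabs M"
      and r: "\<And>k. k \<in> I \<Longrightarrow> r k \<in> borel_measurable borel"
        "\<And>k x. k \<in> I \<Longrightarrow> 0 \<le> r k x" "\<And>k x. k \<in> I \<Longrightarrow> r k x \<le> K / \<tau>"
      and S_r: "\<And>k. k \<in> I \<Longrightarrow> S k = density (slab_dist M) (\<lambda>x. ennreal (r k x))"
      and mom: "\<And>k j. k \<in> I \<Longrightarrow> (\<integral>\<^sup>+x. ennreal ((x - \<theta> k) ^ (2 * j)) \<partial>S k) \<le> ennreal (C j * \<tau> ^ (2 * j))"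
      unfolding is_slab_competitor_def by blast+
    let ?F = "\<lambda>i. if i \<in> A then slab_dist M else return borel 0"
    let ?f = "\<lambda>i x. if i \<in> A then r i x else 1"
    let ?D = "\<lambda>i. if i \<in> A then S i else return borel 0"
    define q where "q = (\<Pi>\<^sub>M i\<in>I. measure_pmf (bernoulli_pmf (if i \<in> A then 1 else 0)) \<bind>
      (\<lambda>b. if b then S i else return borel 0))"
    have q: "q \<in> variational_family M I"
      unfolding variational_family_def q_def
      by (intro CollectI exI[of _ "\<lambda>i. if i \<in> A then 1 else 0"] exI[of _ S]) (auto simp: S)
    have q_D: "q = (\<Pi>\<^sub>M i\<in>I. ?D i)"
      unfolding q_def by (intro PiM_cong refl bind_bernoulli_pmf_0_1
        prob_space_variational_slab[OF S] sets_variational_slab[OF S])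
    have D_dens: "?D i = density (?F i) (\<lambda>x. ennreal (?f i x))" for i
      using A(2) S_r by (cases "i \<in> A") (auto simp: density_1)
    have prob_D: "prob_space (?D i)" for i
      using A(2) prob_space_variational_slab[OF S] by (auto intro: prob_space_return)
    have f_meas: "?f i \<in> borel_measurable borel" for i
      using r(1)[of i] A(2) by (cases "i \<in> A") auto
    define \<gamma> where "\<gamma> = pattern_of I A"
    have \<gamma>: "\<gamma> \<in> inclusion_patterns I s"
      unfolding \<gamma>_def by (rule pattern_of_in_inclusion_patterns[OF I A(2,3)])
    let ?c = "card (inclusion_patterns I s)"
    let ?E = "{\<theta>::param \<Rightarrow> real. \<forall>i\<in>I. \<theta> i \<noteq> 0 \<longleftrightarrow> i \<in> A}"
    define \<rho> where "\<rho> = (\<lambda>x. real ?c * indicator ?E x * (\<Prod>i\<in>I. ?f i (x i)))"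
    have \<gamma>_A: "\<gamma> i = 1 \<longleftrightarrow> i \<in> A" if "i \<in> I" for i using that by (simp add: \<gamma>_def pattern_of_def)
    have E_meas: "(indicator ?E :: _ \<Rightarrow> real) \<in> borel_measurable (param_space I)"
    proof -
      have "{\<theta> \<in> space (param_space I). \<theta> \<in> ?E} \<in> sets (param_space I)"
        using I by simp
      then show ?thesis
        by (subst measurable_cong[where g = "indicator {\<theta> \<in> space (param_space I). \<theta> \<in> ?E}"])
          (auto simp: indicator_def)
    qed
    have prod_meas: "(\<lambda>x. \<Prod>i\<in>I. ?f i (x i)) \<in> borel_measurable (param_space I)"
    proof (rule borel_measurable_prod)
      fix i assume "i \<in> I"
      then show "(\<lambda>x. ?f i (x i)) \<in> borel_measurable (param_space I)"
        by (rule measurable_compose[OF measurable_component_singleton, where g = "?f i"]) (rule f_meas)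
    qed
    have \<rho>_meas: "\<rho> \<in> borel_measurable (param_space I)"
      unfolding \<rho>_def by (intro borel_measurable_times borel_measurable_const E_meas prod_meas)
    have f_nn: "0 \<le> ?f i x" for i x
      using r(2)[of i x] A(2) by (cases "i \<in> A") auto
    have \<rho>_nn: "0 \<le> \<rho> x" for x
      unfolding \<rho>_def using f_nn by (intro mult_nonneg_nonneg prod_nonneg) auto
    have \<rho>_le: "\<rho> x \<le> (card I * (K / \<tau>)) ^ s" for x
    proof -
      have "(\<Prod>i\<in>I. ?f i (x i)) = (\<Prod>i\<in>A. r i (x i))"
        using A(2) I by (intro prod.mono_neutral_cong_right) auto
      also have "\<dots> \<le> (\<Prod>i\<in>A. K / \<tau>)" using r A(2) by (intro prod_mono) auto
      also have "\<dots> = (K / \<tau>) ^ s" using A(3) by simp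
      finally have "(real ?c * indicator ?E x) * (\<Prod>i\<in>I. ?f i (x i)) \<le> (real (card I ^ s) * 1) * (K / \<tau>) ^ s"
        using card_inclusion_patterns_le[OF I s] f_nn
        by (intro mult_mono prod_nonneg) (auto simp: indicator_def)
      then show ?thesis by (simp only: \<rho>_def power_mult_distrib of_nat_power mult_1_right)
    qed
    have "q = (\<Pi>\<^sub>M i\<in>I. density (?F i) (\<lambda>x. ennreal (?f i x)))"
      by (simp only: q_D D_dens)
    also have "\<dots> = density (\<Pi>\<^sub>M i\<in>I. ?F i) (\<lambda>x. \<Prod>i\<in>I. ennreal (?f i (x i)))"
    proof (rule density_PiM[OF I])
      show "prob_space (?F i)" for i by (rule prob_space_pattern_factor)
      show "(\<lambda>x. ennreal (?f i x)) \<in> borel_measurable (?F i)" for i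
      proof -
        have "sets (?F i) = sets borel" by simp
        then show ?thesis
          using measurable_compose[OF f_meas[of i] measurable_ennreal] measurable_cong_sets[of "?F i" borel borel borel]
          by blast
      qed
      show "prob_space (density (?F i) (\<lambda>x. ennreal (?f i x)))" for i
        using prob_D[of i] by (simp only: D_dens)
    qed
    also have "(\<Pi>\<^sub>M i\<in>I. ?F i) = pattern_dist M I \<gamma>"
      unfolding pattern_dist_def by (intro PiM_cong refl) (simp only: \<gamma>_A)
    also have "\<dots> = density (prior M I s) (\<lambda>\<theta>. ennreal (real ?c * indicator ?E \<theta>))"
    proof -
      have "{\<theta>::param \<Rightarrow> real. \<forall>i\<in>I. \<theta> i \<noteq> 0 \<longleftrightarrow> \<gamma> i = 1} = ?E"
        by (intro Collect_cong ball_cong refl) (simp only: \<gamma>_A)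
      moreover have "of_nat ?c * indicator ?E x = ennreal (real ?c * indicator ?E x)" for x
        by (simp add: indicator_def ennreal_of_nat_eq_real_of_nat)
      ultimately show ?thesis
        by (simp only: pattern_dist_eq_density_prior[OF \<gamma>])
    qed
    also have "density \<dots> (\<lambda>x. \<Prod>i\<in>I. ennreal (?f i (x i))) = density (prior M I s)
        (\<lambda>\<theta>. ennreal (real ?c * indicator ?E \<theta>) * (\<Prod>i\<in>I. ennreal (?f i (\<theta> i))))"
    proof (rule density_density_eq)
      show "(\<lambda>\<theta>. ennreal (real ?c * indicator ?E \<theta>)) \<in> borel_measurable (prior M I s)"
        by (intro measurable_compose[OF _ measurable_ennreal] borel_measurable_times borel_measurable_const)
          (simp only: measurable_cong_sets[OF sets_prior refl] E_meas)
      have "(\<lambda>x. ennreal (\<Prod>i\<in>I. ?f i (x i))) \<in> borel_measurable (prior M I s)"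
        by (intro measurable_compose[OF _ measurable_ennreal])
          (simp only: measurable_cong_sets[OF sets_prior refl] prod_meas)
      then show "(\<lambda>x. \<Prod>i\<in>I. ennreal (?f i (x i))) \<in> borel_measurable (prior M I s)"
        by (simp only: prod_ennreal f_nn)
    qed
    also have "\<dots> = density (prior M I s) (\<lambda>x. ennreal (\<rho> x))"
      by (intro arg_cong2[where f = density] ext refl)
        (simp add: \<rho>_def prod_ennreal[OF f_nn] ennreal_mult' prod_nonneg f_nn del: of_nat_mult)
    finally have q_\<rho>: "q = density (prior M I s) (\<lambda>x. ennreal (\<rho> x))" .
    have mom_q: "(\<integral>\<^sup>+\<eta>. ennreal ((\<eta> k - \<theta> k) ^ (2 * j)) \<partial>q) \<le> ennreal (C j * \<tau> ^ (2 * j))"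
      if k: "k \<in> I" and j: "1 \<le> j" for k j
    proof -
      have sets_D: "sets (?D k) = sets borel" using k sets_variational_slab[OF S] by auto
      have "(\<integral>\<^sup>+\<eta>. ennreal ((\<eta> k - \<theta> k) ^ (2 * j)) \<partial>q) = (\<integral>\<^sup>+x. ennreal ((x - \<theta> k) ^ (2 * j)) \<partial>?D k)"
        unfolding q_D by (rule nn_integral_PiM_component[OF prob_D k])
          (simp only: measurable_cong_sets[OF sets_D refl], measurable)
      also have "\<dots> \<le> ennreal (C j * \<tau> ^ (2 * j))"
      proof (cases "k \<in> A")
        case False
        then have "\<theta> k = 0" using A(1) k by blast
        then show ?thesis using False j by (simp add: nn_integral_return power_0_left)
      qed (use mom k in simp)
      finally show ?thesis .
    qed
    show "has_sparse_competitor M I s \<theta> K C \<tau>"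
      unfolding has_sparse_competitor_def
      by (intro exI[of _ q] exI[of _ \<rho>] conjI allI ballI impI q q_\<rho> \<rho>_meas \<rho>_nn \<rho>_le mom_q)
  qed
qed

section \<open>A finite net of sparse parameter vectors\<close>

lemma truncation_toward_zero:
  fixes x d B :: real
  assumes d: "0 < d" and x: "\<bar>x\<bar> \<le> B"
  defines "z \<equiv> (if 0 \<le> x then \<lfloor>x / d\<rfloor> else - \<lfloor>- x / d\<rfloor>)"
  shows "\<bar>x - d * of_int z\<bar> \<le> d" "\<bar>d * of_int z\<bar> \<le> B" "z \<in> {- \<lfloor>B / d\<rfloor>..\<lfloor>B / d\<rfloor>}" "x = 0 \<Longrightarrow> z = 0"
proof -
  have *: "\<bar>y - d * of_int \<lfloor>y / d\<rfloor>\<bar> \<le> d \<and> \<bar>d * of_int \<lfloor>y / d\<rfloor>\<bar> \<le> y \<and> 0 \<le> \<lfloor>y / d\<rfloor> \<and> \<lfloor>y / d\<rfloor> \<le> \<lfloor>B / d\<rfloor>"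
    if y: "0 \<le> y" "y \<le> B" for y
  proof -
    have "of_int \<lfloor>y / d\<rfloor> \<le> y / d" "y / d < of_int \<lfloor>y / d\<rfloor> + 1" by linarith+
    then have "d * of_int \<lfloor>y / d\<rfloor> \<le> y" "y < d * of_int \<lfloor>y / d\<rfloor> + d"
      using d by (simp_all only: pos_le_divide_eq pos_divide_less_eq mult.commute distrib_left mult_1_right)
    moreover have "0 \<le> \<lfloor>y / d\<rfloor>" using y d by simp
    moreover have "\<lfloor>y / d\<rfloor> \<le> \<lfloor>B / d\<rfloor>" using y d by (intro floor_mono divide_right_mono) auto
    moreover have "0 \<le> d * of_int \<lfloor>y / d\<rfloor>" using calculation(3) d by simp
    ultimately show ?thesis by linarith
  qed
  have "\<bar>x - d * of_int z\<bar> \<le> d \<and> \<bar>d * of_int z\<bar> \<le> B \<and> z \<in> {- \<lfloor>B / d\<rfloor>..\<lfloor>B / d\<rfloor>}"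
  proof (cases "0 \<le> x")
    case True
    then have "z = \<lfloor>x / d\<rfloor>" by (simp add: z_def)
    moreover from this have "d * of_int z = d * of_int \<lfloor>x / d\<rfloor>" by simp
    moreover have "\<bar>x - d * of_int \<lfloor>x / d\<rfloor>\<bar> \<le> d \<and> \<bar>d * of_int \<lfloor>x / d\<rfloor>\<bar> \<le> x \<and> 0 \<le> \<lfloor>x / d\<rfloor> \<and> \<lfloor>x / d\<rfloor> \<le> \<lfloor>B / d\<rfloor>"
      using *[of x] True x by simp
    ultimately show ?thesis using x unfolding atLeastAtMost_iff
      by (elim conjE, intro conjI) linarith+
  next
    case False
    then have "\<bar>- x - d * of_int \<lfloor>- x / d\<rfloor>\<bar> \<le> d \<and> \<bar>d * of_int \<lfloor>- x / d\<rfloor>\<bar> \<le> - x \<and> 0 \<le> \<lfloor>- x / d\<rfloor> \<and> \<lfloor>- x / d\<rfloor> \<le> \<lfloor>B / d\<rfloor>"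
      using *[of "- x"] x by simp
    moreover have "z = - \<lfloor>- x / d\<rfloor>" using False by (simp add: z_def)
    moreover from this have "d * of_int z = - (d * of_int \<lfloor>- x / d\<rfloor>)" by simp
    ultimately show ?thesis using False x unfolding atLeastAtMost_iff
      by (elim conjE, intro conjI) linarith+
  qed
  then show "\<bar>x - d * of_int z\<bar> \<le> d" "\<bar>d * of_int z\<bar> \<le> B" "z \<in> {- \<lfloor>B / d\<rfloor>..\<lfloor>B / d\<rfloor>}" by auto
  show "x = 0 \<Longrightarrow> z = 0" by (simp add: z_def)
qed

text \<open>
  Rounding toward zero keeps zeros, so a sparse vector is approximated by one that is described by
  \<open>s\<close> pairs of a position and a grid value.
\<close>

lemma sparse_net:
  fixes I :: "'i set" and B d :: real
  assumes I: "finite I" and s: "s \<le> card I" and d: "0 < d" and B: "0 \<le> B"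
  obtains G :: "('i \<Rightarrow> real) set" where "finite G" "real (card G) \<le> (card I * (2 * B / d + 1)) ^ s"
    and "\<And>\<theta>. (\<And>k. k \<in> I \<Longrightarrow> \<bar>\<theta> k\<bar> \<le> B) \<Longrightarrow> card {k \<in> I. \<theta> k \<noteq> 0} \<le> s \<Longrightarrow>
      \<exists>\<theta>'\<in>G. \<forall>k\<in>I. \<bar>\<theta>' k\<bar> \<le> B \<and> \<bar>\<theta> k - \<theta>' k\<bar> \<le> d"
proof -
  define Z where "Z = {- \<lfloor>B / d\<rfloor>..\<lfloor>B / d\<rfloor>}"
  define decode where "decode xs k = d * of_int (case map_of xs k of None \<Rightarrow> 0 | Some z \<Rightarrow> z)"
    for xs :: "('i \<times> int) list" and k
  let ?X = "{xs. set xs \<subseteq> I \<times> Z \<and> length xs = s}"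
  have fin: "finite (I \<times> Z)" using I by (simp add: Z_def)
  then have finX: "finite ?X" by (rule finite_lists_length_eq)
  have "0 \<le> \<lfloor>B / d\<rfloor>" using B d by simp
  then have "real (card Z) = 2 * of_int \<lfloor>B / d\<rfloor> + 1" by (simp add: Z_def)
  also have "\<dots> \<le> 2 * (B / d) + 1" by (intro add_right_mono mult_left_mono) auto
  finally have Z: "real (card Z) \<le> 2 * B / d + 1" by simp
  have "card (decode ` ?X) \<le> card ?X" by (rule card_image_le[OF finX])
  also have "\<dots> = (card I * card Z) ^ s"
    using card_lists_length_eq[OF fin] by (simp add: card_cartesian_product)
  finally have "real (card (decode ` ?X)) \<le> real ((card I * card Z) ^ s)" by (rule of_nat_mono)
  also have "\<dots> \<le> (card I * (2 * B / d + 1)) ^ s"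
    using Z by (auto intro!: power_mono mult_left_mono)
  finally have card: "real (card (decode ` ?X)) \<le> (card I * (2 * B / d + 1)) ^ s" .
  show thesis
  proof (rule that[OF finite_imageI[OF finX] card])
    fix \<theta> :: "'i \<Rightarrow> real"
    assume \<theta>: "\<And>k. k \<in> I \<Longrightarrow> \<bar>\<theta> k\<bar> \<le> B" and supp: "card {k \<in> I. \<theta> k \<noteq> 0} \<le> s"
    obtain A where A: "{k \<in> I. \<theta> k \<noteq> 0} \<subseteq> A" "A \<subseteq> I" "card A = s"
      using exists_subset_between[OF supp s _ I] by auto
    then have "finite A" using I finite_subset by blast
    then obtain ks where ks: "set ks = A" "distinct ks" using finite_distinct_list by blast
    define z where "z k = (if 0 \<le> \<theta> k then \<lfloor>\<theta> k / d\<rfloor> else - \<lfloor>- \<theta> k / d\<rfloor>)" for k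
    note z = truncation_toward_zero[OF d \<theta>, folded z_def]
    define xs where "xs = map (\<lambda>k. (k, z k)) ks"
    have "xs \<in> ?X"
      using ks A z(3) distinct_card[of ks] by (auto simp: xs_def Z_def)
    moreover have "\<bar>decode xs k\<bar> \<le> B \<and> \<bar>\<theta> k - decode xs k\<bar> \<le> d" if k: "k \<in> I" for k
    proof (cases "k \<in> A")
      case True
      then have "map_of xs k = Some (z k)"
        unfolding xs_def using ks by (simp add: map_of_map_restrict)
      then show ?thesis using z(1,2)[OF k] by (simp add: decode_def)
    next
      case False
      then have "map_of xs k = None" using ks by (auto simp: xs_def map_of_eq_None_iff)
      moreover have "\<theta> k = 0" using False A k by blast
      ultimately show ?thesis using B d by (simp add: decode_def)
    qed
    ultimately show "\<exists>\<theta>'\<in>decode ` ?X. \<forall>k\<in>I. \<bar>\<theta>' k\<bar> \<le> B \<and> \<bar>\<theta> k - \<theta>' k\<bar> \<le> d"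
      by blast
  qed
qed

section \<open>Perturbation of the likelihood and of the Hellinger distance\<close>

lemma log_lik_ratio_diff_le:
  assumes \<eta>: "0 \<le> \<eta>"
    and ff': "\<And>i. i < n \<Longrightarrow> \<bar>f (fst (D i)) - f' (fst (D i))\<bar> \<le> \<eta>"
    and F: "\<And>i. i < n \<Longrightarrow> \<bar>f (fst (D i))\<bar> \<le> F" "\<And>i. i < n \<Longrightarrow> \<bar>f' (fst (D i))\<bar> \<le> F"
      "\<And>i. i < n \<Longrightarrow> \<bar>g (fst (D i))\<bar> \<le> F"
  shows "log_lik_ratio \<sigma> f g n D - log_lik_ratio \<sigma> f' g n D
    \<le> \<eta> * (2 * (\<Sum>i<n. \<bar>snd (D i) - g (fst (D i))\<bar>) + 4 * real n * F) / (2 * \<sigma>\<^sup>2)"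
proof -
  have "log_lik_ratio \<sigma> f g n D - log_lik_ratio \<sigma> f' g n D
      = (\<Sum>i<n. (snd (D i) - f' (fst (D i)))\<^sup>2 - (snd (D i) - f (fst (D i)))\<^sup>2) / (2 * \<sigma>\<^sup>2)"
    by (simp add: log_lik_ratio_def sq_loss_def sum_subtractf diff_divide_distrib)
  also have "\<dots> \<le> (\<Sum>i<n. \<eta> * (2 * \<bar>snd (D i) - g (fst (D i))\<bar> + 4 * F)) / (2 * \<sigma>\<^sup>2)"
  proof (intro divide_right_mono sum_mono)
    fix i assume "i \<in> {..<n}"
    then have i: "i < n" by simp
    let ?y = "snd (D i)" and ?x = "fst (D i)"
    have "(?y - f' ?x)\<^sup>2 - (?y - f ?x)\<^sup>2 = (f ?x - f' ?x) * (2 * (?y - g ?x) + 2 * g ?x - f ?x - f' ?x)"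
      by (simp add: power2_eq_square algebra_simps)
    also have "\<dots> \<le> \<bar>f ?x - f' ?x\<bar> * \<bar>2 * (?y - g ?x) + 2 * g ?x - f ?x - f' ?x\<bar>"
      by (metis abs_ge_self abs_mult)
    also have "\<dots> \<le> \<eta> * (2 * \<bar>?y - g ?x\<bar> + 4 * F)"
    proof (intro mult_mono ff' i \<eta>)
      show "\<bar>2 * (?y - g ?x) + 2 * g ?x - f ?x - f' ?x\<bar> \<le> 2 * \<bar>?y - g ?x\<bar> + 4 * F"
        using F[OF i] by (smt (verit))
    qed simp
    finally show "(?y - f' ?x)\<^sup>2 - (?y - f ?x)\<^sup>2 \<le> \<eta> * (2 * \<bar>?y - g ?x\<bar> + 4 * F)" .
  qed simp
  also have "(\<Sum>i<n. \<eta> * (2 * \<bar>snd (D i) - g (fst (D i))\<bar> + 4 * F))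
      = \<eta> * (2 * (\<Sum>i<n. \<bar>snd (D i) - g (fst (D i))\<bar>) + 4 * real n * F)"
    by (simp add: sum.distrib sum_distrib_left algebra_simps)
  finally show ?thesis .
qed

lemma abs_le_inverse_plus_mult_square:
  fixes g m :: real
  assumes "0 < m"
  shows "\<bar>g\<bar> \<le> 1 / m + m * g\<^sup>2"
proof (cases "\<bar>g\<bar> \<le> 1 / m")
  case True
  then show ?thesis using assms by (simp add: add_increasing2)
next
  case False
  then have "1 * \<bar>g\<bar> \<le> (m * \<bar>g\<bar>) * \<bar>g\<bar>"
    using assms by (intro mult_right_mono) (auto simp: field_simps)
  also have "\<dots> = m * g\<^sup>2" by (simp add: power2_eq_square)
  finally show ?thesis using assms by (simp add: add_increasing)
qed

text \<open>
  The factor \<open>m\<close> trades the linear term in \<open>f - g\<close> for a quadratic one, so that second moments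
  of \<open>f - g\<close> suffice.
\<close>

lemma abs_log_lik_ratio_le:
  assumes m: "0 < m" and \<Psi>: "\<And>i. i < n \<Longrightarrow> (f (fst (D i)) - g (fst (D i)))\<^sup>2 \<le> \<Psi>"
  shows "\<bar>log_lik_ratio \<sigma> f g n D\<bar>
    \<le> (n * \<Psi> + 2 * (1 / m + m * \<Psi>) * (\<Sum>i<n. \<bar>snd (D i) - g (fst (D i))\<bar>)) / (2 * \<sigma>\<^sup>2)"
proof -
  have "\<bar>log_lik_ratio \<sigma> f g n D\<bar>
      = \<bar>\<Sum>i<n. (snd (D i) - g (fst (D i)))\<^sup>2 - (snd (D i) - f (fst (D i)))\<^sup>2\<bar> / (2 * \<sigma>\<^sup>2)"
    by (simp add: log_lik_ratio_def sq_loss_def sum_subtractf abs_divide flip: diff_divide_distrib)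
  also have "\<dots> \<le> (\<Sum>i<n. \<bar>(snd (D i) - g (fst (D i)))\<^sup>2 - (snd (D i) - f (fst (D i)))\<^sup>2\<bar>) / (2 * \<sigma>\<^sup>2)"
    by (intro divide_right_mono sum_abs) simp
  also have "\<dots> \<le> (\<Sum>i<n. \<Psi> + 2 * (1 / m + m * \<Psi>) * \<bar>snd (D i) - g (fst (D i))\<bar>) / (2 * \<sigma>\<^sup>2)"
  proof (intro divide_right_mono sum_mono)
    fix i assume "i \<in> {..<n}"
    then have i: "i < n" by simp
    define e u where "e = snd (D i) - g (fst (D i))" and "u = f (fst (D i)) - g (fst (D i))"
    have "\<bar>u\<bar> \<le> 1 / m + m * u\<^sup>2" by (rule abs_le_inverse_plus_mult_square[OF m])
    also have "\<dots> \<le> 1 / m + m * \<Psi>" using \<Psi>[OF i] m by (simp add: u_def)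
    finally have u: "\<bar>u\<bar> \<le> 1 / m + m * \<Psi>" .
    have "\<bar>e\<^sup>2 - (e - u)\<^sup>2\<bar> = \<bar>2 * u * e - u\<^sup>2\<bar>" by (simp add: power2_eq_square algebra_simps)
    also have "\<dots> \<le> 2 * \<bar>u\<bar> * \<bar>e\<bar> + u\<^sup>2"
      using abs_triangle_ineq4[of "2 * u * e" "u\<^sup>2"] by (simp add: abs_mult)
    also have "\<dots> \<le> 2 * (1 / m + m * \<Psi>) * \<bar>e\<bar> + \<Psi>"
      using u \<Psi>[OF i] by (intro add_mono mult_right_mono) (auto simp: u_def)
    finally show "\<bar>(snd (D i) - g (fst (D i)))\<^sup>2 - (snd (D i) - f (fst (D i)))\<^sup>2\<bar>
        \<le> \<Psi> + 2 * (1 / m + m * \<Psi>) * \<bar>snd (D i) - g (fst (D i))\<bar>"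
      by (simp add: e_def u_def)
  qed simp
  also have "(\<Sum>i<n. \<Psi> + 2 * (1 / m + m * \<Psi>) * \<bar>snd (D i) - g (fst (D i))\<bar>)
      = n * \<Psi> + 2 * (1 / m + m * \<Psi>) * (\<Sum>i<n. \<bar>snd (D i) - g (fst (D i))\<bar>)"
    by (simp add: sum.distrib sum_distrib_left)
  finally show ?thesis .
qed

lemma abs_exp_minus_diff_le:
  fixes u v :: real
  assumes "0 \<le> u" "0 \<le> v"
  shows "\<bar>exp (- u) - exp (- v)\<bar> \<le> \<bar>u - v\<bar>"
proof -
  have *: "\<bar>exp (- u) - exp (- v)\<bar> \<le> \<bar>u - v\<bar>" if "0 \<le> u" "u \<le> v" for u v :: real
  proof -
    have "exp (- u) - exp (- v) = exp (- u) * (1 - exp (- (v - u)))" by (simp add: algebra_simps flip: exp_add)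
    also have "\<dots> \<le> 1 * (v - u)"
    proof (intro mult_mono)
      show "1 - exp (- (v - u)) \<le> v - u" using exp_ge_add_one_self[of "- (v - u)"] by linarith
    qed (use that in auto)
    finally show ?thesis using that by auto
  qed
  show ?thesis using *[of u v] *[of v u] assms by (cases "u \<le> v") (auto simp: abs_minus_commute)
qed

context regression
begin

lemma hellinger_sq_diff_le:
  assumes f: "f \<in> borel_measurable (input_space p)" and f': "f' \<in> borel_measurable (input_space p)"
    and \<eta>: "\<And>x. \<forall>j\<in>{..<p}. \<bar>x j\<bar> \<le> 1 \<Longrightarrow> \<bar>f x - f' x\<bar> \<le> \<eta>" "0 \<le> \<eta>"
    and F: "\<And>x. \<forall>j\<in>{..<p}. \<bar>x j\<bar> \<le> 1 \<Longrightarrow> \<bar>f x\<bar> \<le> F" "\<And>x. \<forall>j\<in>{..<p}. \<bar>x j\<bar> \<le> 1 \<Longrightarrow> \<bar>f' x\<bar> \<le> F"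
      "\<And>x. \<forall>j\<in>{..<p}. \<bar>x j\<bar> \<le> 1 \<Longrightarrow> \<bar>f\<^sub>0 x\<bar> \<le> F"
  shows "hellinger_sq p \<sigma> f f\<^sub>0 - hellinger_sq p \<sigma> f' f\<^sub>0 \<le> \<eta> * (4 * F) / (8 * \<sigma>\<^sup>2)"
proof -
  interpret cube: prob_space "cube_dist p" by (rule prob_space_cube_dist)
  note int = integrable_hellinger[OF f] integrable_hellinger[OF f']
  let ?h = "\<lambda>f x. 1 - exp (- ((f x - f\<^sub>0 x)\<^sup>2 / (8 * \<sigma>\<^sup>2)))"
  have "hellinger_sq p \<sigma> f f\<^sub>0 - hellinger_sq p \<sigma> f' f\<^sub>0 = (\<integral>x. ?h f x - ?h f' x \<partial>cube_dist p)"
    unfolding hellinger_sq_def by (rule Bochner_Integration.integral_diff[symmetric, OF int])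
  also have "\<dots> \<le> (\<integral>x. \<eta> * (4 * F) / (8 * \<sigma>\<^sup>2) \<partial>cube_dist p)"
  proof (rule integral_mono_AE)
    show "integrable (cube_dist p) (\<lambda>x. ?h f x - ?h f' x)"
      by (rule Bochner_Integration.integrable_diff[OF int])
    show "AE x in cube_dist p. ?h f x - ?h f' x \<le> \<eta> * (4 * F) / (8 * \<sigma>\<^sup>2)"
      using AE_cube_dist
    proof eventually_elim
      fix x :: "nat \<Rightarrow> real" assume x: "\<forall>j\<in>{..<p}. \<bar>x j\<bar> \<le> 1"
      have "?h f x - ?h f' x \<le> \<bar>exp (- ((f' x - f\<^sub>0 x)\<^sup>2 / (8 * \<sigma>\<^sup>2))) - exp (- ((f x - f\<^sub>0 x)\<^sup>2 / (8 * \<sigma>\<^sup>2)))\<bar>"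
        by simp
      also have "\<dots> \<le> \<bar>(f' x - f\<^sub>0 x)\<^sup>2 / (8 * \<sigma>\<^sup>2) - (f x - f\<^sub>0 x)\<^sup>2 / (8 * \<sigma>\<^sup>2)\<bar>"
        by (rule abs_exp_minus_diff_le) auto
      also have "(f' x - f\<^sub>0 x)\<^sup>2 / (8 * \<sigma>\<^sup>2) - (f x - f\<^sub>0 x)\<^sup>2 / (8 * \<sigma>\<^sup>2)
          = (f' x - f x) * (f' x + f x - 2 * f\<^sub>0 x) / (8 * \<sigma>\<^sup>2)"
        by (simp add: power2_eq_square algebra_simps flip: diff_divide_distrib)
      also have "\<bar>\<dots>\<bar> = \<bar>f x - f' x\<bar> * \<bar>f' x + f x - 2 * f\<^sub>0 x\<bar> / (8 * \<sigma>\<^sup>2)"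
        by (simp add: abs_mult abs_minus_commute)
      also have "\<dots> \<le> \<eta> * (4 * F) / (8 * \<sigma>\<^sup>2)"
        using \<eta>(1)[OF x] \<eta>(2) F[OF x] by (intro divide_right_mono mult_mono) auto
      finally show "?h f x - ?h f' x \<le> \<eta> * (4 * F) / (8 * \<sigma>\<^sup>2)" .
    qed
  qed simp
  also have "\<dots> = \<eta> * (4 * F) / (8 * \<sigma>\<^sup>2)" by (simp add: cube.prob_space)
  finally show ?thesis .
qed

end

lemma nn_integral_Markov_bound:
  assumes u: "u \<in> borel_measurable M" and a: "(\<integral>\<^sup>+x. u x \<partial>M) \<le> ennreal a" and c: "0 < c"
  shows "emeasure M {x \<in> space M. ennreal c \<le> u x} \<le> ennreal (a / c)"
proof -
  have "ennreal c \<le> u x \<longleftrightarrow> 1 \<le> ennreal (1 / c) * u x" for x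
  proof
    assume "ennreal c \<le> u x"
    then have "ennreal (1 / c) * ennreal c \<le> ennreal (1 / c) * u x" by (intro mult_left_mono) auto
    then show "1 \<le> ennreal (1 / c) * u x" using c by (simp flip: ennreal_mult')
  next
    assume "1 \<le> ennreal (1 / c) * u x"
    then have "ennreal c * 1 \<le> ennreal c * (ennreal (1 / c) * u x)" by (intro mult_left_mono) auto
    then show "ennreal c \<le> u x" using c by (simp flip: mult.assoc ennreal_mult')
  qed
  then have "emeasure M {x \<in> space M. ennreal c \<le> u x} = emeasure M {x \<in> space M. 1 \<le> ennreal (1 / c) * u x}"
    by simp
  also have "\<dots> \<le> ennreal (1 / c) * (\<integral>\<^sup>+x. u x * indicator (space M) x \<partial>M)"
    using u by (intro nn_integral_Markov_inequality) auto
  also have "(\<integral>\<^sup>+x. u x * indicator (space M) x \<partial>M) = (\<integral>\<^sup>+x. u x \<partial>M)"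
    by (intro nn_integral_cong) simp
  also have "ennreal (1 / c) * \<dots> \<le> ennreal (1 / c) * ennreal a" by (intro mult_left_mono a) simp
  also have "\<dots> = ennreal (a / c)" using c by (simp flip: ennreal_mult')
  finally show ?thesis .
qed

section \<open>The bound at a fixed sample size\<close>

text \<open>
  The data are generated by the network with parameters \<open>\<theta>\<^sub>0\<close>, which already has the architecture
  of the student; \<open>W\<close> bounds the layer widths and \<open>T\<close> the entries of \<open>\<theta>\<^sub>0\<close>.
\<close>

locale sparse_student =
  fixes p L n W s :: nat and h :: "nat \<Rightarrow> nat" and \<sigma> :: real and M :: slab
    and \<theta>\<^sub>0 :: "param \<Rightarrow> real" and T :: real
  assumes L: "1 \<le> L" and n: "1 \<le> n" and W: "1 \<le> W"
    and width: "\<And>l. l \<le> L \<Longrightarrow> layer_width p L h l \<le> W"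
    and \<sigma>_pos: "0 < \<sigma>" and valid: "valid_slab M"
    and s_le: "s \<le> card (param_index p L h)"
    and T: "1 \<le> T" and \<theta>\<^sub>0_le: "\<And>k. k \<in> param_index p L h \<Longrightarrow> \<bar>\<theta>\<^sub>0 k\<bar> \<le> T"
    and \<theta>\<^sub>0_sparse: "card {k \<in> param_index p L h. \<theta>\<^sub>0 k \<noteq> 0} \<le> s"
    and \<theta>\<^sub>0_uniform: "\<And>B k. M = Uniform B \<Longrightarrow> k \<in> param_index p L h \<Longrightarrow> \<bar>\<theta>\<^sub>0 k\<bar> \<le> B"
begin

abbreviation I :: "param set" where "I \<equiv> param_index p L h"
abbreviation net :: "(param \<Rightarrow> real) \<Rightarrow> (nat \<Rightarrow> real) \<Rightarrow> real" where "net \<equiv> network p L h"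
abbreviation d2 :: "(param \<Rightarrow> real) \<Rightarrow> real" where "d2 \<theta> \<equiv> hellinger_sq p \<sigma> (net \<theta>) (net \<theta>\<^sub>0)"
abbreviation llr :: "(param \<Rightarrow> real) \<Rightarrow> (nat \<Rightarrow> (nat \<Rightarrow> real) \<times> real) \<Rightarrow> real" where
  "llr \<theta> D \<equiv> log_lik_ratio \<sigma> (net \<theta>) (net \<theta>\<^sub>0) n D"
abbreviation data :: "(nat \<Rightarrow> (nat \<Rightarrow> real) \<times> real) measure" where
  "data \<equiv> data_dist p \<sigma> (net \<theta>\<^sub>0) n"
abbreviation in_cube :: "(nat \<Rightarrow> (nat \<Rightarrow> real) \<times> real) \<Rightarrow> bool" where
  "in_cube D \<equiv> \<forall>i\<in>{..<n}. \<forall>j\<in>{..<p}. \<bar>fst (D i) j\<bar> \<le> 1"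
abbreviation noise :: "(nat \<Rightarrow> (nat \<Rightarrow> real) \<times> real) \<Rightarrow> real" where
  "noise D \<equiv> (\<Sum>i<n. \<bar>snd (D i) - net \<theta>\<^sub>0 (fst (D i))\<bar>)"

abbreviation variational_posterior :: "(nat \<Rightarrow> (nat \<Rightarrow> real) \<times> real) \<Rightarrow> (param \<Rightarrow> real) measure \<Rightarrow> bool" where
  "variational_posterior D \<equiv> is_arg_min (\<lambda>q'. KL q' (posterior (prior M I s) (\<lambda>\<theta>. likelihood \<sigma> (net \<theta>) n D)))
     (\<lambda>q'. q' \<in> variational_family M I)"
abbreviation failure_prob :: "real \<Rightarrow> real" where
  "failure_prob C \<equiv> 2 * exp (\<sigma>\<^sup>2 / 2) / n + 1 / n + C * exp (- real n)"

lemma finite_I: "finite I"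
  by (rule finite_param_index[OF width])

lemma card_I_pos: "1 \<le> card I"
  using output_params_in_param_index(2)[OF L, of p h] finite_I
  by (metis One_nat_def Suc_leI card_gt_0_iff empty_iff)

lemma net_measurable [measurable]: "net \<theta> \<in> borel_measurable (input_space p)"
  by (rule borel_measurable_network[OF L, where \<Theta> = "\<lambda>_. \<theta>" and X = "\<lambda>x. x"]) auto

sublocale reg: regression p \<sigma> "net \<theta>\<^sub>0"
  by unfold_locales (rule \<sigma>_pos, rule net_measurable)

sublocale sp: spike_slab M I s
  by unfold_locales (rule valid, rule finite_I, rule s_le)

lemma llr_measurable_pair:
  "(\<lambda>\<omega>. llr (fst \<omega>) (snd \<omega>)) \<in> borel_measurable ((param_space I) \<Otimes>\<^sub>M data)"
proof -
  have 1: "(\<lambda>\<omega>. net (fst \<omega>) (fst (snd \<omega> i))) \<in> borel_measurable ((param_space I) \<Otimes>\<^sub>M data)" if "i < n" for i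
    by (rule borel_measurable_network[OF L]; measurable; use that in simp)
  have 2: "(\<lambda>\<omega>. net \<theta>\<^sub>0 (fst (snd \<omega> i))) \<in> borel_measurable ((param_space I) \<Otimes>\<^sub>M data)" if "i < n" for i
    by (rule borel_measurable_network[OF L]; measurable; use that in simp)
  have 3: "(\<lambda>\<omega>. snd (snd \<omega> i)) \<in> borel_measurable ((param_space I) \<Otimes>\<^sub>M data)" if "i < n" for i
    by (measurable, use that in simp)
  show ?thesis
    unfolding log_lik_ratio_def sq_loss_def
    by (intro borel_measurable_diff borel_measurable_divide borel_measurable_const borel_measurable_sum
        borel_measurable_power 1 2 3) simp_all
qed

lemma
  assumes "i < n"
  shows net_obs_measurable: "(\<lambda>D. net \<theta> (fst (D i))) \<in> borel_measurable data"
    and obs_measurable: "(\<lambda>D. snd (D i)) \<in> borel_measurable data"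
proof -
  show "(\<lambda>D. net \<theta> (fst (D i))) \<in> borel_measurable data"
    by (rule borel_measurable_network[OF L]; measurable; use assms in simp)
  show "(\<lambda>D. snd (D i)) \<in> borel_measurable data"
    by (measurable, use assms in simp)
qed

lemma llr_measurable_data: "llr \<theta> \<in> borel_measurable data"
  unfolding log_lik_ratio_def sq_loss_def
  by (intro borel_measurable_diff borel_measurable_divide borel_measurable_const borel_measurable_sum
      borel_measurable_power net_obs_measurable obs_measurable) simp_all

lemma llr_measurable_params: "(\<lambda>\<theta>. llr \<theta> D) \<in> borel_measurable (param_space I)"
proof -
  have 1: "(\<lambda>\<theta>. net \<theta> x) \<in> borel_measurable (param_space I)" for x
    by (rule borel_measurable_network[OF L]) measurable
  show ?thesis
    unfolding log_lik_ratio_def sq_loss_def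
    by (intro borel_measurable_diff borel_measurable_divide borel_measurable_const borel_measurable_sum
        borel_measurable_power 1)
qed

lemma d2_measurable [measurable]: "d2 \<in> borel_measurable (param_space I)"
proof -
  interpret cube: prob_space "cube_dist p" by (rule prob_space_cube_dist)
  have 1 [measurable]: "(\<lambda>\<omega>. net (fst \<omega>) (snd \<omega>)) \<in> borel_measurable ((param_space I) \<Otimes>\<^sub>M cube_dist p)"
    by (rule borel_measurable_network[OF L]) measurable
  show ?thesis
    unfolding hellinger_sq_def by measurable
qed

text \<open>
  The box of half-width \<open>radius\<close> is so large that its complement has prior mass at most of order \<open>exp (- 3 * n)\<close>; this
  outweighs the factor \<open>exp (2 * real n)\<close> by which the Hellinger term can tilt the likelihood.  The mesh
  is fine enough for rounding to change the log-likelihood by a constant only.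
\<close>

definition radius :: real where "radius = 3 * real n + real (card I) + T"
definition net_bound :: real where "net_bound = (2 * real W * radius) ^ L"
definition mesh :: real where "mesh = 1 / (real n ^ 2 * real L * net_bound ^ 2)"

lemma radius_ge: "1 \<le> radius" "T \<le> radius" "3 * real n + card I \<le> radius"
  using T n by (auto simp: radius_def)

lemma net_bound_ge: "1 \<le> net_bound"
proof -
  have "1 * 1 \<le> 2 * real W * radius" using W radius_ge(1) by (intro mult_mono) auto
  then show ?thesis by (simp add: net_bound_def one_le_power)
qed

lemma mesh_pos: "0 < mesh"
  using n L net_bound_ge by (simp add: mesh_def)

lemma in_ball_bounds:
  assumes x: "\<forall>j\<in>{..<p}. \<bar>x j\<bar> \<le> 1"
    and \<theta>: "\<And>k. k \<in> I \<Longrightarrow> \<bar>\<theta> k\<bar> \<le> radius"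
  shows "\<bar>net \<theta> x\<bar> \<le> net_bound"
    and "(\<And>k. k \<in> I \<Longrightarrow> \<bar>\<theta>' k\<bar> \<le> radius) \<Longrightarrow> (\<And>k. k \<in> I \<Longrightarrow> \<bar>\<theta> k - \<theta>' k\<bar> \<le> mesh) \<Longrightarrow>
      \<bar>net \<theta> x - net \<theta>' x\<bar> \<le> mesh * real L * net_bound"
proof -
  have *: "\<And>l. l < L \<Longrightarrow> layer_width p L h l \<le> W" "\<And>j. j < p \<Longrightarrow> \<bar>x j\<bar> \<le> 1" using width x by auto
  show "\<bar>net \<theta> x\<bar> \<le> net_bound"
    unfolding net_bound_def by (rule abs_network_le[OF refl *(1) W radius_ge(1) *(2) \<theta> L])
  assume "\<And>k. k \<in> I \<Longrightarrow> \<bar>\<theta>' k\<bar> \<le> radius" "\<And>k. k \<in> I \<Longrightarrow> \<bar>\<theta> k - \<theta>' k\<bar> \<le> mesh"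
  then show "\<bar>net \<theta> x - net \<theta>' x\<bar> \<le> mesh * real L * net_bound"
    unfolding net_bound_def using mesh_pos
    by (intro abs_network_diff_le[OF refl *(1) W radius_ge(1) *(2) \<theta> _ _ _ L]) auto
qed

text \<open>
  With the mesh as above, rounding changes the network by at most \<open>1 / (n\<^sup>2 * net_bound)\<close> on the cube.
  Against noise of total size at most \<open>n\<^sup>2\<close> this is negligible.
\<close>

lemma tilted_log_lik_ratio_diff_le:
  assumes D: "in_cube D" "noise D \<le> real n ^ 2"
    and \<theta>: "\<And>k. k \<in> I \<Longrightarrow> \<bar>\<theta> k\<bar> \<le> radius" and \<theta>': "\<And>k. k \<in> I \<Longrightarrow> \<bar>\<theta>' k\<bar> \<le> radius"
    and d: "\<And>k. k \<in> I \<Longrightarrow> \<bar>\<theta> k - \<theta>' k\<bar> \<le> mesh"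
  shows "llr \<theta> D + 2 * real n * d2 \<theta> \<le> llr \<theta>' D + 2 * real n * d2 \<theta>' + 4 / \<sigma>\<^sup>2"
proof -
  define \<eta> where "\<eta> = mesh * real L * net_bound"
  have \<theta>\<^sub>0: "\<bar>\<theta>\<^sub>0 k\<bar> \<le> radius" if "k \<in> I" for k using \<theta>\<^sub>0_le[OF that] radius_ge(2) by linarith
  have \<eta>: "0 \<le> \<eta>" using mesh_pos net_bound_ge by (simp add: \<eta>_def)
  have \<eta>_eq: "\<eta> = 1 / (real n ^ 2 * net_bound)"
    using L net_bound_ge n by (simp add: \<eta>_def mesh_def power2_eq_square field_simps)
  have n_\<eta>: "\<eta> * (real n * net_bound) \<le> 1" "\<eta> * real n ^ 2 \<le> 1"
    using n net_bound_ge by (simp_all add: \<eta>_eq power2_eq_square field_simps)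
  note b = in_ball_bounds(1)
  have llr: "llr \<theta> D - llr \<theta>' D \<le> \<eta> * (2 * noise D + 4 * real n * net_bound) / (2 * \<sigma>\<^sup>2)"
    by (rule log_lik_ratio_diff_le)
      (use D(1) in \<open>auto intro!: \<eta> b \<theta> \<theta>' \<theta>\<^sub>0 in_ball_bounds(2)[OF _ \<theta> \<theta>' d, folded \<eta>_def]\<close>)
  have "\<eta> * (2 * noise D + 4 * real n * net_bound) \<le> \<eta> * (2 * real n ^ 2 + 4 * real n * net_bound)"
    using D(2) \<eta> by (intro mult_left_mono) auto
  also have "\<dots> = 2 * (\<eta> * real n ^ 2) + 4 * (\<eta> * (real n * net_bound))" by (simp add: algebra_simps)
  also have "\<dots> \<le> 6" using n_\<eta> by linarith
  finally have "\<eta> * (2 * noise D + 4 * real n * net_bound) / (2 * \<sigma>\<^sup>2) \<le> 6 / (2 * \<sigma>\<^sup>2)"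
    by (intro divide_right_mono) auto
  with llr have llr': "llr \<theta> D - llr \<theta>' D \<le> 3 / \<sigma>\<^sup>2" by simp
  have "d2 \<theta> - d2 \<theta>' \<le> \<eta> * (4 * net_bound) / (8 * \<sigma>\<^sup>2)"
    by (rule reg.hellinger_sq_diff_le[OF net_measurable net_measurable _ \<eta>])
      (auto intro!: b \<theta> \<theta>' \<theta>\<^sub>0 in_ball_bounds(2)[OF _ \<theta> \<theta>' d, folded \<eta>_def])
  then have "2 * real n * (d2 \<theta> - d2 \<theta>') \<le> 2 * real n * (\<eta> * (4 * net_bound) / (8 * \<sigma>\<^sup>2))"
    by (intro mult_left_mono) auto
  also have "\<dots> = (\<eta> * (real n * net_bound)) / \<sigma>\<^sup>2" by simp
  also have "\<dots> \<le> 1 / \<sigma>\<^sup>2" using n_\<eta>(1) by (intro divide_right_mono) auto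
  finally have "2 * real n * (d2 \<theta> - d2 \<theta>') \<le> 1 / \<sigma>\<^sup>2" .
  with llr' show ?thesis by (simp add: algebra_simps)
qed

text \<open>
  \<open>net_size\<close> bounds the number of choices for one nonzero coordinate, a position and a grid value;
  its \<open>s\<close>-th power bounds the size of the net.
\<close>

definition net_size :: real where "net_size = real (card I) * (2 * radius / mesh + 1)"
definition evidence_exponent :: real where
  "evidence_exponent = 2 * (real s * ln net_size + ln (real n)) + 4 / \<sigma>\<^sup>2"

lemma net_size_ge: "1 \<le> net_size"
proof -
  have "1 * 1 \<le> real (card I) * (2 * radius / mesh + 1)"
    using card_I_pos radius_ge(1) mesh_pos by (intro mult_mono) auto
  then show ?thesis by (simp add: net_size_def)
qed

text \<open>
  Since \<open>d\<^sup>2 \<le> 1\<close>, parameters outside the box are controlled by the prior tail alone: the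
  expected likelihood ratio is one for every \<open>\<theta>\<close>.
\<close>

lemma expected_tail_integral_le:
  assumes C: "0 \<le> C" "\<And>b. 0 \<le> b \<Longrightarrow> emeasure (slab_dist M) {x. b < \<bar>x\<bar>} \<le> ennreal (C * exp (- b))"
  defines "Out \<equiv> {\<theta> \<in> space (param_space I). \<exists>k\<in>I. radius < \<bar>\<theta> k\<bar>}"
  shows "(\<lambda>D. \<integral>\<^sup>+\<theta>. ennreal (exp (2 * real n + llr \<theta> D)) * indicator Out \<theta> \<partial>prior M I s) \<in> borel_measurable data"
    and "(\<integral>\<^sup>+D. (\<integral>\<^sup>+\<theta>. ennreal (exp (2 * real n + llr \<theta> D)) * indicator Out \<theta> \<partial>prior M I s) \<partial>data) \<le> ennreal (C * exp (- real n))"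
proof -
  interpret prior: prob_space "prior M I s" by (rule sp.prob_space_prior)
  interpret data: prob_space data by (rule reg.prob_space_data_dist)
  interpret pair_sigma_finite "prior M I s" data ..
  have Out [measurable]: "Out \<in> sets (param_space I)"
    unfolding Out_def using finite_I by measurable
  have llr [measurable]: "(\<lambda>\<omega>. llr (fst \<omega>) (snd \<omega>)) \<in> borel_measurable (prior M I s \<Otimes>\<^sub>M data)"
    using llr_measurable_pair by (simp cong: measurable_cong_sets sets_pair_measure_cong)
  have meas [measurable]: "(\<lambda>(\<theta>, D). ennreal (exp (2 * real n + llr \<theta> D)) * indicator Out \<theta>)
      \<in> borel_measurable (prior M I s \<Otimes>\<^sub>M data)"
    unfolding case_prod_beta by measurable
  show "(\<lambda>D. \<integral>\<^sup>+\<theta>. ennreal (exp (2 * real n + llr \<theta> D)) * indicator Out \<theta> \<partial>prior M I s) \<in> borel_measurable data"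
    by (rule prior.borel_measurable_nn_integral) (rule measurable_pair_swap[OF meas, unfolded case_prod_conv])
  have "(\<integral>\<^sup>+D. (\<integral>\<^sup>+\<theta>. ennreal (exp (2 * real n + llr \<theta> D)) * indicator Out \<theta> \<partial>prior M I s) \<partial>data)
      = (\<integral>\<^sup>+\<theta>. (\<integral>\<^sup>+D. ennreal (exp (2 * real n + llr \<theta> D)) * indicator Out \<theta> \<partial>data) \<partial>prior M I s)"
    using Fubini'[OF meas] by simp
  also have "\<dots> = (\<integral>\<^sup>+\<theta>. ennreal (exp (2 * real n)) * indicator Out \<theta> \<partial>prior M I s)"
  proof (rule nn_integral_cong)
    fix \<theta>
    have "(\<integral>\<^sup>+D. ennreal (exp (2 * real n + llr \<theta> D)) * indicator Out \<theta> \<partial>data)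
        = (\<integral>\<^sup>+D. (ennreal (exp (2 * real n)) * indicator Out \<theta>) * ennreal (exp (llr \<theta> D)) \<partial>data)"
      by (simp add: exp_add ennreal_mult' mult_ac)
    also have "\<dots> = (ennreal (exp (2 * real n)) * indicator Out \<theta>) * (\<integral>\<^sup>+D. ennreal (exp (llr \<theta> D)) \<partial>data)"
      using llr_measurable_data by (intro nn_integral_cmult) auto
    finally show "(\<integral>\<^sup>+D. ennreal (exp (2 * real n + llr \<theta> D)) * indicator Out \<theta> \<partial>data)
        = ennreal (exp (2 * real n)) * indicator Out \<theta>"
      by (simp add: reg.nn_integral_lik_ratio[OF net_measurable])
  qed
  also have "\<dots> = ennreal (exp (2 * real n)) * emeasure (prior M I s) Out"
    by (rule nn_integral_cmult_indicator) simp
  also have "\<dots> \<le> ennreal (exp (2 * real n)) * ennreal (card I * (C * exp (- radius)))"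
    unfolding Out_def using radius_ge(1) C(1)
    by (intro mult_left_mono sp.prior_tail_le[OF C(2)]) auto
  also have "\<dots> = ennreal (C * (card I * exp (2 * real n - radius)))"
    by (simp add: exp_diff exp_minus field_simps flip: ennreal_mult')
  also have "\<dots> \<le> ennreal (C * exp (- real n))"
  proof (intro ennreal_leI mult_left_mono C(1))
    have "card I * exp (2 * real n - radius) \<le> exp (card I) * exp (2 * real n - radius)"
      using exp_ge_add_one_self[of "card I"] by (intro mult_right_mono) (linarith, simp)
    also have "\<dots> \<le> exp (- real n)" using radius_ge(3) by (simp flip: exp_add)
    finally show "card I * exp (2 * real n - radius) \<le> exp (- real n)" .
  qed
  finally show "(\<integral>\<^sup>+D. (\<integral>\<^sup>+\<theta>. ennreal (exp (2 * real n + llr \<theta> D)) * indicator Out \<theta> \<partial>prior M I s) \<partial>data) \<le> ennreal (C * exp (- real n))" .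
qed

text \<open>
  The event excludes large noise, a large tilted likelihood ratio at some point of the net, and a
  large contribution of the parameters outside the box, each by Markov's inequality; observations
  outside the cube form a null set.
\<close>

lemma good_event:
  assumes C: "0 \<le> C" "\<And>b. 0 \<le> b \<Longrightarrow> emeasure (slab_dist M) {x. b < \<bar>x\<bar>} \<le> ennreal (C * exp (- b))"
  obtains A where "A \<in> sets data"
    and "1 - failure_prob C \<le> measure data A"
    and "\<And>D. D \<in> A \<Longrightarrow> in_cube D" "\<And>D. D \<in> A \<Longrightarrow> noise D \<le> real n ^ 2"
    and "\<And>D. D \<in> A \<Longrightarrow>
      (\<integral>\<^sup>+\<theta>. ennreal (exp (2 * real n * d2 \<theta> + llr \<theta> D)) \<partial>prior M I s) \<le> ennreal (exp evidence_exponent + 1)"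
proof -
  interpret data: prob_space data by (rule reg.prob_space_data_dist)
  interpret prior: prob_space "prior M I s" by (rule sp.prob_space_prior)
  define Out where "Out = {\<theta> \<in> space (param_space I). \<exists>k\<in>I. radius < \<bar>\<theta> k\<bar>}"
  note tail = expected_tail_integral_le[OF C, folded Out_def]
  let ?Tail = "\<lambda>D. \<integral>\<^sup>+\<theta>. ennreal (exp (2 * real n + llr \<theta> D)) * indicator Out \<theta> \<partial>prior M I s"
  have radius_nn: "0 \<le> radius" using radius_ge(1) by simp
  show thesis
  proof (rule sparse_net[OF finite_I s_le mesh_pos radius_nn, folded net_size_def])
    fix G :: "(param \<Rightarrow> real) set"
    assume G: "finite G" "real (card G) \<le> net_size ^ s"
      and net: "\<And>\<theta>. (\<And>k. k \<in> I \<Longrightarrow> \<bar>\<theta> k\<bar> \<le> radius) \<Longrightarrow> card {k \<in> I. \<theta> k \<noteq> 0} \<le> s \<Longrightarrow>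
        \<exists>\<theta>'\<in>G. \<forall>k\<in>I. \<bar>\<theta>' k\<bar> \<le> radius \<and> \<bar>\<theta> k - \<theta>' k\<bar> \<le> mesh"
    define Q where "Q = net_size ^ s * real n"
    have Q: "0 < Q" using net_size_ge n by (simp add: Q_def)
    have llr_m [measurable]: "llr \<theta> \<in> borel_measurable data" for \<theta> by (rule llr_measurable_data)
    have noise_m [measurable]: "noise \<in> borel_measurable data"
      by (intro borel_measurable_sum borel_measurable_abs borel_measurable_diff net_obs_measurable
          obs_measurable) simp_all
    define N0 where "N0 = {D \<in> space data. \<not> in_cube D}"
    define N1 where "N1 = {D \<in> space data. ennreal (real n ^ 2) \<le> ennreal (noise D)}"
    define N2 where "N2 \<theta> = {D \<in> space data. ennreal (Q * exp (- (real n * d2 \<theta>))) \<le> ennreal (exp (llr \<theta> D / 2))}" for \<theta>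
    define N3 where "N3 = {D \<in> space data. ennreal 1 \<le> ?Tail D}"
    have N0_m: "N0 \<in> sets data" unfolding N0_def by measurable
    have N1_m: "N1 \<in> sets data" unfolding N1_def by measurable
    have N2_m: "N2 \<theta> \<in> sets data" for \<theta> unfolding N2_def by measurable
    have N3_m: "N3 \<in> sets data" unfolding N3_def using tail(1) by measurable
    have N0: "emeasure data N0 = 0"
      using reg.AE_data_dist[of n] N0_m unfolding N0_def by (subst (asm) AE_iff_measurable[OF _ refl]) auto
    have N1: "emeasure data N1 \<le> ennreal (2 * exp (\<sigma>\<^sup>2 / 2) / n)"
    proof -
      have "emeasure data N1 \<le> ennreal (n * (2 * exp (\<sigma>\<^sup>2 / 2)) / real n ^ 2)"
        unfolding N1_def using reg.nn_integral_noise_le[of n] n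
        by (intro nn_integral_Markov_bound) auto
      also have "n * (2 * exp (\<sigma>\<^sup>2 / 2)) / real n ^ 2 = 2 * exp (\<sigma>\<^sup>2 / 2) / n"
        using n by (simp add: power2_eq_square)
      finally show ?thesis .
    qed
    have N2: "emeasure data (N2 \<theta>) \<le> ennreal (1 / Q)" for \<theta>
    proof -
      have "emeasure data (N2 \<theta>) \<le> ennreal (exp (- (real n * d2 \<theta>)) / (Q * exp (- (real n * d2 \<theta>))))"
        unfolding N2_def using reg.nn_integral_sqrt_lik_ratio_le[OF net_measurable, of n \<theta>] Q
        by (intro nn_integral_Markov_bound) auto
      then show ?thesis by simp
    qed
    have N3: "emeasure data N3 \<le> ennreal (C * exp (- real n))"
      unfolding N3_def using nn_integral_Markov_bound[OF tail(1,2), of 1] by simp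
    define N where "N = (N0 \<union> N1) \<union> ((\<Union>\<theta>\<in>G. N2 \<theta>) \<union> N3)"
    have U_m: "(\<Union>\<theta>\<in>G. N2 \<theta>) \<in> sets data" using G(1) N2_m by auto
    have N_m: "N \<in> sets data" unfolding N_def using N0_m N1_m N3_m U_m by auto
    have U: "emeasure data (\<Union>\<theta>\<in>G. N2 \<theta>) \<le> ennreal (1 / n)"
    proof -
      have "emeasure data (\<Union>\<theta>\<in>G. N2 \<theta>) \<le> (\<Sum>\<theta>\<in>G. emeasure data (N2 \<theta>))"
        using G(1) N2_m by (intro emeasure_subadditive_finite) auto
      also have "\<dots> \<le> (\<Sum>\<theta>\<in>G. ennreal (1 / Q))" by (intro sum_mono N2)
      also have "\<dots> = ennreal (card G * (1 / Q))"
        by (simp add: ennreal_of_nat_eq_real_of_nat flip: ennreal_mult')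
      also have "\<dots> \<le> ennreal (1 / n)"
        using G(2) Q n net_size_ge by (intro ennreal_leI) (simp add: Q_def field_simps)
      finally show ?thesis .
    qed
    have "emeasure data N \<le> (emeasure data N0 + emeasure data N1) + (emeasure data (\<Union>\<theta>\<in>G. N2 \<theta>) + emeasure data N3)"
      unfolding N_def using N0_m N1_m N3_m U_m
      by (intro order_trans[OF emeasure_subadditive] add_mono emeasure_subadditive) auto
    also have "\<dots> \<le> (0 + ennreal (2 * exp (\<sigma>\<^sup>2 / 2) / n)) + (ennreal (1 / n) + ennreal (C * exp (- real n)))"
      using N0 N1 U N3 by (intro add_mono) auto
    also have "\<dots> = ennreal (2 * exp (\<sigma>\<^sup>2 / 2) / n + 1 / n + C * exp (- real n))"
      using C(1) by (simp add: add.assoc flip: ennreal_plus)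
    finally have "measure data N \<le> 2 * exp (\<sigma>\<^sup>2 / 2) / n + 1 / n + C * exp (- real n)"
      using C(1) unfolding data.emeasure_eq_measure by (subst (asm) ennreal_le_iff) simp_all
    moreover have "measure data (space data - N) = 1 - measure data N"
      using N_m by (rule data.prob_compl)
    ultimately have prob: "1 - failure_prob C \<le> measure data (space data - N)"
      by linarith
    show thesis
    proof (rule that[OF _ prob])
      show "space data - N \<in> sets data" by (rule sets.compl_sets[OF N_m])
      fix D assume "D \<in> space data - N"
      then have D: "D \<in> space data" "D \<notin> N0" "D \<notin> N1" "\<And>\<theta>. \<theta> \<in> G \<Longrightarrow> D \<notin> N2 \<theta>" "D \<notin> N3"
        by (auto simp: N_def)
      show cube: "in_cube D" using D(1,2) by (simp add: N0_def)
      have "\<not> ennreal (real n ^ 2) \<le> ennreal (noise D)" using D(1,3) by (simp only: N1_def mem_Collect_eq simp_thms)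
      then show noise: "noise D \<le> real n ^ 2" by (meson ennreal_leI linear)
      have G_le: "llr \<theta> D + 2 * real n * d2 \<theta> \<le> 2 * ln Q" if "\<theta> \<in> G" for \<theta>
      proof -
        have "exp (llr \<theta> D / 2) < Q * exp (- (real n * d2 \<theta>))"
        proof (rule ccontr)
          assume "\<not> ?thesis"
          then have "D \<in> N2 \<theta>" using D(1) by (simp add: N2_def ennreal_leI)
          with D(4)[OF that] show False by contradiction
        qed
        also have "\<dots> = exp (ln Q - real n * d2 \<theta>)" using Q by (simp add: exp_diff exp_minus field_simps)
        finally show ?thesis by simp
      qed
      have "(\<integral>\<^sup>+\<theta>. ennreal (exp (2 * real n * d2 \<theta> + llr \<theta> D)) \<partial>prior M I s)
          \<le> (\<integral>\<^sup>+\<theta>. ennreal (exp evidence_exponent) + ennreal (exp (2 * real n + llr \<theta> D)) * indicator Out \<theta> \<partial>prior M I s)"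
      proof (rule nn_integral_mono_AE)
        show "AE \<theta> in prior M I s. ennreal (exp (2 * real n * d2 \<theta> + llr \<theta> D))
            \<le> ennreal (exp evidence_exponent) + ennreal (exp (2 * real n + llr \<theta> D)) * indicator Out \<theta>"
          using sp.AE_prior_sparse AE_space
        proof eventually_elim
          fix \<theta> :: "param \<Rightarrow> real"
          assume sparse: "card {k \<in> I. \<theta> k \<noteq> 0} \<le> s" and sp: "\<theta> \<in> space (prior M I s)"
          show "ennreal (exp (2 * real n * d2 \<theta> + llr \<theta> D))
            \<le> ennreal (exp evidence_exponent) + ennreal (exp (2 * real n + llr \<theta> D)) * indicator Out \<theta>"
          proof (cases "\<theta> \<in> Out")
            case True
            have "2 * real n * d2 \<theta> \<le> 2 * real n * 1"
              using reg.hellinger_sq_bounds(2) by (intro mult_left_mono) auto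
            then have "ennreal (exp (2 * real n * d2 \<theta> + llr \<theta> D)) \<le> ennreal (exp (2 * real n + llr \<theta> D))"
              by (intro ennreal_leI) simp
            then show ?thesis using True by (simp add: add_increasing)
          next
            case False
            then have in_box: "\<bar>\<theta> k\<bar> \<le> radius" if "k \<in> I" for k
              using sp that by (force simp: Out_def sets_eq_imp_space_eq[OF sp.sets_prior])
            obtain \<theta>' where \<theta>': "\<theta>' \<in> G" "\<And>k. k \<in> I \<Longrightarrow> \<bar>\<theta>' k\<bar> \<le> radius" "\<And>k. k \<in> I \<Longrightarrow> \<bar>\<theta> k - \<theta>' k\<bar> \<le> mesh"
              using net[OF in_box sparse] by metis
            have "llr \<theta> D + 2 * real n * d2 \<theta> \<le> llr \<theta>' D + 2 * real n * d2 \<theta>' + 4 / \<sigma>\<^sup>2"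
              by (rule tilted_log_lik_ratio_diff_le[OF cube noise in_box \<theta>'(2,3)])
            also have "\<dots> \<le> 2 * ln Q + 4 / \<sigma>\<^sup>2" using G_le[OF \<theta>'(1)] by simp
            also have "\<dots> = evidence_exponent"
              using net_size_ge n by (simp add: evidence_exponent_def Q_def ln_mult ln_realpow)
            finally have "ennreal (exp (2 * real n * d2 \<theta> + llr \<theta> D)) \<le> ennreal (exp evidence_exponent)"
              by (intro ennreal_leI) (simp add: add.commute)
            then show ?thesis by (simp add: add_increasing2)
          qed
        qed
      qed
      also have "\<dots> = (\<integral>\<^sup>+\<theta>. ennreal (exp evidence_exponent) \<partial>prior M I s) + ?Tail D"
      proof (rule nn_integral_add)
        have [measurable]: "Out \<in> sets (param_space I)" unfolding Out_def using finite_I by measurable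
        have [measurable]: "(\<lambda>\<theta>. llr \<theta> D) \<in> borel_measurable (param_space I)" by (rule llr_measurable_params)
        show "(\<lambda>\<theta>. ennreal (exp (2 * real n + llr \<theta> D)) * indicator Out \<theta>) \<in> borel_measurable (prior M I s)"
          by measurable
      qed simp
      also have "\<dots> \<le> ennreal (exp evidence_exponent) + 1"
        using D(1,5) by (intro add_mono) (auto simp: prior.emeasure_space_1 N3_def not_le)
      also have "\<dots> = ennreal (exp evidence_exponent + 1)" by (simp flip: ennreal_plus ennreal_1)
      finally show "(\<integral>\<^sup>+\<theta>. ennreal (exp (2 * real n * d2 \<theta> + llr \<theta> D)) \<partial>prior M I s) \<le> ennreal (exp evidence_exponent + 1)" .
    qed
  qed
qed


text \<open>
  A polynomial in the coordinatewise errors that dominates the squared error of the network on the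
  cube.  Even powers are used because their Gaussian moments are explicit.
\<close>

definition sq_err_bound :: "(param \<Rightarrow> real) \<Rightarrow> real" where
  "sq_err_bound \<theta> = (real L * (4 * real W) ^ L)\<^sup>2 *
     (\<Sum>k\<in>I. T ^ (2 * L) * (\<theta> k - \<theta>\<^sub>0 k) ^ (2 * 1) + (\<theta> k - \<theta>\<^sub>0 k) ^ (2 * (L + 1)))"

lemma sq_err_bound_nonneg: "0 \<le> sq_err_bound \<theta>"
  unfolding sq_err_bound_def using T
  by (intro mult_nonneg_nonneg sum_nonneg add_nonneg_nonneg zero_le_even_power) auto

lemma net_diff_sq_le:
  assumes x: "\<forall>j\<in>{..<p}. \<bar>x j\<bar> \<le> 1"
  shows "(net \<theta> x - net \<theta>\<^sub>0 x)\<^sup>2 \<le> sq_err_bound \<theta>"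
proof -
  define R where "R = Max ((\<lambda>k. \<bar>\<theta> k - \<theta>\<^sub>0 k\<bar>) ` I)"
  have ne: "I \<noteq> {}" using card_I_pos by auto
  have R_ge: "\<bar>\<theta> k - \<theta>\<^sub>0 k\<bar> \<le> R" if "k \<in> I" for k
    unfolding R_def using finite_I that by (intro Max_ge) auto
  have "R \<in> (\<lambda>k. \<bar>\<theta> k - \<theta>\<^sub>0 k\<bar>) ` I"
    unfolding R_def using finite_I ne by (intro Max_in) auto
  then obtain k where k: "k \<in> I" "R = \<bar>\<theta> k - \<theta>\<^sub>0 k\<bar>" by blast
  have R: "0 \<le> R" using k by simp
  have *: "\<And>l. l < L \<Longrightarrow> layer_width p L h l \<le> W" "\<And>j. j < p \<Longrightarrow> \<bar>x j\<bar> \<le> 1" "1 \<le> T + R"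
    using width x T R by auto
  have "\<bar>\<theta> k\<bar> \<le> T + R" "\<bar>\<theta>\<^sub>0 k\<bar> \<le> T + R" if "k \<in> I" for k
    using R_ge[OF that] \<theta>\<^sub>0_le[OF that] R by linarith+
  then have "\<bar>net \<theta> x - net \<theta>\<^sub>0 x\<bar> \<le> R * real L * (2 * real W * (T + R)) ^ L"
    using R_ge R by (intro abs_network_diff_le[OF refl *(1) W *(3) *(2) _ _ _ _ L]) auto
  also have "\<dots> = R * (real L * (2 * real W) ^ L) * (T + R) ^ L"
    by (simp add: power_mult_distrib)
  finally have "\<bar>net \<theta> x - net \<theta>\<^sub>0 x\<bar>\<^sup>2 \<le> (R * (real L * (2 * real W) ^ L) * (T + R) ^ L)\<^sup>2"
    by (intro power_mono) auto
  also have "\<dots> = (real L * (2 * real W) ^ L)\<^sup>2 * (R\<^sup>2 * (T + R) ^ (2 * L))"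
    by (simp add: power_mult_distrib mult_ac flip: power_mult)
  also have "\<dots> \<le> (real L * (2 * real W) ^ L)\<^sup>2 * (R\<^sup>2 * (2 ^ (2 * L) * (T ^ (2 * L) + R ^ (2 * L))))"
  proof (intro mult_left_mono)
    have "(T + R) ^ (2 * L) \<le> (2 * max T R) ^ (2 * L)" using T R by (intro power_mono) auto
    also have "\<dots> = 2 ^ (2 * L) * max T R ^ (2 * L)" by (simp add: power_mult_distrib)
    also have "\<dots> \<le> 2 ^ (2 * L) * (T ^ (2 * L) + R ^ (2 * L))"
      using T R by (intro mult_left_mono) (auto simp: max_def)
    finally show "(T + R) ^ (2 * L) \<le> 2 ^ (2 * L) * (T ^ (2 * L) + R ^ (2 * L))" .
  qed auto
  also have "\<dots> = (real L * (4 * real W) ^ L)\<^sup>2 * (T ^ (2 * L) * R ^ (2 * 1) + R ^ (2 * (L + 1)))"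
  proof -
    have "4 * real W = 2 * (2 * real W)" by simp
    then have "(4 * real W) ^ L = 2 ^ L * (2 * real W) ^ L" by (simp only: power_mult_distrib)
    then have "real L * (4 * real W) ^ L = (real L * (2 * real W) ^ L) * 2 ^ L" by simp
    then have "(real L * (4 * real W) ^ L)\<^sup>2 = (real L * (2 * real W) ^ L)\<^sup>2 * 2 ^ (2 * L)"
      by (simp only: power_mult_distrib[where n = 2] power_mult[symmetric] mult.commute[of L 2])
    moreover have "R ^ (2 * (L + 1)) = R\<^sup>2 * R ^ (2 * L)" by (simp add: power2_eq_square)
    moreover have "a * (u * (b * (t + r))) = (a * b) * (t * u + u * r)" for a b t r u :: real
      by (simp add: algebra_simps)
    ultimately show ?thesis by (simp only: mult_1_right)
  qed
  also have "T ^ (2 * L) * R ^ (2 * 1) + R ^ (2 * (L + 1))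
      = T ^ (2 * L) * (\<theta> k - \<theta>\<^sub>0 k) ^ (2 * 1) + (\<theta> k - \<theta>\<^sub>0 k) ^ (2 * (L + 1))"
    unfolding k(2) by (simp only: power_even_abs even_mult_iff even_numeral simp_thms)
  also have "\<dots> \<le> (\<Sum>k\<in>I. T ^ (2 * L) * (\<theta> k - \<theta>\<^sub>0 k) ^ (2 * 1) + (\<theta> k - \<theta>\<^sub>0 k) ^ (2 * (L + 1)))"
    using T by (intro member_le_sum k finite_I add_nonneg_nonneg mult_nonneg_nonneg zero_le_even_power) auto
  finally show ?thesis by (simp add: sq_err_bound_def mult_left_mono)
qed

lemma expected_sq_err_bound_le:
  assumes q: "sets q = sets (param_space I)"
    and C: "\<And>j. 0 \<le> C j" and \<tau>: "0 < \<tau>" "\<tau> \<le> 1"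
    and mom: "\<And>k j. k \<in> I \<Longrightarrow> 1 \<le> j \<Longrightarrow>
      (\<integral>\<^sup>+\<eta>. ennreal ((\<eta> k - \<theta>\<^sub>0 k) ^ (2 * j)) \<partial>q) \<le> ennreal (C j * \<tau> ^ (2 * j))"
  shows "(\<integral>\<^sup>+\<eta>. ennreal (sq_err_bound \<eta>) \<partial>q)
    \<le> ennreal ((real L * (4 * real W) ^ L)\<^sup>2 * (card I * ((T ^ (2 * L) * C 1 + C (L + 1)) * \<tau>\<^sup>2)))"
proof -
  have [measurable_cong]: "sets q = sets (param_space I)" by (rule q)
  have meas: "(\<lambda>\<eta>. ennreal ((\<eta> k - \<theta>\<^sub>0 k) ^ j)) \<in> borel_measurable q" if "k \<in> I" for k j
    using that by measurable
  have nn: "0 \<le> (\<eta> k - \<theta>\<^sub>0 k) ^ (2 * j)" for \<eta> :: "param \<Rightarrow> real" and k j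
    by (simp add: zero_le_even_power)
  have T_nn: "0 \<le> T ^ (2 * L)" using T by simp
  have one: "(\<integral>\<^sup>+\<eta>. ennreal (T ^ (2 * L) * (\<eta> k - \<theta>\<^sub>0 k) ^ (2 * 1) + (\<eta> k - \<theta>\<^sub>0 k) ^ (2 * (L + 1))) \<partial>q)
      \<le> ennreal ((T ^ (2 * L) * C 1 + C (L + 1)) * \<tau>\<^sup>2)" if k: "k \<in> I" for k
  proof -
    have "(\<integral>\<^sup>+\<eta>. ennreal (T ^ (2 * L) * (\<eta> k - \<theta>\<^sub>0 k) ^ (2 * 1) + (\<eta> k - \<theta>\<^sub>0 k) ^ (2 * (L + 1))) \<partial>q)
        = (\<integral>\<^sup>+\<eta>. ennreal (T ^ (2 * L)) * ennreal ((\<eta> k - \<theta>\<^sub>0 k) ^ (2 * 1))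
            + ennreal ((\<eta> k - \<theta>\<^sub>0 k) ^ (2 * (L + 1))) \<partial>q)"
      by (intro nn_integral_cong) (simp only: ennreal_plus ennreal_mult nn T_nn mult_nonneg_nonneg)
    also have "\<dots> = ennreal (T ^ (2 * L)) * (\<integral>\<^sup>+\<eta>. ennreal ((\<eta> k - \<theta>\<^sub>0 k) ^ (2 * 1)) \<partial>q)
        + (\<integral>\<^sup>+\<eta>. ennreal ((\<eta> k - \<theta>\<^sub>0 k) ^ (2 * (L + 1))) \<partial>q)"
      by (subst nn_integral_add)
        (simp_all only: nn_integral_cmult meas[OF k] borel_measurable_times_ennreal borel_measurable_const)
    also have "\<dots> \<le> ennreal (T ^ (2 * L)) * ennreal (C 1 * \<tau> ^ (2 * 1)) + ennreal (C (L + 1) * \<tau> ^ (2 * (L + 1)))"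
      by (intro add_mono mult_left_mono mom k) auto
    also have "\<dots> = ennreal (T ^ (2 * L) * (C 1 * \<tau> ^ (2 * 1)) + C (L + 1) * \<tau> ^ (2 * (L + 1)))"
      using C T_nn \<tau> by (simp only: ennreal_plus ennreal_mult mult_nonneg_nonneg zero_le_power less_imp_le)
    also have "\<dots> \<le> ennreal ((T ^ (2 * L) * C 1 + C (L + 1)) * \<tau>\<^sup>2)"
    proof (rule ennreal_leI)
      have "\<tau> ^ (2 * (L + 1)) \<le> \<tau>\<^sup>2" using \<tau> by (intro power_decreasing) auto
      then have "C (L + 1) * \<tau> ^ (2 * (L + 1)) \<le> C (L + 1) * \<tau>\<^sup>2" using C by (intro mult_left_mono) auto
      moreover have "T ^ (2 * L) * (C 1 * \<tau> ^ (2 * 1)) = T ^ (2 * L) * C 1 * \<tau>\<^sup>2"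
        by (simp only: mult.assoc mult_1_right)
      ultimately show "T ^ (2 * L) * (C 1 * \<tau> ^ (2 * 1)) + C (L + 1) * \<tau> ^ (2 * (L + 1))
          \<le> (T ^ (2 * L) * C 1 + C (L + 1)) * \<tau>\<^sup>2"
        unfolding distrib_right by linarith
    qed
    finally show ?thesis .
  qed
  let ?u = "\<lambda>k \<eta>. T ^ (2 * L) * (\<eta> k - \<theta>\<^sub>0 k) ^ (2 * 1) + (\<eta> k - \<theta>\<^sub>0 k) ^ (2 * (L + 1))"
  have u_nn: "0 \<le> ?u k \<eta>" for k and \<eta> :: "param \<Rightarrow> real"
    by (intro add_nonneg_nonneg mult_nonneg_nonneg nn T_nn)
  have u_meas: "(\<lambda>\<eta>. ennreal (?u k \<eta>)) \<in> borel_measurable q" if "k \<in> I" for k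
    using that by measurable
  have "(\<integral>\<^sup>+\<eta>. ennreal (sq_err_bound \<eta>) \<partial>q)
      = (\<integral>\<^sup>+\<eta>. ennreal ((real L * (4 * real W) ^ L)\<^sup>2) * (\<Sum>k\<in>I. ennreal (?u k \<eta>)) \<partial>q)"
    unfolding sq_err_bound_def
    by (intro nn_integral_cong) (simp only: ennreal_mult sum_ennreal u_nn sum_nonneg zero_le_power2)
  also have "\<dots> = ennreal ((real L * (4 * real W) ^ L)\<^sup>2) * (\<Sum>k\<in>I. \<integral>\<^sup>+\<eta>. ennreal (?u k \<eta>) \<partial>q)"
    by (subst nn_integral_cmult) (auto intro!: borel_measurable_sum u_meas simp only: nn_integral_sum[OF u_meas])
  also have "\<dots> \<le> ennreal ((real L * (4 * real W) ^ L)\<^sup>2) * (\<Sum>k\<in>I. ennreal ((T ^ (2 * L) * C 1 + C (L + 1)) * \<tau>\<^sup>2))"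
    by (intro mult_left_mono sum_mono one) auto
  also have "\<dots> = ennreal ((real L * (4 * real W) ^ L)\<^sup>2 * (card I * ((T ^ (2 * L) * C 1 + C (L + 1)) * \<tau>\<^sup>2)))"
    using C T_nn \<tau> by (simp add: ennreal_of_nat_eq_real_of_nat flip: ennreal_mult')
  finally show ?thesis .
qed

text \<open>
  The hypothesis on \<open>sq_err_bound\<close> leaves room for noise of total size \<open>n\<^sup>2\<close>: in
  \<open>abs_log_lik_ratio_le\<close> the choice \<open>m = n\<^sup>2\<close> makes both contributions of the noise bounded.
\<close>

lemma competitor_log_lik_ratio:
  assumes q: "prob_space q" "sets q = sets (param_space I)"
    and small: "(\<integral>\<^sup>+\<eta>. ennreal (sq_err_bound \<eta>) \<partial>q) \<le> ennreal (1 / real n ^ 4)"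
    and D: "in_cube D" "noise D \<le> real n ^ 2"
  shows "integrable q (\<lambda>\<theta>. llr \<theta> D)" and "- (\<integral>\<theta>. llr \<theta> D \<partial>q) \<le> 5 / (2 * \<sigma>\<^sup>2)"
proof -
  interpret q: prob_space q by (rule q(1))
  have [measurable_cong]: "sets q = sets (param_space I)" by (rule q(2))
  have b_meas [measurable]: "sq_err_bound \<in> borel_measurable q"
    unfolding sq_err_bound_def by measurable
  have llr_meas [measurable]: "(\<lambda>\<theta>. llr \<theta> D) \<in> borel_measurable q"
    using llr_measurable_params by measurable
  have int: "integrable q sq_err_bound"
    using small sq_err_bound_nonneg by (intro integrableI_nonneg) (auto intro: le_less_trans)
  have int_le: "(\<integral>\<eta>. sq_err_bound \<eta> \<partial>q) \<le> 1 / real n ^ 4"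
    using small sq_err_bound_nonneg by (subst integral_eq_nn_integral) (auto intro: enn2real_leI)
  have le: "\<bar>llr \<theta> D\<bar> \<le> (2 + 3 * (real n ^ 4 * sq_err_bound \<theta>)) / (2 * \<sigma>\<^sup>2)" for \<theta>
  proof -
    let ?\<Psi> = "sq_err_bound \<theta>"
    have "\<bar>llr \<theta> D\<bar> \<le> (real n * ?\<Psi> + 2 * (1 / real n ^ 2 + real n ^ 2 * ?\<Psi>) * noise D) / (2 * \<sigma>\<^sup>2)"
      by (rule abs_log_lik_ratio_le) (use n D(1) in \<open>auto intro!: net_diff_sq_le\<close>)
    also have "\<dots> \<le> (real n ^ 4 * ?\<Psi> + 2 * (1 / real n ^ 2 + real n ^ 2 * ?\<Psi>) * real n ^ 2) / (2 * \<sigma>\<^sup>2)"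
    proof (intro divide_right_mono add_mono mult_left_mono mult_right_mono)
      show "real n \<le> real n ^ 4" using n by (intro self_le_power) auto
    qed (use D(2) sq_err_bound_nonneg in auto)
    also have "\<dots> = (2 + 3 * (real n ^ 4 * ?\<Psi>)) / (2 * \<sigma>\<^sup>2)"
      using n by (simp add: power_def algebra_simps numeral_eq_Suc)
    finally show ?thesis .
  qed
  have int_dom: "integrable q (\<lambda>\<theta>. (2 + 3 * (real n ^ 4 * sq_err_bound \<theta>)) / (2 * \<sigma>\<^sup>2))"
    using int by auto
  show int_llr: "integrable q (\<lambda>\<theta>. llr \<theta> D)"
  proof (rule Bochner_Integration.integrable_bound[OF int_dom])
    show "AE \<theta> in q. norm (llr \<theta> D) \<le> norm ((2 + 3 * (real n ^ 4 * sq_err_bound \<theta>)) / (2 * \<sigma>\<^sup>2))"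
      unfolding real_norm_def by (intro AE_I2 order_trans[OF le abs_ge_self])
  qed measurable
  have "- (\<integral>\<theta>. llr \<theta> D \<partial>q) = (\<integral>\<theta>. - llr \<theta> D \<partial>q)" by simp
  also have "\<dots> \<le> (\<integral>\<theta>. (2 + 3 * (real n ^ 4 * sq_err_bound \<theta>)) / (2 * \<sigma>\<^sup>2) \<partial>q)"
    using le int_dom int_llr by (intro integral_mono) (auto simp: abs_le_iff)
  also have "\<dots> = (2 + 3 * (real n ^ 4 * (\<integral>\<eta>. sq_err_bound \<eta> \<partial>q))) / (2 * \<sigma>\<^sup>2)"
    using int by (simp add: q.prob_space)
  also have "\<dots> \<le> 5 / (2 * \<sigma>\<^sup>2)"
  proof (rule divide_right_mono)
    have "real n ^ 4 * (\<integral>\<eta>. sq_err_bound \<eta> \<partial>q) \<le> real n ^ 4 * (1 / real n ^ 4)"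
      using int_le by (intro mult_left_mono) auto
    then show "2 + 3 * (real n ^ 4 * (\<integral>\<eta>. sq_err_bound \<eta> \<partial>q)) \<le> 5" using n by simp
  qed simp
  finally show "- (\<integral>\<theta>. llr \<theta> D \<partial>q) \<le> 5 / (2 * \<sigma>\<^sup>2)" .
qed

lemma evidence_exponent_nonneg: "0 \<le> evidence_exponent"
  unfolding evidence_exponent_def using net_size_ge n by (intro add_nonneg_nonneg mult_nonneg_nonneg) auto

text \<open>
  The oracle inequality with \<open>h = 2 * n * d\<^sup>2\<close>; the summand one bounds
  \<open>ln (exp evidence_exponent + 1) - evidence_exponent\<close>.
\<close>

lemma variational_posterior_bound:
  assumes comp: "q' \<in> variational_family M I" "\<rho> \<in> borel_measurable (param_space I)"
      "\<And>\<theta>. 0 \<le> \<rho> \<theta>" "\<And>\<theta>. \<rho> \<theta> \<le> exp \<kappa>" "q' = density (prior M I s) (\<lambda>\<theta>. ennreal (\<rho> \<theta>))"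
    and small: "(\<integral>\<^sup>+\<eta>. ennreal (sq_err_bound \<eta>) \<partial>q') \<le> ennreal (1 / real n ^ 4)"
    and D: "in_cube D" "noise D \<le> real n ^ 2"
      "(\<integral>\<^sup>+\<theta>. ennreal (exp (2 * real n * d2 \<theta> + llr \<theta> D)) \<partial>prior M I s) \<le> ennreal (exp evidence_exponent + 1)"
    and q: "variational_posterior D q"
  shows "absolutely_continuous (prior M I s) q"
    and "2 * real n * (\<integral>\<theta>. d2 \<theta> \<partial>q) \<le> \<kappa> + evidence_exponent + 5 / (2 * \<sigma>\<^sup>2) + 1"
proof -
  interpret prior: prob_space "prior M I s" by (rule sp.prob_space_prior)
  have q_fam: "q \<in> variational_family M I"
    and KL_le: "KL q (posterior (prior M I s) (\<lambda>\<theta>. likelihood \<sigma> (net \<theta>) n D))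
      \<le> KL q' (posterior (prior M I s) (\<lambda>\<theta>. likelihood \<sigma> (net \<theta>) n D))"
    using q comp(1) by (auto simp: is_arg_min_def not_less)
  have q'_prob: "prob_space q'" and q'_sets: "sets q' = sets (param_space I)"
    using prob_space_variational_family[OF comp(1)] sets_variational_family[OF comp(1)] .
  interpret q': prob_space q' by (rule q'_prob)
  have llr_m [measurable]: "(\<lambda>\<theta>. llr \<theta> D) \<in> borel_measurable (param_space I)" by (rule llr_measurable_params)
  define l0 where "l0 = likelihood \<sigma> (net \<theta>\<^sub>0) n D"
  have l0: "0 < l0" unfolding l0_def by (rule likelihood_pos[OF \<sigma>_pos])
  have lik: "likelihood \<sigma> (net \<theta>) n D = l0 * exp (llr \<theta> D)" for \<theta>
    unfolding l0_def by (rule likelihood_eq_log_lik_ratio)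
  have ln_lik: "ln (likelihood \<sigma> (net \<theta>) n D) = ln l0 + llr \<theta> D" for \<theta>
    using l0 by (simp add: lik ln_mult)
  have lik_m: "(\<lambda>\<theta>. likelihood \<sigma> (net \<theta>) n D) \<in> borel_measurable (prior M I s)"
    unfolding lik by measurable
  have \<rho>_m: "\<rho> \<in> borel_measurable (prior M I s)" using comp(2) by measurable
  have h_m: "(\<lambda>\<theta>. 2 * real n * d2 \<theta>) \<in> borel_measurable (prior M I s)" by measurable
  have h: "\<bar>2 * real n * d2 \<theta>\<bar> \<le> 2 * real n" for \<theta>
    using reg.hellinger_sq_bounds[of "net \<theta>"] mult_left_mono[of "d2 \<theta>" 1 "2 * real n"] by (simp add: abs_mult)
  note llr_q' = competitor_log_lik_ratio[OF q'_prob q'_sets small D(1,2)]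
  have int_ln: "integrable q' (\<lambda>\<theta>. ln (likelihood \<sigma> (net \<theta>) n D))"
    unfolding ln_lik using llr_q'(1) by simp
  have q_sets: "sets q = sets (prior M I s)"
    using sets_variational_family[OF q_fam] by simp
  note bound = variational_oracle_inequality[OF sp.prob_space_prior prob_space_variational_family[OF q_fam]
      q'_prob q_sets lik_m \<rho>_m h_m likelihood_pos[OF \<sigma>_pos] likelihood_le[OF \<sigma>_pos] comp(5) comp(3,4) int_ln KL_le h]
  show "absolutely_continuous (prior M I s) q" by (rule bound(1))
  let ?g = "\<lambda>\<theta>. exp (2 * real n * d2 \<theta> + llr \<theta> D)"
  define J where "J = (\<integral>\<theta>. ?g \<theta> \<partial>prior M I s)"
  have g_m: "?g \<in> borel_measurable (prior M I s)" by measurable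
  have int_g: "integrable (prior M I s) ?g"
    using D(3) g_m by (intro integrableI_nonneg) (auto intro: le_less_trans)
  have J_le: "J \<le> exp evidence_exponent + 1"
    unfolding J_def using D(3) g_m by (subst integral_eq_nn_integral) (auto intro!: enn2real_leI add_nonneg_nonneg)
  have J_pos: "0 < J"
  proof -
    have "J \<noteq> 0"
    proof
      assume "J = 0"
      then have "AE \<theta> in prior M I s. ?g \<theta> = 0"
        unfolding J_def using integral_nonneg_eq_0_iff_AE[OF int_g] by simp
      then have "AE \<theta> in prior M I s. False" by eventually_elim simp
      then show False by simp
    qed
    moreover have "0 \<le> J" unfolding J_def by simp
    ultimately show ?thesis by simp
  qed
  have "2 * real n * (\<integral>\<theta>. d2 \<theta> \<partial>q) = (\<integral>\<theta>. 2 * real n * d2 \<theta> \<partial>q)" by simp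
  also have "\<dots> \<le> \<kappa> - (\<integral>\<theta>. ln (likelihood \<sigma> (net \<theta>) n D) \<partial>q')
      + ln (\<integral>\<theta>. exp (2 * real n * d2 \<theta>) * likelihood \<sigma> (net \<theta>) n D \<partial>prior M I s)"
    by (rule bound(2))
  also have "(\<integral>\<theta>. ln (likelihood \<sigma> (net \<theta>) n D) \<partial>q') = ln l0 + (\<integral>\<theta>. llr \<theta> D \<partial>q')"
    unfolding ln_lik using llr_q'(1) by (simp add: q'.prob_space)
  also have "(\<integral>\<theta>. exp (2 * real n * d2 \<theta>) * likelihood \<sigma> (net \<theta>) n D \<partial>prior M I s) = l0 * J"
    unfolding J_def lik by (simp add: exp_add mult_ac flip: integral_mult_right_zero)
  also have "ln (l0 * J) = ln l0 + ln J" using l0 J_pos by (simp add: ln_mult)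
  finally have "2 * real n * (\<integral>\<theta>. d2 \<theta> \<partial>q) \<le> \<kappa> - (\<integral>\<theta>. llr \<theta> D \<partial>q') + ln J" by simp
  moreover have "ln J \<le> evidence_exponent + 1"
  proof -
    have "J \<le> exp evidence_exponent * 2"
      using J_le one_le_exp_iff[of evidence_exponent] evidence_exponent_nonneg by linarith
    also have "\<dots> \<le> exp evidence_exponent * exp 1"
      using exp_ge_add_one_self[of 1] by (intro mult_left_mono) auto
    also have "\<dots> = exp (evidence_exponent + 1)" by (simp add: exp_add)
    finally show ?thesis using J_pos by (metis exp_gt_zero ln_exp ln_le_cancel_iff)
  qed
  ultimately show "2 * real n * (\<integral>\<theta>. d2 \<theta> \<partial>q) \<le> \<kappa> + evidence_exponent + 5 / (2 * \<sigma>\<^sup>2) + 1"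
    using llr_q'(2) by linarith
qed


lemma d2_eq_0:
  assumes "\<And>k. k \<in> I \<Longrightarrow> \<theta> k = \<theta>\<^sub>0 k"
  shows "d2 \<theta> = 0"
proof -
  have z: "sq_err_bound \<theta> = 0" using assms by (simp add: sq_err_bound_def)
  have "AE x in cube_dist p. net \<theta> x - net \<theta>\<^sub>0 x = 0"
    using AE_cube_dist
  proof eventually_elim
    fix x :: "nat \<Rightarrow> real" assume "\<forall>j\<in>{..<p}. \<bar>x j\<bar> \<le> 1"
    with net_diff_sq_le[of x \<theta>] z show "net \<theta> x - net \<theta>\<^sub>0 x = 0" by simp
  qed
  then have "AE x in cube_dist p. 1 - exp (- ((net \<theta> x - net \<theta>\<^sub>0 x)\<^sup>2 / (8 * \<sigma>\<^sup>2))) = 0"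
    by eventually_elim simp
  then show ?thesis
    unfolding hellinger_sq_def by (rule integral_eq_zero_AE)
qed

text \<open>
  For \<open>s = 0\<close> the rate of convergence is zero.  In that case the prior is a point mass at the teacher, and
  the risk vanishes exactly.
\<close>

lemma integral_d2_eq_0:
  assumes "s = 0" and "q \<in> variational_family M I" and ac: "absolutely_continuous (prior M I s) q"
  shows "(\<integral>\<theta>. d2 \<theta> \<partial>q) = 0"
proof (rule integral_eq_zero_AE)
  have "sets q = sets (prior M I s)" using sets_variational_family[OF assms(2)] by simp
  then have "AE \<theta> in q. card {k \<in> I. \<theta> k \<noteq> 0} \<le> s"
    by (rule absolutely_continuous_AE[OF _ ac sp.AE_prior_sparse])
  then show "AE \<theta> in q. d2 \<theta> = 0"
  proof eventually_elim
    fix \<theta> :: "param \<Rightarrow> real" assume "card {k \<in> I. \<theta> k \<noteq> 0} \<le> s"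
    then have "\<theta> k = \<theta>\<^sub>0 k" if "k \<in> I" for k
      using \<theta>\<^sub>0_sparse \<open>s = 0\<close> finite_I that by auto
    then show "d2 \<theta> = 0" by (rule d2_eq_0)
  qed
qed

text \<open>
  At this scale the expectation of \<open>sq_err_bound\<close> under the competitor is at most \<open>1 / n ^ 4\<close>, if
  \<open>c\<close> dominates the moment constants.
\<close>

definition scale :: "real \<Rightarrow> real" where
  "scale c = 1 / (real n ^ 2 * real L * (4 * real W) ^ L * real (card I) * c)"

lemma scale_bounds:
  assumes "1 \<le> c"
  shows "0 < scale c" "scale c \<le> 1"
proof -
  have "1 * 1 * 1 * 1 * 1 \<le> real n ^ 2 * real L * (4 * real W) ^ L * real (card I) * c"
    using n L W card_I_pos assms by (intro mult_mono one_le_power) auto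
  then show "0 < scale c" "scale c \<le> 1" by (simp_all add: scale_def)
qed

lemma student_bound:
  fixes K c :: real and C :: "nat \<Rightarrow> real"
  assumes tail: "0 \<le> C\<^sub>t" "\<And>b. 0 \<le> b \<Longrightarrow> emeasure (slab_dist M) {x. b < \<bar>x\<bar>} \<le> ennreal (C\<^sub>t * exp (- b))"
    and K: "0 < K" and C: "\<And>j. 0 \<le> C j" and c: "1 \<le> c" "T ^ (2 * L) * C 1 + C (L + 1) \<le> c"
    and comp: "\<And>\<tau>. 0 < \<tau> \<Longrightarrow> \<tau> \<le> 1 \<Longrightarrow> has_sparse_competitor M I s \<theta>\<^sub>0 K C \<tau>"
  obtains A where "A \<in> sets data"
    and "1 - failure_prob C\<^sub>t \<le> measure data A"
    and "\<And>D q. D \<in> A \<Longrightarrow>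
      variational_posterior D q \<Longrightarrow>
      absolutely_continuous (prior M I s) q \<and>
      2 * real n * (\<integral>\<theta>. d2 \<theta> \<partial>q) \<le> real s * ln (real (card I) * (K / scale c)) + evidence_exponent + 5 / (2 * \<sigma>\<^sup>2) + 1"
proof -
  note \<tau> = scale_bounds[OF c(1)]
  obtain q' \<rho> where q': "q' \<in> variational_family M I" "\<rho> \<in> borel_measurable (param_space I)"
      "\<forall>x. 0 \<le> \<rho> x \<and> \<rho> x \<le> (card I * (K / scale c)) ^ s"
      "q' = density (prior M I s) (\<lambda>x. ennreal (\<rho> x))"
      "\<forall>k\<in>I. \<forall>j\<ge>1. (\<integral>\<^sup>+\<eta>. ennreal ((\<eta> k - \<theta>\<^sub>0 k) ^ (2 * j)) \<partial>q') \<le> ennreal (C j * scale c ^ (2 * j))"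
    using comp[OF \<tau>] unfolding has_sparse_competitor_def by (elim exE conjE)
  define \<kappa> where "\<kappa> = real s * ln (real (card I) * (K / scale c))"
  have pos: "0 < real (card I) * (K / scale c)" using card_I_pos K \<tau>(1) by simp
  then have \<kappa>: "exp \<kappa> = (card I * (K / scale c)) ^ s"
    unfolding \<kappa>_def by (simp only: exp_of_nat_mult exp_ln)
  have small: "(\<integral>\<^sup>+\<eta>. ennreal (sq_err_bound \<eta>) \<partial>q') \<le> ennreal (1 / real n ^ 4)"
  proof -
    let ?a = "real L * (4 * real W) ^ L"
    have "(\<integral>\<^sup>+\<eta>. ennreal (sq_err_bound \<eta>) \<partial>q')
        \<le> ennreal (?a\<^sup>2 * (card I * ((T ^ (2 * L) * C 1 + C (L + 1)) * (scale c)\<^sup>2)))"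
      by (rule expected_sq_err_bound_le[OF sets_variational_family[OF q'(1)] C \<tau>]) (use q'(5) in blast)
    also have "\<dots> \<le> ennreal (?a\<^sup>2 * (card I * (c * (scale c)\<^sup>2)))"
      using c by (intro ennreal_leI mult_left_mono mult_right_mono) auto
    also have "?a\<^sup>2 * (card I * (c * (scale c)\<^sup>2)) = 1 / (real n ^ 4 * (real (card I) * c))"
      using L W card_I_pos c n by (simp add: scale_def power2_eq_square field_simps numeral_eq_Suc)
    also have "ennreal \<dots> \<le> ennreal (1 / real n ^ 4)"
    proof (intro ennreal_leI divide_left_mono)
      have "1 * 1 \<le> real (card I) * c" using card_I_pos c by (intro mult_mono) auto
      then show "real n ^ 4 \<le> real n ^ 4 * (real (card I) * c)"
        using mult_left_mono[of 1 "real (card I) * c" "real n ^ 4"] by simp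
    qed (use n card_I_pos c in auto)
    finally show ?thesis .
  qed
  show thesis
  proof (rule good_event[OF tail])
    fix A assume A: "A \<in> sets data" "1 - failure_prob C\<^sub>t \<le> measure data A"
      "\<And>D. D \<in> A \<Longrightarrow> in_cube D" "\<And>D. D \<in> A \<Longrightarrow> noise D \<le> real n ^ 2"
      "\<And>D. D \<in> A \<Longrightarrow>
        (\<integral>\<^sup>+\<theta>. ennreal (exp (2 * real n * d2 \<theta> + llr \<theta> D)) \<partial>prior M I s) \<le> ennreal (exp evidence_exponent + 1)"
    show thesis
    proof (rule that[OF A(1,2)])
      fix D q assume D: "D \<in> A" and q: "variational_posterior D q"
      have \<rho>: "0 \<le> \<rho> x" "\<rho> x \<le> exp \<kappa>" for x using q'(3) \<kappa> by auto
      note b = variational_posterior_bound[OF q'(1,2) \<rho> q'(4) small A(3)[OF D] A(4)[OF D] A(5)[OF D] q]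
      from b show "absolutely_continuous (prior M I s) q \<and>
        2 * real n * (\<integral>\<theta>. d2 \<theta> \<partial>q) \<le> real s * ln (real (card I) * (K / scale c)) + evidence_exponent + 5 / (2 * \<sigma>\<^sup>2) + 1"
        unfolding \<kappa>_def by blast
    qed
  qed
qed

end

section \<open>The rate\<close>

lemma ln_le_of_le_mult_power:
  fixes a X y :: real
  assumes "0 < y" "y \<le> a * X ^ m" "1 \<le> X" "0 < a"
  shows "ln y \<le> (\<bar>ln a\<bar> + m) * (1 + ln X)"
proof -
  have "ln y \<le> ln (a * X ^ m)" using assms by simp
  also have "\<dots> = ln a + m * ln X" using assms by (simp add: ln_mult ln_realpow)
  also have "\<dots> \<le> \<bar>ln a\<bar> * (1 + ln X) + m * (1 + ln X)"
  proof (intro add_mono)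
    have "ln a \<le> \<bar>ln a\<bar> * 1" by simp
    also have "\<dots> \<le> \<bar>ln a\<bar> * (1 + ln X)" using assms by (intro mult_left_mono) auto
    finally show "ln a \<le> \<bar>ln a\<bar> * (1 + ln X)" .
  qed (simp add: mult_left_mono)
  finally show ?thesis by (simp add: distrib_right)
qed

context sparse_student
begin

lemma card_I_le: "real (card I) \<le> 2 * real L * (real n * real W) ^ 2"
proof -
  have "real (card I) \<le> real (2 * L * W\<^sup>2)"
    by (intro of_nat_mono card_param_index_le[OF width])
  also have "\<dots> = 2 * real L * real W ^ 2" by simp
  also have "\<dots> \<le> 2 * real L * (real n * real W) ^ 2"
    using n by (intro mult_left_mono power_mono) (auto simp: mult_le_cancel_right1)
  finally show ?thesis .
qed

lemma nW_ge: "1 \<le> real n * real W" "real n \<le> real n * real W" "real W \<le> real n * real W"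
  using n W mult_mono[of 1 "real n" 1 "real W"] by (auto simp: mult_le_cancel_right1)

lemma competitor_exponent_le:
  assumes K: "0 < K" and c: "1 \<le> c"
  shows "ln (real (card I) * (K / scale c))
    \<le> (\<bar>ln ((2 * real L)\<^sup>2 * K * real L * 4 ^ L * c)\<bar> + real (L + 6)) * (1 + ln (real n * real W))"
proof (rule ln_le_of_le_mult_power)
  let ?X = "real n * real W"
  show "0 < real (card I) * (K / scale c)" using card_I_pos K scale_bounds[OF c] by simp
  have "real (card I) * (K / scale c)
      = real (card I) * (real (card I) * (K * real L * 4 ^ L * c * (real n ^ 2 * real W ^ L)))"
    using L by (simp add: scale_def power_mult_distrib mult_ac)
  also have "\<dots> \<le> (2 * real L * ?X ^ 2) * ((2 * real L * ?X ^ 2) * (K * real L * 4 ^ L * c * (?X ^ 2 * ?X ^ L)))"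
    using card_I_le nW_ge K c by (intro mult_mono power_mono mult_nonneg_nonneg) auto
  also have "\<dots> = (2 * real L)\<^sup>2 * K * real L * 4 ^ L * c * ?X ^ (L + 6)"
  proof -
    have "?X ^ (L + 6) = ?X ^ L * (?X ^ 2 * (?X ^ 2 * ?X ^ 2))"
      unfolding power_add[symmetric] by simp
    moreover have "(2 * l * u) * ((2 * l * u) * (K * l * a * c * (u * v))) = (2 * l)\<^sup>2 * K * l * a * c * (v * (u * (u * u)))"
      for l u v a :: real by (simp add: power2_eq_square)
    ultimately show ?thesis by (simp only:)
  qed
  finally show "real (card I) * (K / scale c) \<le> (2 * real L)\<^sup>2 * K * real L * 4 ^ L * c * ?X ^ (L + 6)" .
  show "0 < (2 * real L)\<^sup>2 * K * real L * 4 ^ L * c" using L K c by simp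
qed (rule nW_ge)

lemma ln_net_size_le:
  defines "r \<equiv> 3 + 2 * real L + T"
  shows "ln net_size \<le> (\<bar>ln (6 * (real L)\<^sup>2 * r * (2 * r) ^ (2 * L))\<bar> + real (6 * L + 6)) * (1 + ln (real n * real W))"
proof (rule ln_le_of_le_mult_power)
  let ?X = "real n * real W"
  have r: "1 \<le> r" using T by (simp add: r_def)
  have X: "1 \<le> ?X" by (rule nW_ge)
  show "0 < net_size" using net_size_ge by simp
  have "?X \<le> ?X ^ 2" using X by (intro self_le_power) auto
  then have "3 * real n \<le> 3 * ?X ^ 2" "T * 1 \<le> T * ?X ^ 2"
    using nW_ge X T by (linarith, intro mult_left_mono one_le_power) auto
  then have radius: "radius \<le> r * ?X ^ 2"
    using card_I_le by (simp add: radius_def r_def distrib_right)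
  have "net_bound \<le> (2 * ?X * (r * ?X ^ 2)) ^ L"
    unfolding net_bound_def using radius nW_ge radius_ge(1) by (intro power_mono mult_mono) auto
  also have "\<dots> = (2 * r) ^ L * ?X ^ (3 * L)"
  proof -
    have "2 * ?X * (r * ?X ^ 2) = (2 * r) * ?X ^ 3" by (simp add: power2_eq_square power3_eq_cube)
    then show ?thesis by (simp only: power_mult_distrib[of "2 * r"] power_mult)
  qed
  finally have "net_bound ^ 2 \<le> ((2 * r) ^ L * ?X ^ (3 * L)) ^ 2"
    using net_bound_ge by (intro power_mono) auto
  also have "\<dots> = (2 * r) ^ (2 * L) * ?X ^ (6 * L)"
    unfolding power_mult_distrib[of "(2 * r) ^ L"] power_mult[symmetric] by (simp add: mult.commute)
  finally have nb: "net_bound ^ 2 \<le> (2 * r) ^ (2 * L) * ?X ^ (6 * L)" .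
  have "net_size \<le> real (card I) * (3 * (radius * (real n ^ 2 * real L * net_bound ^ 2)))"
  proof -
    have "1 * 1 * 1 * 1 \<le> real n ^ 2 * real L * net_bound ^ 2 * radius"
      using n L net_bound_ge radius_ge(1) by (intro mult_mono one_le_power) auto
    then have "2 * radius / mesh + 1 \<le> 3 * (radius * (real n ^ 2 * real L * net_bound ^ 2))"
      by (simp add: mesh_def mult_ac)
    then show ?thesis unfolding net_size_def by (intro mult_left_mono) auto
  qed
  also have "\<dots> \<le> (2 * real L * ?X ^ 2) * (3 * ((r * ?X ^ 2) * (?X ^ 2 * real L * ((2 * r) ^ (2 * L) * ?X ^ (6 * L)))))"
    using card_I_le radius nb nW_ge radius_ge(1) net_bound_ge r
    by (intro mult_mono power_mono mult_nonneg_nonneg) auto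
  also have "\<dots> = 6 * (real L)\<^sup>2 * r * (2 * r) ^ (2 * L) * ?X ^ (6 * L + 6)"
  proof -
    have "?X ^ (6 * L + 6) = ?X ^ (6 * L) * (?X ^ 2 * (?X ^ 2 * ?X ^ 2))"
      unfolding power_add[symmetric] by simp
    moreover have "(2 * l * u) * (3 * ((r * u) * (u * l * (a * v)))) = 6 * l\<^sup>2 * r * a * (v * (u * (u * u)))"
      for l u v a :: real by (simp add: power2_eq_square)
    ultimately show ?thesis by (simp only:)
  qed
  finally show "net_size \<le> 6 * (real L)\<^sup>2 * r * (2 * r) ^ (2 * L) * ?X ^ (6 * L + 6)" .
  show "0 < 6 * (real L)\<^sup>2 * r * (2 * r) ^ (2 * L)" using L r by simp
qed (rule nW_ge)

end

definition risk_constant :: "nat \<Rightarrow> real \<Rightarrow> real \<Rightarrow> real \<Rightarrow> real \<Rightarrow> real" where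
  "risk_constant L T K c \<sigma> = (\<bar>ln ((2 * real L)\<^sup>2 * K * real L * 4 ^ L * c)\<bar> + real (L + 6))
     + 2 * (\<bar>ln (6 * (real L)\<^sup>2 * (3 + 2 * real L + T) * (2 * (3 + 2 * real L + T)) ^ (2 * L))\<bar> + real (6 * L + 6))
     + 2 + 4 / \<sigma>\<^sup>2 + 5 / (2 * \<sigma>\<^sup>2) + 1"

lemma risk_constant_pos: "0 < risk_constant L T K c \<sigma>"
  unfolding risk_constant_def by (intro add_nonneg_pos add_nonneg_nonneg mult_nonneg_nonneg) auto

text \<open>
  At a fixed sample size the variational risk is of order \<open>s * (1 + ln (n * W)) / n\<close>, with a
  constant that depends neither on \<open>n\<close> nor on \<open>W\<close> and \<open>s\<close>.
\<close>

lemma (in sparse_student) student_bound_explicit: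
  fixes K c :: real and C :: "nat \<Rightarrow> real"
  assumes tail: "0 \<le> C\<^sub>t" "\<And>b. 0 \<le> b \<Longrightarrow> emeasure (slab_dist M) {x. b < \<bar>x\<bar>} \<le> ennreal (C\<^sub>t * exp (- b))"
    and K: "0 < K" and C: "\<And>j. 0 \<le> C j" and c: "1 \<le> c" "T ^ (2 * L) * C 1 + C (L + 1) \<le> c"
    and comp: "\<And>\<tau>. 0 < \<tau> \<Longrightarrow> \<tau> \<le> 1 \<Longrightarrow> has_sparse_competitor M I s \<theta>\<^sub>0 K C \<tau>"
  defines "R \<equiv> risk_constant L T K c \<sigma>"
  shows "\<exists>A. A \<in> sets data \<and> 1 - failure_prob C\<^sub>t \<le> measure data A \<and>
    (\<forall>D q. D \<in> A \<longrightarrow>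
      variational_posterior D q \<longrightarrow>
      (\<integral>\<theta>. d2 \<theta> \<partial>q) \<le> R * (real s * (1 + ln (real n * real W))) / real n)"
proof (rule student_bound[OF tail K C c comp])
  fix A assume A: "A \<in> sets data" "1 - failure_prob C\<^sub>t \<le> measure data A"
    and bound: "\<And>D q. D \<in> A \<Longrightarrow>
      variational_posterior D q \<Longrightarrow>
      absolutely_continuous (prior M I s) q \<and>
      2 * real n * (\<integral>\<theta>. d2 \<theta> \<partial>q) \<le> real s * ln (real (card I) * (K / scale c)) + evidence_exponent + 5 / (2 * \<sigma>\<^sup>2) + 1"
  let ?Y = "1 + ln (real n * real W)"
  define R1 where "R1 = \<bar>ln ((2 * real L)\<^sup>2 * K * real L * 4 ^ L * c)\<bar> + real (L + 6)"
  define R2 where "R2 = \<bar>ln (6 * (real L)\<^sup>2 * (3 + 2 * real L + T) * (2 * (3 + 2 * real L + T)) ^ (2 * L))\<bar>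
    + real (6 * L + 6)"
  have R: "R = R1 + 2 * R2 + 2 + 4 / \<sigma>\<^sup>2 + 5 / (2 * \<sigma>\<^sup>2) + 1" by (simp add: R_def risk_constant_def R1_def R2_def)
  have R_nn: "0 \<le> R" unfolding R_def by (rule less_imp_le[OF risk_constant_pos])
  have Y: "1 \<le> ?Y" using nW_ge(1) by simp
  have small: "(\<integral>\<theta>. d2 \<theta> \<partial>q) \<le> R * (real s * ?Y) / real n"
    if D: "D \<in> A" and q: "variational_posterior D q" for D q
  proof (cases "s = 0")
    case True
    have "q \<in> variational_family M I" using q by (simp add: is_arg_min_def)
    then show ?thesis using integral_d2_eq_0[OF True _ conjunct1[OF bound[OF D q]]] True by simp
  next
    case False
    then have s1: "1 \<le> real s * ?Y" using Y mult_mono[of 1 "real s" 1 ?Y] by simp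
    define Z where "Z = real s * ?Y"
    define v where "v = 4 / \<sigma>\<^sup>2 + 5 / (2 * \<sigma>\<^sup>2) + 1"
    have "real s * ln (real (card I) * (K / scale c)) \<le> real s * (R1 * ?Y)"
      unfolding R1_def by (intro mult_left_mono competitor_exponent_le K c) auto
    then have 1: "real s * ln (real (card I) * (K / scale c)) \<le> R1 * Z" by (simp add: Z_def mult.left_commute)
    have "real s * ln net_size \<le> real s * (R2 * ?Y)"
      unfolding R2_def by (intro mult_left_mono ln_net_size_le) auto
    then have 2: "real s * ln net_size \<le> R2 * Z" by (simp add: Z_def mult.left_commute)
    have 3: "ln (real n) \<le> Z"
    proof -
      have "ln (real n) \<le> ln (real n * real W)" using n nW_ge by simp
      also have "\<dots> \<le> 1 * ?Y" by simp
      also have "\<dots> \<le> real s * ?Y" using False Y by (intro mult_right_mono) auto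
      finally show ?thesis by (simp only: Z_def)
    qed
    have "v * 1 \<le> v * Z"
      using s1 unfolding Z_def v_def by (intro mult_left_mono) auto
    then have "real s * ln (real (card I) * (K / scale c)) + evidence_exponent + 5 / (2 * \<sigma>\<^sup>2) + 1
        \<le> R1 * Z + 2 * (R2 * Z + Z) + v * Z"
      using 1 2 3 unfolding evidence_exponent_def by (simp add: v_def)
    also have "\<dots> = (R1 + 2 * R2 + 2 + v) * Z" by (simp add: algebra_simps)
    also have "\<dots> = R * (real s * ?Y)" by (simp add: R v_def Z_def add.assoc)
    finally have "2 * real n * (\<integral>\<theta>. d2 \<theta> \<partial>q) \<le> R * (real s * ?Y)"
      using conjunct2[OF bound[OF D q]] by linarith
    also have "\<dots> \<le> 2 * (R * (real s * ?Y))" using R_nn s1 by simp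
    finally show ?thesis using n by (simp add: field_simps)
  qed
  show ?thesis
    by (intro exI[of _ A] conjI A allI impI small)
qed

text \<open>
  The factor \<open>ln x\<close> on the right pays for the term \<open>s * ln x\<close> on the left, which
  \<open>s * ln (x * L / s)\<close> alone does not dominate when \<open>s\<close> is close to \<open>x\<close>.
\<close>

lemma log_rate_le:
  fixes s N W x :: real
  assumes s: "0 \<le> s" and x: "1 \<le> x" "1 \<le> ln x" and N: "1 \<le> N" and L: "1 \<le> L" and one: "1 \<le> ln (x * L / s)"
  shows "s * (1 + ln (x * (12 * N))) \<le> (3 + ln 12) * ((s * ln (x * L / s) + L * s * ln N) * ln x)"
proof -
  define r where "r = s * ln (x * L / s) + L * s * ln N"
  have lnN: "0 \<le> ln N" using N by simp
  have "s * 1 \<le> s * ln (x * L / s)" using s one by (intro mult_left_mono) auto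
  moreover have "s * ln N \<le> L * (s * ln N)" using mult_right_mono[OF L, of "s * ln N"] s lnN by simp
  moreover have "0 \<le> s * ln N" using s lnN by simp
  ultimately have r: "s \<le> r" "s * ln N \<le> r" "0 \<le> r" using s by (simp_all add: r_def mult.assoc)
  have r_ln: "r \<le> r * ln x" using mult_left_mono[OF x(2) r(3)] by simp
  have "ln (x * (12 * N)) = ln x + (ln 12 + ln N)" using x N by (simp add: ln_mult)
  then have "s * (1 + ln (x * (12 * N))) = s + s * ln x + ln 12 * s + s * ln N"
    by (simp add: algebra_simps)
  also have "\<dots> \<le> r * ln x + r * ln x + ln 12 * (r * ln x) + r * ln x"
    using r r_ln x by (intro add_mono mult_left_mono mult_right_mono) auto
  also have "\<dots> = (3 + ln 12) * (r * ln x)" by (simp add: algebra_simps)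
  finally show ?thesis by (simp add: r_def)
qed

text \<open>
  The growth condition forces \<open>s = o(n)\<close>, even if \<open>p * N = 1\<close>, where \<open>ln (p * N)\<close> vanishes but
  the number of parameters is bounded.
\<close>

lemma eventually_log_ratio_ge_one:
  fixes s N :: "nat \<Rightarrow> nat" and p L :: nat
  assumes L: "1 \<le> L" and pN: "\<And>n. 1 \<le> p * N n"
    and s_le: "\<And>n. s n \<le> 2 * L * (12 * p * N n)\<^sup>2"
    and growth: "(\<lambda>n. max (real L * real (s n) * ln (real p * real (N n)))
                   (real (s n) * ln (real n * real L / real (s n)))) \<in> o(\<lambda>n. real n)"
  shows "eventually (\<lambda>n. 1 \<le> s n \<longrightarrow> 1 \<le> ln (real n * real L / real (s n))) sequentially"
proof -
  define e where "e = (real L)\<^sup>2 * ln 2 / exp 1"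
  \<comment> \<open>If \<open>p * N \<ge> 2\<close>, the bound \<open>L * s * ln 2 \<le> e * n\<close> is exactly \<open>exp 1 * s \<le> n * L\<close>.\<close>
  have "0 < e" using L by (simp add: e_def)
  from landau_o.smallD[OF growth this]
  have "\<forall>\<^sub>F n in sequentially. max (real L * real (s n) * ln (real p * real (N n)))
                   (real (s n) * ln (real n * real L / real (s n))) \<le> e * real n"
    by eventually_elim (metis abs_ge_self norm_of_nat order_trans real_norm_def)
  \<comment> \<open>If \<open>p * N = 1\<close>, then \<open>s \<le> 288 * L\<close>, and \<open>864 = 3 * 288\<close>.\<close>
  moreover have "eventually (\<lambda>n. 864 \<le> n) sequentially" by (rule eventually_ge_at_top)
  ultimately show ?thesis
  proof eventually_elim
    fix n assume le: "max (real L * real (s n) * ln (real p * real (N n)))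
                   (real (s n) * ln (real n * real L / real (s n))) \<le> e * real n" and n: "864 \<le> n"
    show "1 \<le> s n \<longrightarrow> 1 \<le> ln (real n * real L / real (s n))"
    proof
      assume s: "1 \<le> s n"
      have "exp 1 * real (s n) \<le> real n * real L"
      proof (cases "p * N n = 1")
        case True
        then have "s n \<le> 288 * L" using s_le[of n] by (simp add: mult.assoc)
        then have "exp 1 * real (s n) \<le> 3 * real (288 * L)"
          using exp_le by (intro mult_mono) auto
        also have "\<dots> = 864 * real L" by simp
        also have "\<dots> \<le> real n * real L" using n by (intro mult_right_mono) auto
        finally show ?thesis .
      next
        case False
        then have "2 \<le> p * N n" using pN[of n] by linarith
        then have "2 \<le> real p * real (N n)" by (metis of_nat_le_iff of_nat_mult of_nat_numeral)
        then have "ln 2 \<le> ln (real p * real (N n))" by simp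
        then have "real L * real (s n) * ln 2 \<le> real L * real (s n) * ln (real p * real (N n))"
          by (intro mult_left_mono) auto
        also have "\<dots> \<le> e * real n" using le by simp
        finally have "real L * ln 2 * (exp 1 * real (s n)) \<le> real L * ln 2 * (real n * real L)"
          by (simp add: e_def power2_eq_square field_simps)
        then show ?thesis using L by (simp add: mult_le_cancel_left)
      qed
      then have "exp 1 \<le> real n * real L / real (s n)" using s by (simp add: field_simps)
      then have "ln (exp 1) \<le> ln (real n * real L / real (s n))"
        by (intro ln_mono) (auto intro: less_le_trans[OF exp_gt_zero])
      then show "1 \<le> ln (real n * real L / real (s n))" by simp
    qed
  qed
qed

theorem corollary6p3:
  fixes p L L\<^sub>0 s\<^sub>0 :: nat and h\<^sub>0 :: "nat \<Rightarrow> nat" and \<theta>\<^sub>0 :: "param \<Rightarrow> real"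
    and f\<^sub>0 :: "(nat \<Rightarrow> real) \<Rightarrow> real" and \<sigma> :: real and M :: slab
    and s N :: "nat \<Rightarrow> nat" and h :: "nat \<Rightarrow> nat \<Rightarrow> nat" and I :: "nat \<Rightarrow> param set"
    and q :: "nat \<Rightarrow> (nat \<Rightarrow> (nat \<Rightarrow> real) \<times> real) \<Rightarrow> (param \<Rightarrow> real) measure"
  defines "f\<^sub>0 \<equiv> network p L\<^sub>0 h\<^sub>0 \<theta>\<^sub>0"
    and "h \<equiv> \<lambda>n _. 12 * p * N n"
    and "I \<equiv> \<lambda>n. param_index p L (h n)"
  assumes "p \<ge> 1" and "L\<^sub>0 \<ge> 1" and "\<sigma> > 0" and "valid_slab M"
    and "l0_norm p L\<^sub>0 h\<^sub>0 \<theta>\<^sub>0 \<le> s\<^sub>0"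
    and "L = L\<^sub>0"
    and "\<And>n. s\<^sub>0 \<le> s n"
    and "\<And>n. s n \<le> card (I n)"
    and "\<And>n. real (N n) \<ge> real (Max (layer_width p L\<^sub>0 h\<^sub>0 ` {1..L\<^sub>0})) / (12 * real p)"
    and "\<And>B\<^sub>0 k. M = Uniform B\<^sub>0 \<Longrightarrow> k \<in> param_index p L\<^sub>0 h\<^sub>0 \<Longrightarrow> \<bar>\<theta>\<^sub>0 k\<bar> \<le> B\<^sub>0"
    and "(\<lambda>n. max (real L * real (s n) * ln (real p * real (N n)))
                   (real (s n) * ln (real n * real L / real (s n)))) \<in> o(\<lambda>n. real n)"
    and "\<And>n D. D \<in> space (data_dist p \<sigma> f\<^sub>0 n) \<Longrightarrow>
           is_arg_min
             (\<lambda>q'. KL q' (posterior (prior M (I n) (s n)) (\<lambda>\<theta>. likelihood \<sigma> (network p L (h n) \<theta>) n D)))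
             (\<lambda>q'. q' \<in> variational_family M (I n)) (q n D)"
  shows "\<exists>C>0. \<forall>\<delta>>1.
           with_dominating_probability (data_dist p \<sigma> f\<^sub>0)
             (\<lambda>n D. (\<integral>\<theta>. hellinger_sq p \<sigma> (network p L (h n) \<theta>) f\<^sub>0 \<partial>q n D)
                \<le> C * ((real (s n) * ln (real n * real L / real (s n))
                         + real L * real (s n) * ln (real p * real (N n))) / real n
                       * ln (real n) powr (2 * \<delta>)))"
proof -
  note p = assms(4) and L\<^sub>0 = assms(5) and \<sigma> = assms(6) and M = assms(7) and sparse = assms(8)
    and L_eq = assms(9) and s\<^sub>0_le = assms(10) and s_le = assms(11) and N_ge = assms(12)
    and uniform = assms(13) and growth = assms(14) and argmin = assms(15)
  have L: "1 \<le> L" using L\<^sub>0 L_eq by simp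
  define risk where "risk n D = (\<integral>\<theta>. hellinger_sq p \<sigma> (network p L (h n) \<theta>) f\<^sub>0 \<partial>q n D)" for n D
  define r where "r n = real (s n) * ln (real n * real L / real (s n)) + real L * real (s n) * ln (real p * real (N n))" for n
  define J\<^sub>0 where "J\<^sub>0 = param_index p L h\<^sub>0"
  define \<theta> where "\<theta> = pad_params J\<^sub>0 \<theta>\<^sub>0"
  define W where "W n = 12 * p * N n" for n
  have teacher_width: "layer_width p L h\<^sub>0 l \<le> W n" if "l \<in> {1..L}" for l n
  proof -
    have "layer_width p L h\<^sub>0 l \<le> Max (layer_width p L\<^sub>0 h\<^sub>0 ` {1..L\<^sub>0})"
      using that L_eq by (intro Max_ge) auto
    moreover have "real (Max (layer_width p L\<^sub>0 h\<^sub>0 ` {1..L\<^sub>0})) \<le> real (W n)"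
      using N_ge[of n] p by (simp add: W_def field_simps)
    ultimately show ?thesis by linarith
  qed
  have W: "1 \<le> W n" for n
    using teacher_width[of L n] L by (simp add: layer_width_def)
  then have N: "1 \<le> N n" for n by (metis W_def mult_0_right not_one_le_zero less_one not_less)
  have pN: "1 \<le> p * N n" for n using p N[of n] by simp
  have width: "layer_width p L (h n) l \<le> W n" for n l
    using W[of n] N[of n] by (simp add: layer_width_def h_def W_def)
  have wider: "layer_width p L h\<^sub>0 l \<le> layer_width p L (h n) l" if "l \<le> L" for n l
    using teacher_width[of l n] that by (auto simp: layer_width_def h_def W_def)
  have fin\<^sub>0: "finite J\<^sub>0"
    unfolding J\<^sub>0_def by (rule finite_param_index[where W = "max p (W 0)"])
      (metis atLeastAtMost_iff layer_width_def less_one linorder_not_le max.coboundedI1 max.coboundedI2 order_refl teacher_width)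
  have J\<^sub>0_sub: "J\<^sub>0 \<subseteq> I n" for n
    unfolding J\<^sub>0_def I_def by (rule param_index_mono[OF wider])
  have f\<^sub>0: "f\<^sub>0 = network p L (h n) \<theta>" for n
    unfolding f\<^sub>0_def \<theta>_def J\<^sub>0_def L_eq[symmetric]
    by (rule ext) (rule network_pad_params[symmetric, OF wider L], simp)
  \<comment> \<open>A bound for the teacher's parameters that is the same for all sample sizes.\<close>
  define T where "T = 1 + (\<Sum>k\<in>J\<^sub>0. \<bar>\<theta>\<^sub>0 k\<bar>)"
  have T: "1 \<le> T" unfolding T_def by (simp add: sum_nonneg)
  have \<theta>_le: "\<bar>\<theta> k\<bar> \<le> T" for k
  proof (cases "k \<in> J\<^sub>0")
    case True
    then have "\<bar>\<theta>\<^sub>0 k\<bar> \<le> (\<Sum>k\<in>J\<^sub>0. \<bar>\<theta>\<^sub>0 k\<bar>)" using fin\<^sub>0 by (intro member_le_sum) auto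
    then show ?thesis using True by (simp add: \<theta>_def pad_params_def T_def)
  qed (use T in \<open>simp add: \<theta>_def pad_params_def\<close>)
  have \<theta>_uniform: "\<bar>\<theta> k\<bar> \<le> B" if "M = Uniform B" for k B
    using uniform[OF that, of k] M that by (simp add: \<theta>_def pad_params_def J\<^sub>0_def L_eq)
  have \<theta>_sparse: "card {k \<in> I n. \<theta> k \<noteq> 0} \<le> s n" for n
  proof -
    have "{k \<in> I n. \<theta> k \<noteq> 0} = {k \<in> J\<^sub>0. \<theta>\<^sub>0 k \<noteq> 0}"
      using J\<^sub>0_sub[of n] by (auto simp: \<theta>_def pad_params_def)
    also have "card \<dots> \<le> s\<^sub>0" using sparse by (simp add: l0_norm_def J\<^sub>0_def L_eq)
    finally show ?thesis using s\<^sub>0_le[of n] by simp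
  qed
  have fin: "finite (I n)" for n unfolding I_def by (rule finite_param_index[OF width])
  have student: "sparse_student p L n (W n) (s n) (h n) \<sigma> M \<theta> T" if "1 \<le> n" for n
    by unfold_locales
      (use that L W width \<sigma> M s_le T \<theta>_le \<theta>_sparse \<theta>_uniform in \<open>auto simp: I_def\<close>)
  obtain C\<^sub>t where C\<^sub>t: "0 \<le> C\<^sub>t"
    "\<And>b. 0 \<le> b \<Longrightarrow> emeasure (slab_dist M) {x. b < \<bar>x\<bar>} \<le> ennreal (C\<^sub>t * exp (- b))"
    using slab_dist_tail[OF M] by metis
  show ?thesis
  proof (rule sparse_competitor[OF M, of T])
    fix K :: real and C :: "nat \<Rightarrow> real"
    assume K: "0 < K" and C: "\<And>j. 0 \<le> C j"
      and comp: "\<And>I s \<theta> \<tau>. finite I \<Longrightarrow> s \<le> card I \<Longrightarrow> card {k \<in> I. \<theta> k \<noteq> 0} \<le> s \<Longrightarrow>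
      (\<And>k. k \<in> I \<Longrightarrow> \<bar>\<theta> k\<bar> \<le> T) \<Longrightarrow> (\<And>B k. M = Uniform B \<Longrightarrow> k \<in> I \<Longrightarrow> \<bar>\<theta> k\<bar> \<le> B) \<Longrightarrow>
      0 < \<tau> \<Longrightarrow> \<tau> \<le> 1 \<Longrightarrow> has_sparse_competitor M I s \<theta> K C \<tau>"
    define c where "c = max 1 (T ^ (2 * L) * C 1 + C (L + 1))"
    have c: "1 \<le> c" "T ^ (2 * L) * C 1 + C (L + 1) \<le> c" by (auto simp: c_def)
    define R where "R = risk_constant L T K c \<sigma>"
    have R: "0 < R" unfolding R_def by (rule risk_constant_pos)
    define err where "err n = 2 * exp (\<sigma>\<^sup>2 / 2) / real n + 1 / real n + C\<^sub>t * exp (- real n)" for n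
    have "\<exists>A. A \<in> sets (data_dist p \<sigma> f\<^sub>0 n) \<and> 1 - err n \<le> measure (data_dist p \<sigma> f\<^sub>0 n) A \<and>
        (\<forall>D\<in>A. risk n D
          \<le> R * (real (s n) * (1 + ln (real n * real (W n)))) / real n)" if n: "1 \<le> n" for n
    proof -
      interpret S: sparse_student p L n "W n" "s n" "h n" \<sigma> M \<theta> T by (rule student[OF n])
      have comp': "has_sparse_competitor M (param_index p L (h n)) (s n) \<theta> K C \<tau>"
        if "0 < \<tau>" "\<tau> \<le> 1" for \<tau>
      proof (rule comp[OF S.finite_I _ _ \<theta>_le _ that])
        show "s n \<le> card (param_index p L (h n))" using s_le[of n] by (simp add: I_def)
        show "card {k \<in> param_index p L (h n). \<theta> k \<noteq> 0} \<le> s n" using \<theta>_sparse[of n] by (simp add: I_def)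
      qed (rule \<theta>_uniform)
      have "\<exists>A. A \<in> sets (data_dist p \<sigma> f\<^sub>0 n) \<and> 1 - err n \<le> measure (data_dist p \<sigma> f\<^sub>0 n) A \<and>
        (\<forall>D q'. D \<in> A \<longrightarrow>
          is_arg_min (\<lambda>q'. KL q' (posterior (prior M (param_index p L (h n)) (s n)) (\<lambda>\<theta>. likelihood \<sigma> (network p L (h n) \<theta>) n D)))
            (\<lambda>q'. q' \<in> variational_family M (param_index p L (h n))) q' \<longrightarrow>
          (\<integral>\<theta>. hellinger_sq p \<sigma> (network p L (h n) \<theta>) f\<^sub>0 \<partial>q')
            \<le> R * (real (s n) * (1 + ln (real n * real (W n)))) / real n)"
        by (rule S.student_bound_explicit[OF C\<^sub>t K C c comp', folded R_def err_def f\<^sub>0[of n]])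
      then obtain A where A: "A \<in> sets (data_dist p \<sigma> f\<^sub>0 n)" "1 - err n \<le> measure (data_dist p \<sigma> f\<^sub>0 n) A"
        and bound: "\<forall>D q'. D \<in> A \<longrightarrow>
          is_arg_min (\<lambda>q'. KL q' (posterior (prior M (param_index p L (h n)) (s n)) (\<lambda>\<theta>. likelihood \<sigma> (network p L (h n) \<theta>) n D)))
            (\<lambda>q'. q' \<in> variational_family M (param_index p L (h n))) q' \<longrightarrow>
          (\<integral>\<theta>. hellinger_sq p \<sigma> (network p L (h n) \<theta>) f\<^sub>0 \<partial>q')
            \<le> R * (real (s n) * (1 + ln (real n * real (W n)))) / real n"
        by (elim exE conjE)
      have "risk n D
          \<le> R * (real (s n) * (1 + ln (real n * real (W n)))) / real n" if D: "D \<in> A" for D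
      proof -
        have "D \<in> space (data_dist p \<sigma> f\<^sub>0 n)" using sets.sets_into_space[OF A(1)] D by blast
        from argmin[OF this] show ?thesis
          unfolding I_def risk_def by (rule bound[rule_format, OF D])
      qed
      with A show ?thesis by blast
    qed
    then obtain A where A: "\<And>n. 1 \<le> n \<Longrightarrow> A n \<in> sets (data_dist p \<sigma> f\<^sub>0 n)"
        "\<And>n. 1 \<le> n \<Longrightarrow> 1 - err n \<le> measure (data_dist p \<sigma> f\<^sub>0 n) (A n)"
      and bound: "\<And>n D. 1 \<le> n \<Longrightarrow> D \<in> A n \<Longrightarrow> risk n D
          \<le> R * (real (s n) * (1 + ln (real n * real (W n)))) / real n"
      by metis
    have "eventually (\<lambda>n. (1 \<le> s n \<longrightarrow> 1 \<le> ln (real n * real L / real (s n))) \<and> 3 \<le> n) sequentially"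
    proof (intro eventually_conj eventually_ge_at_top eventually_log_ratio_ge_one[OF L pN _ growth])
      show "s n \<le> 2 * L * (12 * p * N n)\<^sup>2" for n
        using s_le[of n] card_param_index_le[OF width, of n] by (simp add: I_def W_def)
    qed
    then obtain n\<^sub>0 where n\<^sub>0: "\<And>n. n\<^sub>0 \<le> n \<Longrightarrow> 1 \<le> s n \<Longrightarrow> 1 \<le> ln (real n * real L / real (s n))"
        "\<And>n. n\<^sub>0 \<le> n \<Longrightarrow> 3 \<le> n"
      unfolding eventually_sequentially by blast
    define C' where "C' = R * (3 + ln 12)"
    have "0 < C'" using R by (simp add: C'_def add_pos_nonneg)
    have rate: "R * (real (s n) * (1 + ln (real n * real (W n)))) / real n
        \<le> C' * (r n / real n * ln (real n) powr (2 * \<delta>))" if n: "n\<^sub>0 \<le> n" and \<delta>: "1 < \<delta>" for n \<delta>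
    proof (cases "s n = 0")
      case False
      have n3: "3 \<le> n" using n\<^sub>0(2)[OF n] .
      have "exp 1 \<le> real n" using exp_le n3 by linarith
      then have "ln (exp 1) \<le> ln (real n)" by (intro ln_mono) auto
      then have ln_n: "1 \<le> ln (real n)" by simp
      have one: "1 \<le> ln (real n * real L / real (s n))" using n\<^sub>0(1)[OF n] False by simp
      have pN': "1 \<le> real p * real (N n)" using pN[of n] by (metis of_nat_1 of_nat_le_iff of_nat_mult)
      have r: "0 \<le> r n" unfolding r_def using one pN' by (intro add_nonneg_nonneg mult_nonneg_nonneg) auto
      have "real (s n) * (1 + ln (real n * real (W n))) \<le> (3 + ln 12) * (r n * ln (real n))"
        using log_rate_le[of "real (s n)" "real n" "real p * real (N n)" "real L"] n3 ln_n one pN' L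
        by (simp add: W_def r_def mult.assoc)
      also have "\<dots> \<le> (3 + ln 12) * (r n * ln (real n) powr (2 * \<delta>))"
      proof (intro mult_left_mono r)
        have "ln (real n) powr 1 \<le> ln (real n) powr (2 * \<delta>)" using ln_n \<delta> by (intro powr_mono) auto
        then show "ln (real n) \<le> ln (real n) powr (2 * \<delta>)" using ln_n by simp
      qed (simp add: add_nonneg_nonneg)
      finally have "R * (real (s n) * (1 + ln (real n * real (W n)))) \<le> R * ((3 + ln 12) * (r n * ln (real n) powr (2 * \<delta>)))"
        using R by (intro mult_left_mono) auto
      then have "R * (real (s n) * (1 + ln (real n * real (W n)))) / real n
          \<le> R * ((3 + ln 12) * (r n * ln (real n) powr (2 * \<delta>))) / real n"
        by (rule divide_right_mono) simp
      then show ?thesis by (simp add: C'_def mult.assoc)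
    qed (simp add: r_def)
    \<comment> \<open>The bound is only claimed from \<open>n\<^sub>0\<close> on; the empty event takes care of smaller sample sizes.\<close>
    define A' where "A' n = (if n\<^sub>0 \<le> n then A n else {})" for n
    have event: "with_dominating_probability (data_dist p \<sigma> f\<^sub>0)
             (\<lambda>n D. risk n D \<le> C' * (r n / real n * ln (real n) powr (2 * \<delta>)))" if \<delta>: "1 < \<delta>" for \<delta>
      unfolding with_dominating_probability_def
    proof (intro exI[of _ A'] conjI allI ballI)
      fix n
      show "A' n \<in> sets (data_dist p \<sigma> f\<^sub>0 n)"
        using A(1)[of n] n\<^sub>0(2)[of n] by (auto simp: A'_def)
      fix D assume "D \<in> A' n"
      then have n: "n\<^sub>0 \<le> n" and D: "D \<in> A n" by (auto simp: A'_def split: if_splits)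
      have "1 \<le> n" using n\<^sub>0(2)[OF n] by simp
      from order_trans[OF bound[OF this D] rate[OF n \<delta>]]
      show "risk n D \<le> C' * (r n / real n * ln (real n) powr (2 * \<delta>))" .
    next
      have err: "(\<lambda>n. 1 - err n) \<longlonglongrightarrow> 1"
      proof -
        have e: "(\<lambda>n. exp (- real n)) \<longlonglongrightarrow> 0"
          by (rule filterlim_compose[OF exp_at_bot])
            (simp only: filterlim_uminus_at_bot minus_minus filterlim_real_sequentially)
        have "(\<lambda>n. 1 - (2 * exp (\<sigma>\<^sup>2 / 2) / real n + 1 / real n + C\<^sub>t * exp (- real n)))
            \<longlonglongrightarrow> 1 - (0 + 0 + C\<^sub>t * 0)"
          by (intro tendsto_diff tendsto_add tendsto_mult tendsto_const lim_const_over_n e)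
        then show ?thesis by (simp only: err_def add_0_right mult_zero_right diff_zero)
      qed
      show "(\<lambda>n. measure (data_dist p \<sigma> f\<^sub>0 n) (A' n)) \<longlonglongrightarrow> 1"
      proof (rule tendsto_sandwich[OF _ _ err tendsto_const])
        show "\<forall>\<^sub>F n in sequentially. 1 - err n \<le> measure (data_dist p \<sigma> f\<^sub>0 n) (A' n)"
          using eventually_ge_at_top[of n\<^sub>0]
        proof eventually_elim
          fix n assume n: "n\<^sub>0 \<le> n"
          then have "1 \<le> n" using n\<^sub>0(2)[OF n] by simp
          then show "1 - err n \<le> measure (data_dist p \<sigma> f\<^sub>0 n) (A' n)" using A(2) n by (simp add: A'_def)
        qed
        show "\<forall>\<^sub>F n in sequentially. measure (data_dist p \<sigma> f\<^sub>0 n) (A' n) \<le> 1"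
          using eventually_ge_at_top[of 1]
        proof eventually_elim
          fix n :: nat assume "1 \<le> n"
          then interpret S: sparse_student p L n "W n" "s n" "h n" \<sigma> M \<theta> T by (rule student)
          interpret prob_space "data_dist p \<sigma> f\<^sub>0 n"
            unfolding f\<^sub>0[of n] by (rule S.reg.prob_space_data_dist)
          show "measure (data_dist p \<sigma> f\<^sub>0 n) (A' n) \<le> 1" by (rule prob_le_1)
        qed
      qed
    qed
    show ?thesis
      using event \<open>0 < C'\<close> unfolding risk_def r_def by blast
  qed
qed

end
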